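(* Let $I\subset R=\mathbb{k}[x,y,z]$ be an ideal as in the setting described in the context, with presentation matrix $\varphi$ in Case I, and suppose that $\varphi'$ is strictly equivalent to $[L'_{n-3}\ M_1]$ with $M_1=[ax+by]$, $a,b\in\mathbb{k}$, with $\varphi$ written so that $\varphi'$ equals this block diagonal matrix. Let $B$, $\overline{\mathcal K}$, $B(\varphi'')$ and $\mathfrak{a}_1,\dots,\mathfrak{a}_{n-3}$ be as in the context, and define the $B$-ideal $$N_3=(\overline{z^2w_0^2})+\big(\{\overline{-aw_{n-1}\mathfrak{a}_{i+1}+bw_{n-1}\mathfrak{a}_i}\ :\ 1\le i\le n-4\}\big).$$ If $w_0\notin I_2(B(\varphi''))$, then $\overline{\mathcal K}^{(2)}=N_3$.
   Context: Setting. $\mathbb{k}$ is an algebraically closed field, $R=\mathbb{k}[x,y,z]$, $\mathfrak{m}=(x,y,z)$. $I\subset R$ is an ideal such that: $I$ is a height two perfect ideal; $I=(f_1,\dots,f_n)$ is generated by homogeneous elements of the same degree with $\mu(I)=n>4$; its presentation matrix $\varphi$ is $n\times(n-1)$ and almost linear, i.e. all columns except the last have linear entries and the entries of the last column are homogeneous of degree $2$; $I_1(\varphi)=\mathfrak{m}$; after a change of variables, $\varphi$ has rank at most $1$ modulo the prime ideal generated by two of the variables; $I$ satisfies $(G_2)$ but not $(G_3)$. Here $I$ satisfies $(G_s)$ if $\mu(I_{\mathfrak p})\le \operatorname{ht}\mathfrak p$ for all $\mathfrak p\in V(I)$ with $\operatorname{ht}\mathfrak p\le s-1$; $\mu$ is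 the minimal number of generators and $I_i(\cdot)$ is the ideal of $i\times i$ minors. Case I. (After a change of variables and elementary row and column operations) the first row of $\varphi$ is $( *,\dots,*,z,*')$ with $z$ in column $n-2$; the block $\varphi'$ formed by the last $n-1$ rows and first $n-2$ columns has entries linear forms in $\mathbb{k}[x,y]$; the entries $*$ are linear forms in $\mathbb{k}[x,y]$; all entries of the last column are homogeneous of degree $2$ in $\mathbb{k}[x,y,z]$ with no $z^2$ term; and $l_{n-1}\in(x,y,zw_0)^2$. Blocks. Two matrices $M,M'$ of linear forms in $\mathbb{k}[x,y]$ are strictly equivalent if $M'=CMD$ with $C,D$ invertible over $\mathbb{k}$. $L_m$ is the $m\times(m+1)$ matrix with $x$ in positions $(i,i)$, $y$ in positions $(i,i+1)$ and zeros elsewhere; $L'_m=L_m^t$. $[P\ Q]$ denotes the block diagonal matrix with blocks $P,Q$. Notation. $S=\mathbb{k}[x,y,z,w_0,\dots,w_{n-1}]$, $[l_1,\dots,l_{n-1}]=[w_0,\dots,w_{n-1}]\cdot\varphi$, $\mathcal J=(l_1,\dots,l_{n-2}):_S(x,y,zw_0)$, $B=S/\mathcal J$ (a Cohen-Macaulay domain), bars denote images in $B$. $\varphi''$ consists of the first $n-2$ columns of $\varphi$; $B(\varphi'')$ is the $3\times(n-2)$ matrix with entries in $\mathbb{k}[w_0,\dots,w_{n-1}]$ such that $[l_1,\dots,l_{n-2}]=[x,\ y,\ zw_0]\cdot B(\varphi'')$ (its last row is $(0,\dots,0,1)$). $A$ is $B(\varphi'')$ with the last row deleted. For $1\le i\le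 n-3$, $\mathfrak{a}_i$ is the determinant of the $2\times2$ matrix whose first column is the $i$-th column of $A$ and whose second column is the $(n-2)$-th column of $A$. $\mathcal{K}=(l_1,\dots,l_{n-2})+I_2(A)+(zw_0)$, and $\overline{\mathcal{K}}^{(2)}=\bigcap_{P\in\operatorname{Ass}(B/\overline{\mathcal K})}(\overline{\mathcal K}^2B_P\cap B)$. *)

theory Defs
  imports
    "HOL-Library.Poly_Mapping"
    "HOL-Library.Extended_Nat"
    "HOL-Computational_Algebra.Polynomial"
    "HOL-Algebra.QuotRing"
    "HOL-Algebra.Ideal_Product"
    "HOL-Algebra.Module"
    "Jordan_Normal_Form.Determinant"
    "Jordan_Normal_Form.DL_Submatrix"
begin

section \<open>Polynomial rings in finitely many variables\<close>

datatype var = Vx | Vy | Vz | Vw nat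

text \<open>All polynomials live in one type; a particular polynomial ring is the subring
  of the polynomials involving only a prescribed set of variables. In this way
  $k[x,y]$, $k[x,y,z]$ and $k[w_0,\ldots,w_{n-1}]$ are literally subrings of
  $k[x,y,z,w_0,\ldots,w_{n-1}]$.\<close>

type_synonym 'k mpoly = "(var \<Rightarrow>\<^sub>0 nat) \<Rightarrow>\<^sub>0 'k"

definition pvar :: "var \<Rightarrow> 'k::comm_ring_1 mpoly" where
  "pvar v = Poly_Mapping.single (Poly_Mapping.single v 1) 1"

definition pconst :: "'k::comm_ring_1 \<Rightarrow> 'k mpoly" where
  "pconst c = Poly_Mapping.single 0 c"

abbreviation px :: "'k::comm_ring_1 mpoly" where "px \<equiv> pvar Vx"
abbreviation py :: "'k::comm_ring_1 mpoly" where "py \<equiv> pvar Vy"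
abbreviation pz :: "'k::comm_ring_1 mpoly" where "pz \<equiv> pvar Vz"
abbreviation pw :: "nat \<Rightarrow> 'k::comm_ring_1 mpoly" where "pw i \<equiv> pvar (Vw i)"

definition vars :: "'k::comm_ring_1 mpoly \<Rightarrow> var set" where
  "vars p = (\<Union>m \<in> Poly_Mapping.keys p. Poly_Mapping.keys m)"

definition poly_ring :: "var set \<Rightarrow> 'k::comm_ring_1 mpoly ring" where
  "poly_ring V = \<lparr>carrier = {p. vars p \<subseteq> V},
     monoid.mult = (*), one = 1, zero = 0, add = (+)\<rparr>"

definition mdeg :: "(var \<Rightarrow>\<^sub>0 nat) \<Rightarrow> nat" where
  "mdeg m = (\<Sum>v \<in> Poly_Mapping.keys m. Poly_Mapping.lookup m v)"

text \<open>The zero polynomial is homogeneous of every degree.\<close>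

definition homogeneous :: "nat \<Rightarrow> 'k::comm_ring_1 mpoly \<Rightarrow> bool" where
  "homogeneous d p \<longleftrightarrow> (\<forall>m \<in> Poly_Mapping.keys p. mdeg m = d)"

definition linear_form_xy :: "'k::comm_ring_1 mpoly \<Rightarrow> bool" where
  "linear_form_xy p \<longleftrightarrow> p \<in> carrier (poly_ring {Vx, Vy}) \<and> homogeneous 1 p"

abbreviation Rxyz :: "'k::comm_ring_1 mpoly ring" where
  "Rxyz \<equiv> poly_ring {Vx, Vy, Vz}"

abbreviation Sring :: "nat \<Rightarrow> 'k::comm_ring_1 mpoly ring" where
  "Sring n \<equiv> poly_ring ({Vx, Vy, Vz} \<union> Vw ` {..<n})"

section \<open>Commutative algebra\<close>

definition colon_ideal :: "('a, 'b) ring_scheme \<Rightarrow> 'a set \<Rightarrow> 'a set \<Rightarrow> 'a set" where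
  "colon_ideal R I J = {r \<in> carrier R. \<forall>t \<in> J. r \<otimes>\<^bsub>R\<^esub> t \<in> I}"

text \<open>\<open>fraction R P a s\<close> is the class of $a/s$ in the localization $R_P$.\<close>

definition fraction :: "('a, 'b) ring_scheme \<Rightarrow> 'a set \<Rightarrow> 'a \<Rightarrow> 'a \<Rightarrow> ('a \<times> 'a) set" where
  "fraction R P a s = {(b, t). b \<in> carrier R \<and> t \<in> carrier R - P \<and>
     (\<exists>u \<in> carrier R - P. u \<otimes>\<^bsub>R\<^esub> (a \<otimes>\<^bsub>R\<^esub> t) = u \<otimes>\<^bsub>R\<^esub> (b \<otimes>\<^bsub>R\<^esub> s))}"

text \<open>The unions below run over all representatives of the two classes; since every pair of
  representatives yields the same class, their value is that class.\<close>

definition localization :: "('a, 'b) ring_scheme \<Rightarrow> 'a set \<Rightarrow> ('a \<times> 'a) set ring" where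
  "localization R P =
    \<lparr>carrier = {fraction R P a s | a s. a \<in> carrier R \<and> s \<in> carrier R - P},
     monoid.mult = (\<lambda>F G. \<Union>(a, s) \<in> F. \<Union>(b, t) \<in> G. fraction R P (a \<otimes>\<^bsub>R\<^esub> b) (s \<otimes>\<^bsub>R\<^esub> t)),
     one = fraction R P \<one>\<^bsub>R\<^esub> \<one>\<^bsub>R\<^esub>,
     zero = fraction R P \<zero>\<^bsub>R\<^esub> \<one>\<^bsub>R\<^esub>,
     add = (\<lambda>F G. \<Union>(a, s) \<in> F. \<Union>(b, t) \<in> G.
        fraction R P (a \<otimes>\<^bsub>R\<^esub> t \<oplus>\<^bsub>R\<^esub> b \<otimes>\<^bsub>R\<^esub> s) (s \<otimes>\<^bsub>R\<^esub> t))\<rparr>"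

definition localized_ideal ::
    "('a, 'b) ring_scheme \<Rightarrow> 'a set \<Rightarrow> 'a set \<Rightarrow> ('a \<times> 'a) set set" where
  "localized_ideal R P I = genideal (localization R P) ((\<lambda>r. fraction R P r \<one>\<^bsub>R\<^esub>) ` I)"

definition loc_contraction ::
    "('a, 'b) ring_scheme \<Rightarrow> 'a set \<Rightarrow> ('a \<times> 'a) set set \<Rightarrow> 'a set" where
  "loc_contraction R P L = {r \<in> carrier R. fraction R P r \<one>\<^bsub>R\<^esub> \<in> L}"

definition Ass_quot :: "('a, 'b) ring_scheme \<Rightarrow> 'a set \<Rightarrow> 'a set set" where
  "Ass_quot R I = {P. primeideal P R \<and>
     (\<exists>c \<in> carrier R. P = {r \<in> carrier R. r \<otimes>\<^bsub>R\<^esub> c \<in> I})}"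

definition symbolic_square :: "('a, 'b) ring_scheme \<Rightarrow> 'a set \<Rightarrow> 'a set" where
  "symbolic_square R I = carrier R \<inter>
     (\<Inter>P \<in> Ass_quot R I. loc_contraction R P (localized_ideal R P (ideal_prod R I I)))"

definition min_gens :: "('a, 'b) ring_scheme \<Rightarrow> 'a set \<Rightarrow> enat" where
  "min_gens R I = Inf {enat (card A) | A. finite A \<and> A \<subseteq> carrier R \<and> genideal R A = I}"

definition prime_height :: "('a, 'b) ring_scheme \<Rightarrow> 'a set \<Rightarrow> enat" where
  "prime_height R P = Sup {enat k | k. \<exists>C :: nat \<Rightarrow> 'a set.
     (\<forall>i \<le> k. primeideal (C i) R) \<and> (\<forall>i < k. C i \<subset> C (Suc i)) \<and> C k = P}"

definition ideal_height :: "('a, 'b) ring_scheme \<Rightarrow> 'a set \<Rightarrow> enat" where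
  "ideal_height R I = Inf {prime_height R P | P. primeideal P R \<and> I \<subseteq> P}"

definition satisfies_G :: "nat \<Rightarrow> ('a, 'b) ring_scheme \<Rightarrow> 'a set \<Rightarrow> bool" where
  "satisfies_G s R I \<longleftrightarrow>
     (\<forall>P. primeideal P R \<and> I \<subseteq> P \<and> prime_height R P \<le> enat (s - 1) \<longrightarrow>
        min_gens (localization R P) (localized_ideal R P I) \<le> prime_height R P)"

subsection \<open>Perfect ideals\<close>

definition regular_sequence :: "('a, 'b) ring_scheme \<Rightarrow> 'a list \<Rightarrow> bool" where
  "regular_sequence R xs \<longleftrightarrow> set xs \<subseteq> carrier R \<and> genideal R (set xs) \<noteq> carrier R \<and>
     (\<forall>i < length xs. \<forall>r \<in> carrier R.
        xs ! i \<otimes>\<^bsub>R\<^esub> r \<in> genideal R (set (take i xs)) \<longrightarrow> r \<in> genideal R (set (take i xs)))"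

definition grade :: "('a, 'b) ring_scheme \<Rightarrow> 'a set \<Rightarrow> enat" where
  "grade R I = Sup {enat (length xs) | xs. set xs \<subseteq> I \<and> regular_sequence R xs}"

definition module_homs ::
    "('a, 'b) ring_scheme \<Rightarrow> ('a, 'm) module \<Rightarrow> ('a, 'n) module \<Rightarrow> ('m \<Rightarrow> 'n) set" where
  "module_homs R M N = {h \<in> carrier M \<rightarrow> carrier N.
     (\<forall>u \<in> carrier M. \<forall>v \<in> carrier M. h (u \<oplus>\<^bsub>M\<^esub> v) = h u \<oplus>\<^bsub>N\<^esub> h v) \<and>
     (\<forall>r \<in> carrier R. \<forall>u \<in> carrier M. h (r \<odot>\<^bsub>M\<^esub> u) = r \<odot>\<^bsub>N\<^esub> h u)}"

text \<open>A type has to be fixed for the modules in the lifting property. The type of sequences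
  of ring elements is large enough: every module on a subset of it is a quotient of a
  free module which again embeds into that type. Hence the lifting property below says that
  the module is a direct summand of a free module.\<close>

definition projective_module ::
    "('a, 'b) ring_scheme \<Rightarrow> ('a, nat \<Rightarrow> 'a) module \<Rightarrow> bool" where
  "projective_module R P \<longleftrightarrow> module R P \<and>
     (\<forall>(M :: ('a, nat \<Rightarrow> 'a) module) (N :: ('a, nat \<Rightarrow> 'a) module) g f.
        module R M \<and> module R N \<and> g \<in> module_homs R M N \<and> g ` carrier M = carrier N \<and>
        f \<in> module_homs R P N \<longrightarrow>
        (\<exists>h \<in> module_homs R P M. \<forall>u \<in> carrier P. g (h u) = f u))"

text \<open>Exactness of $0 \to P_d \to \cdots \to P_1 \to P_0 \to M \to 0$, where \<open>D i\<close> is the map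
  $P_{i+1} \to P_i$ and \<open>e\<close> is the augmentation $P_0 \to M$.\<close>

definition projective_resolution ::
    "('a, 'b) ring_scheme \<Rightarrow> ('a, 'm) module \<Rightarrow> nat \<Rightarrow> (nat \<Rightarrow> ('a, nat \<Rightarrow> 'a) module) \<Rightarrow>
     (nat \<Rightarrow> (nat \<Rightarrow> 'a) \<Rightarrow> (nat \<Rightarrow> 'a)) \<Rightarrow> ((nat \<Rightarrow> 'a) \<Rightarrow> 'm) \<Rightarrow> bool" where
  "projective_resolution R M d P D e \<longleftrightarrow>
     (\<forall>i. projective_module R (P i)) \<and>
     (\<forall>i > d. carrier (P i) = {\<zero>\<^bsub>P i\<^esub>}) \<and>
     e \<in> module_homs R (P 0) M \<and> e ` carrier (P 0) = carrier M \<and>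
     (\<forall>i. D i \<in> module_homs R (P (Suc i)) (P i)) \<and>
     D 0 ` carrier (P 1) = {u \<in> carrier (P 0). e u = \<zero>\<^bsub>M\<^esub>} \<and>
     (\<forall>i. D (Suc i) ` carrier (P (Suc (Suc i))) =
            {u \<in> carrier (P (Suc i)). D i u = \<zero>\<^bsub>P i\<^esub>})"

definition proj_dim :: "('a, 'b) ring_scheme \<Rightarrow> ('a, 'm) module \<Rightarrow> enat" where
  "proj_dim R M = Inf {enat d | d. \<exists>P D e. projective_resolution R M d P D e}"

definition quotient_module :: "('a, 'b) ring_scheme \<Rightarrow> 'a set \<Rightarrow> ('a, 'a set) module" where
  "quotient_module R I =
    \<lparr>carrier = carrier (R Quot I), monoid.mult = monoid.mult (R Quot I),
     one = one (R Quot I), zero = zero (R Quot I), add = add (R Quot I),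
     module.smult = (\<lambda>r C. (I +>\<^bsub>R\<^esub> r) \<otimes>\<^bsub>R Quot I\<^esub> C)\<rparr>"

definition perfect_ideal :: "('a, 'b) ring_scheme \<Rightarrow> 'a set \<Rightarrow> bool" where
  "perfect_ideal R I \<longleftrightarrow> ideal I R \<and> I \<noteq> carrier R \<and>
     proj_dim R (quotient_module R I) = grade R I"

section \<open>Matrices of polynomials\<close>

definition entries_in :: "'a mat \<Rightarrow> 'a set \<Rightarrow> bool" where
  "entries_in M E \<longleftrightarrow> (\<forall>i < dim_row M. \<forall>j < dim_col M. M $$ (i, j) \<in> E)"

definition minors_ideal ::
    "'k::comm_ring_1 mpoly ring \<Rightarrow> nat \<Rightarrow> 'k mpoly mat \<Rightarrow> 'k mpoly set" where
  "minors_ideal R r M = genideal R {det (submatrix M I J) | I J.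
     I \<subseteq> {..<dim_row M} \<and> J \<subseteq> {..<dim_col M} \<and> card I = r \<and> card J = r}"

text \<open>The rank of \<open>M\<close> modulo the prime ideal \<open>P\<close>, i.e. the size of the largest minor
  with nonzero image in the domain $R/P$.\<close>

definition rank_modulo ::
    "'k::comm_ring_1 mpoly ring \<Rightarrow> 'k mpoly set \<Rightarrow> 'k mpoly mat \<Rightarrow> nat" where
  "rank_modulo R P M = Max {r. r \<le> dim_row M \<and> \<not> minors_ideal R r M \<subseteq> P}"

text \<open>Exactness of $R^{m} \to R^n \to (f_1,\ldots,f_n) \to 0$, the first map being given by
  the $n \times m$ matrix \<open>M\<close>: the columns of \<open>M\<close> generate the syzygies of \<open>f\<close>.\<close>

definition presentation_matrix ::
    "'k::comm_ring_1 mpoly ring \<Rightarrow> 'k mpoly vec \<Rightarrow> 'k mpoly mat \<Rightarrow> bool" where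
  "presentation_matrix R f M \<longleftrightarrow> dim_row M = dim_vec f \<and> entries_in M (carrier R) \<and>
     {v \<in> carrier_vec (dim_vec f). (\<forall>i < dim_vec f. v $ i \<in> carrier R) \<and> f \<bullet> v = 0} =
     {M *\<^sub>v u | u. u \<in> carrier_vec (dim_col M) \<and> (\<forall>j < dim_col M. u $ j \<in> carrier R)}"

definition Lblock :: "nat \<Rightarrow> 'k::comm_ring_1 mpoly mat" where
  "Lblock m = mat m (m + 1) (\<lambda>(i, j). if j = i then px else if j = i + 1 then py else 0)"

section \<open>The objects attached to the presentation matrix\<close>

text \<open>Rows and columns of matrices are numbered from $0$.\<close>

text \<open>The row $[w_0,\ldots,w_{n-1}] \cdot M$.\<close>

definition l_row :: "nat \<Rightarrow> 'k::comm_ring_1 mpoly mat \<Rightarrow> 'k mpoly mat" where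
  "l_row n M = mat_of_row (vec n pw) * M"

definition l_set :: "nat \<Rightarrow> 'k::comm_ring_1 mpoly mat \<Rightarrow> 'k mpoly set" where
  "l_set n \<phi> = {l_row n \<phi> $$ (0, j) | j. j < n - 2}"

definition phi' :: "nat \<Rightarrow> 'k::comm_ring_1 mpoly mat \<Rightarrow> 'k mpoly mat" where
  "phi' n \<phi> = mat (n - 1) (n - 2) (\<lambda>(i, j). \<phi> $$ (i + 1, j))"

definition phi'' :: "nat \<Rightarrow> 'k::comm_ring_1 mpoly mat \<Rightarrow> 'k mpoly mat" where
  "phi'' n \<phi> = mat n (n - 2) (\<lambda>(i, j). \<phi> $$ (i, j))"

definition xyzw0 :: "nat \<Rightarrow> 'k::comm_ring_1 mpoly set" where
  "xyzw0 n = genideal (Sring n) {px, py, pz * pw 0}"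

definition J_ideal :: "nat \<Rightarrow> 'k::comm_ring_1 mpoly mat \<Rightarrow> 'k mpoly set" where
  "J_ideal n \<phi> = colon_ideal (Sring n) (genideal (Sring n) (l_set n \<phi>)) (xyzw0 n)"

definition B_ring :: "nat \<Rightarrow> 'k::comm_ring_1 mpoly mat \<Rightarrow> 'k mpoly set ring" where
  "B_ring n \<phi> = Sring n Quot J_ideal n \<phi>"

definition bar :: "nat \<Rightarrow> 'k::comm_ring_1 mpoly mat \<Rightarrow> 'k mpoly \<Rightarrow> 'k mpoly set" where
  "bar n \<phi> p = J_ideal n \<phi> +>\<^bsub>Sring n\<^esub> p"

text \<open>\<open>is_B_matrix n \<phi> Bm\<close> says that \<open>Bm\<close> is the matrix $B(\varphi'')$; the conditions
  determine \<open>Bm\<close> uniquely.\<close>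

definition is_B_matrix ::
    "nat \<Rightarrow> 'k::comm_ring_1 mpoly mat \<Rightarrow> 'k mpoly mat \<Rightarrow> bool" where
  "is_B_matrix n \<phi> Bm \<longleftrightarrow> Bm \<in> carrier_mat 3 (n - 2) \<and>
     entries_in Bm (carrier (poly_ring (Vw ` {..<n}))) \<and>
     l_row n (phi'' n \<phi>) = mat_of_row (vec_of_list [px, py, pz * pw 0]) * Bm"

definition A_matrix :: "nat \<Rightarrow> 'k::comm_ring_1 mpoly mat \<Rightarrow> 'k mpoly mat" where
  "A_matrix n Bm = mat 2 (n - 2) (\<lambda>(i, j). Bm $$ (i, j))"

text \<open>With columns numbered from $0$, \<open>frak_a n Bm i\<close> is $\mathfrak{a}_{i+1}$.\<close>

definition frak_a :: "nat \<Rightarrow> 'k::comm_ring_1 mpoly mat \<Rightarrow> nat \<Rightarrow> 'k mpoly" where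
  "frak_a n Bm i = det (mat 2 2 (\<lambda>(r, c). A_matrix n Bm $$ (r, if c = 0 then i else n - 3)))"

definition K_ideal ::
    "nat \<Rightarrow> 'k::comm_ring_1 mpoly mat \<Rightarrow> 'k mpoly mat \<Rightarrow> 'k mpoly set" where
  "K_ideal n \<phi> Bm = genideal (Sring n) (l_set n \<phi>)
     <+>\<^bsub>Sring n\<^esub> minors_ideal (Sring n) 2 (A_matrix n Bm)
     <+>\<^bsub>Sring n\<^esub> genideal (Sring n) {pz * pw 0}"

definition K_bar ::
    "nat \<Rightarrow> 'k::comm_ring_1 mpoly mat \<Rightarrow> 'k mpoly mat \<Rightarrow> 'k mpoly set set" where
  "K_bar n \<phi> Bm = bar n \<phi> ` K_ideal n \<phi> Bm"

definition N3_ideal ::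
    "nat \<Rightarrow> 'k::comm_ring_1 mpoly mat \<Rightarrow> 'k mpoly mat \<Rightarrow> 'k \<Rightarrow> 'k \<Rightarrow> 'k mpoly set set" where
  "N3_ideal n \<phi> Bm a b =
     genideal (B_ring n \<phi>) {bar n \<phi> (pz ^ 2 * pw 0 ^ 2)}
     <+>\<^bsub>B_ring n \<phi>\<^esub>
     genideal (B_ring n \<phi>)
       {bar n \<phi> (- pconst a * pw (n - 1) * frak_a n Bm (i + 1)
                 + pconst b * pw (n - 1) * frak_a n Bm i) | i. i < n - 4}"

text \<open>The normal form of Case I. Modulo $x, y$ only the entry $z$ of the first row survives.\<close>

definition case_I :: "nat \<Rightarrow> 'k::comm_ring_1 mpoly mat \<Rightarrow> bool" where
  "case_I n \<phi> \<longleftrightarrow>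
     (\<forall>j < n - 3. linear_form_xy (\<phi> $$ (0, j))) \<and>
     \<phi> $$ (0, n - 3) = pz \<and>
     (\<forall>i < n - 1. \<forall>j < n - 2. linear_form_xy (phi' n \<phi> $$ (i, j))) \<and>
     (\<forall>i < n. \<phi> $$ (i, n - 2) \<in> carrier Rxyz \<and> homogeneous 2 (\<phi> $$ (i, n - 2)) \<and>
        Poly_Mapping.lookup (\<phi> $$ (i, n - 2)) (Poly_Mapping.single Vz 2) = 0) \<and>
     l_row n \<phi> $$ (0, n - 2) \<in> ideal_prod (Sring n) (xyzw0 n) (xyzw0 n)"

end

theory Submission
  imports Defs
begin

text \<open>Let \<open>m = n - 3\<close> and \<open>w = w\<^sub>n\<^sub>-\<^sub>1\<close>. The hypothesis \<open>w\<^sub>0 \<notin> I\<^sub>2(B(\<phi>''))\<close> forces the two rows of the first \<open>m\<close>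
  columns of \<open>A\<close> to be shifts of one sequence: there are linear forms \<open>t\<^sub>j = w\<^sub>j\<^sub>+\<^sub>1 + \<gamma>\<^sub>j w\<^sub>0\<close> such that these
  columns are \<open>(t\<^sub>j, t\<^sub>j\<^sub>+\<^sub>1)\<close>, and the last column is \<open>(a w, b w)\<close>. Hence \<open>l\<^sub>j = x t\<^sub>j + y t\<^sub>j\<^sub>+\<^sub>1\<close> and the last form is
  \<open>z w\<^sub>0 + (ax + by) w\<close>. Moreover \<open>(a, b) \<noteq> 0\<close>, because otherwise a column of \<open>\<phi>\<close> has \<open>z\<close> as its only nonzero
  entry, the first generator of the ideal vanishes, and fewer than \<open>n\<close> elements generate it.

  The forms \<open>l\<^sub>j\<close> and the minors of the \<open>t\<close>'s define the cone over a rational normal scroll,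
  \<open>x = \<lambda> \<sigma>\<close>, \<open>y = - \<lambda> \<tau>\<close>, \<open>t\<^sub>j = \<rho> \<sigma>\<^sup>j \<tau>\<^sup>m\<^sup>-\<^sup>j\<close>. Choose a basis \<open>\<epsilon> = a \<sigma> - b \<tau>\<close>, \<open>\<eta>\<close> of the span of \<open>\<sigma>, \<tau>\<close>. Then
  \<open>ax + by = \<lambda> \<epsilon>\<close>, and the remaining relation \<open>z w\<^sub>0 = - \<lambda> \<epsilon> w\<close> is solved by splitting
  \<open>\<lambda> = \<lambda>\<^sub>1 \<lambda>\<^sub>2\<close>, \<open>\<epsilon> = \<epsilon>\<^sub>1 \<epsilon>\<^sub>2\<close>, \<open>w = \<omega>\<^sub>1 \<omega>\<^sub>2\<close> and setting \<open>z = \<lambda>\<^sub>1 \<epsilon>\<^sub>1 \<omega>\<^sub>1\<close>, \<open>w\<^sub>0 = - \<lambda>\<^sub>2 \<epsilon>\<^sub>2 \<omega>\<^sub>2\<close>. This embeds \<open>B\<close> into a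
  polynomial ring in eight coordinates as the span of the monomials that have degree zero for three
  gradings. That \<open>J\<close> is exactly the kernel (\<open>J_eq_kernel\<close>) is shown with a linear section: each such monomial
  is lifted to a normal form, and multiplication by each of the generators respects the lifts
  modulo \<open>J\<close>.

  In these coordinates \<open>K\<close> consists of the elements divisible by \<open>\<epsilon>\<^sub>1 \<epsilon>\<^sub>2 \<omega>\<^sub>1 \<omega>\<^sub>2\<close>, and \<open>N\<^sub>3\<close> of those divisible by
  its square (\<open>lift_mem_1\<close>, \<open>lift_mem_2\<close>); both are statements about exponents. The four coordinates
  give associated primes of \<open>K\<close>, and orders of vanishing are additive, so the symbolic square is
  contained in \<open>N\<^sub>3\<close>. In the other direction the element \<open>h = \<lambda> \<eta>\<close> lies in no associated prime of \<open>K\<close> and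
  carries \<open>N\<^sub>3\<close> into \<open>K\<^sup>2\<close> (\<open>symbolic_square_eq_N3\<close>).\<close>

section \<open>Localization at a prime ideal\<close>

locale localized = cring R + primeideal P R for R (structure) and P
begin

abbreviation "cP \<equiv> carrier R - P"

lemma one_not_in_P: "\<one> \<in> cP"
  using I_notcarr one_imp_carrier by auto

lemma mult_not_in_P: "s \<in> cP \<Longrightarrow> t \<in> cP \<Longrightarrow> s \<otimes> t \<in> cP"
  using I_prime by auto

text \<open>Equality of fractions is transitive: the multipliers \<open>u, v\<close> of two equations with the common
  denominator \<open>s\<close> combine to \<open>u v s\<close>.\<close>

lemma fraction_eqI:
  assumes c: "a \<in> carrier R" "b \<in> carrier R" "s \<in> cP" "t \<in> cP" "u \<in> cP"
    and e: "u \<otimes> (a \<otimes> t) = u \<otimes> (b \<otimes> s)"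
  shows "fraction R P a s = fraction R P b t"
proof -
  have sub: "fraction R P a s \<subseteq> fraction R P b t"
    if c: "a \<in> carrier R" "b \<in> carrier R" "s \<in> cP" "t \<in> cP" "u \<in> cP"
      and e: "u \<otimes> (a \<otimes> t) = u \<otimes> (b \<otimes> s)" for a b s t u
  proof
    fix x assume "x \<in> fraction R P a s"
    then obtain d r v where x: "x = (d, r)" and d: "d \<in> carrier R" "r \<in> cP" "v \<in> cP"
      and v: "v \<otimes> (a \<otimes> r) = v \<otimes> (d \<otimes> s)"
      by (auto simp: fraction_def)
    have cc: "a \<in> carrier R" "b \<in> carrier R" "s \<in> carrier R" "t \<in> carrier R" "u \<in> carrier R"
      "d \<in> carrier R" "r \<in> carrier R" "v \<in> carrier R" using c d by auto
    have "(u \<otimes> v \<otimes> s) \<otimes> (b \<otimes> r) = v \<otimes> r \<otimes> (u \<otimes> (b \<otimes> s))" using cc by algebra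
    also have "\<dots> = v \<otimes> r \<otimes> (u \<otimes> (a \<otimes> t))" using e by simp
    also have "\<dots> = u \<otimes> t \<otimes> (v \<otimes> (a \<otimes> r))" using cc by algebra
    also have "\<dots> = u \<otimes> t \<otimes> (v \<otimes> (d \<otimes> s))" using v by simp
    also have "\<dots> = (u \<otimes> v \<otimes> s) \<otimes> (d \<otimes> t)" using cc by algebra
    finally show "x \<in> fraction R P b t"
      using c d mult_not_in_P unfolding x fraction_def by blast
  qed
  show ?thesis using sub[OF c e] sub[OF c(2,1,4,3,5) e[symmetric]] by auto
qed

lemma self_in_fraction: "a \<in> carrier R \<Longrightarrow> s \<in> cP \<Longrightarrow> (a, s) \<in> fraction R P a s"
  using one_not_in_P unfolding fraction_def by blast

lemma fraction_eqD:
  assumes "b \<in> carrier R" "t \<in> cP" "fraction R P a s = fraction R P b t"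
  shows "\<exists>u\<in>cP. u \<otimes> (a \<otimes> t) = u \<otimes> (b \<otimes> s)"
  using self_in_fraction[OF assms(1,2)] unfolding assms(3)[symmetric] by (simp add: fraction_def)

text \<open>Unions over all representatives collapse, so the operations of the localization are the
  usual ones on fractions.\<close>

lemma UN_fraction_collapse:
  assumes "a \<in> carrier R" "s \<in> cP" "b \<in> carrier R" "t \<in> cP"
    and "\<And>a' s' b' t'. (a', s') \<in> fraction R P a s \<Longrightarrow> (b', t') \<in> fraction R P b t
      \<Longrightarrow> F a' s' b' t' = F a s b t"
  shows "(\<Union>(a', s') \<in> fraction R P a s. \<Union>(b', t') \<in> fraction R P b t. F a' s' b' t') = F a s b t"
  using self_in_fraction[OF assms(1,2)] self_in_fraction[OF assms(3,4)] assms(5) by fast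

lemma fraction_mult:
  assumes "a \<in> carrier R" "s \<in> cP" "b \<in> carrier R" "t \<in> cP"
  shows "fraction R P a s \<otimes>\<^bsub>localization R P\<^esub> fraction R P b t = fraction R P (a \<otimes> b) (s \<otimes> t)"
  unfolding localization_def monoid.simps
proof (rule UN_fraction_collapse[OF assms])
  fix a' s' b' t' assume "(a', s') \<in> fraction R P a s" "(b', t') \<in> fraction R P b t"
  then obtain u v where c: "a' \<in> carrier R" "s' \<in> cP" "u \<in> cP" "b' \<in> carrier R" "t' \<in> cP" "v \<in> cP"
    and u: "u \<otimes> (a \<otimes> s') = u \<otimes> (a' \<otimes> s)" and v: "v \<otimes> (b \<otimes> t') = v \<otimes> (b' \<otimes> t)"
    unfolding fraction_def by blast
  have cc: "a \<in> carrier R" "b \<in> carrier R" "s \<in> carrier R" "t \<in> carrier R"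
    "a' \<in> carrier R" "b' \<in> carrier R" "s' \<in> carrier R" "t' \<in> carrier R"
    "u \<in> carrier R" "v \<in> carrier R" using c assms by auto
  have "u \<otimes> v \<otimes> (a' \<otimes> b' \<otimes> (s \<otimes> t)) = (u \<otimes> (a' \<otimes> s)) \<otimes> (v \<otimes> (b' \<otimes> t))" using cc by algebra
  also have "\<dots> = (u \<otimes> (a \<otimes> s')) \<otimes> (v \<otimes> (b \<otimes> t'))" using u v by simp
  also have "\<dots> = u \<otimes> v \<otimes> (a \<otimes> b \<otimes> (s' \<otimes> t'))" using cc by algebra
  finally show "fraction R P (a' \<otimes> b') (s' \<otimes> t') = fraction R P (a \<otimes> b) (s \<otimes> t)"
    by (rule fraction_eqI[rotated -1]) (use c assms mult_not_in_P in auto)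
qed

lemma fraction_add:
  assumes "a \<in> carrier R" "s \<in> cP" "b \<in> carrier R" "t \<in> cP"
  shows "fraction R P a s \<oplus>\<^bsub>localization R P\<^esub> fraction R P b t
    = fraction R P (a \<otimes> t \<oplus> b \<otimes> s) (s \<otimes> t)"
  unfolding localization_def ring_record_simps
proof (rule UN_fraction_collapse[OF assms])
  fix a' s' b' t' assume "(a', s') \<in> fraction R P a s" "(b', t') \<in> fraction R P b t"
  then obtain u v where c: "a' \<in> carrier R" "s' \<in> cP" "u \<in> cP" "b' \<in> carrier R" "t' \<in> cP" "v \<in> cP"
    and u: "u \<otimes> (a \<otimes> s') = u \<otimes> (a' \<otimes> s)" and v: "v \<otimes> (b \<otimes> t') = v \<otimes> (b' \<otimes> t)"
    unfolding fraction_def by blast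
  have cc: "a \<in> carrier R" "b \<in> carrier R" "s \<in> carrier R" "t \<in> carrier R"
    "a' \<in> carrier R" "b' \<in> carrier R" "s' \<in> carrier R" "t' \<in> carrier R"
    "u \<in> carrier R" "v \<in> carrier R" using c assms by auto
  have "u \<otimes> v \<otimes> ((a' \<otimes> t' \<oplus> b' \<otimes> s') \<otimes> (s \<otimes> t))
      = (u \<otimes> (a' \<otimes> s)) \<otimes> (v \<otimes> t \<otimes> t') \<oplus> (v \<otimes> (b' \<otimes> t)) \<otimes> (u \<otimes> s \<otimes> s')"
    using cc by algebra
  also have "\<dots> = (u \<otimes> (a \<otimes> s')) \<otimes> (v \<otimes> t \<otimes> t') \<oplus> (v \<otimes> (b \<otimes> t')) \<otimes> (u \<otimes> s \<otimes> s')"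
    using u v by simp
  also have "\<dots> = u \<otimes> v \<otimes> ((a \<otimes> t \<oplus> b \<otimes> s) \<otimes> (s' \<otimes> t'))" using cc by algebra
  finally show "fraction R P (a' \<otimes> t' \<oplus> b' \<otimes> s') (s' \<otimes> t') = fraction R P (a \<otimes> t \<oplus> b \<otimes> s) (s \<otimes> t)"
    by (rule fraction_eqI[rotated -1]) (use c assms mult_not_in_P in auto)
qed

abbreviation "RP \<equiv> localization R P"

lemma localization_carrierE:
  assumes "x \<in> carrier RP"
  obtains a s where "x = fraction R P a s" "a \<in> carrier R" "s \<in> cP"
  using assms unfolding localization_def by auto

lemma fraction_closed: "a \<in> carrier R \<Longrightarrow> s \<in> cP \<Longrightarrow> fraction R P a s \<in> carrier RP"
  unfolding localization_def by auto

lemma one_RP: "\<one>\<^bsub>RP\<^esub> = fraction R P \<one> \<one>" and zero_RP: "\<zero>\<^bsub>RP\<^esub> = fraction R P \<zero> \<one>"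
  unfolding localization_def by auto

lemma fraction_eqI1:
  assumes c: "a \<in> carrier R" "b \<in> carrier R" "s \<in> cP" "t \<in> cP"
    and e: "a \<otimes> t = b \<otimes> s"
  shows "fraction R P a s = fraction R P b t"
  by (rule fraction_eqI[OF c one_not_in_P]) (use e in simp)

lemma localization_cring: "cring RP"
proof (intro cringI abelian_groupI comm_monoidI)
  fix x y assume "x \<in> carrier RP" "y \<in> carrier RP"
  then obtain a s b t where xy: "x = fraction R P a s" "y = fraction R P b t"
    and c: "a \<in> carrier R" "s \<in> cP" "b \<in> carrier R" "t \<in> cP" by (metis localization_carrierE)
  have cc: "s \<in> carrier R" "t \<in> carrier R" using c by auto
  show "x \<oplus>\<^bsub>RP\<^esub> y \<in> carrier RP" "x \<otimes>\<^bsub>RP\<^esub> y \<in> carrier RP"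
    unfolding xy fraction_add[OF c] fraction_mult[OF c]
    by (rule fraction_closed; use c mult_not_in_P in auto)+
  show "x \<oplus>\<^bsub>RP\<^esub> y = y \<oplus>\<^bsub>RP\<^esub> x" "x \<otimes>\<^bsub>RP\<^esub> y = y \<otimes>\<^bsub>RP\<^esub> x"
    unfolding xy fraction_add[OF c] fraction_mult[OF c] fraction_add[OF c(3,4,1,2)] fraction_mult[OF c(3,4,1,2)]
    using c cc by (simp_all add: m_comm a_comm)
  fix z assume "z \<in> carrier RP"
  then obtain d r where z: "z = fraction R P d r" and d: "d \<in> carrier R" "r \<in> cP"
    by (metis localization_carrierE)
  have rc: "r \<in> carrier R" using d by auto
  note st = mult_not_in_P[OF c(2,4)] and tr = mult_not_in_P[OF c(4) d(2)]
  show "x \<otimes>\<^bsub>RP\<^esub> y \<otimes>\<^bsub>RP\<^esub> z = x \<otimes>\<^bsub>RP\<^esub> (y \<otimes>\<^bsub>RP\<^esub> z)"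
    unfolding xy z fraction_mult[OF c] fraction_mult[OF c(3,4) d]
      fraction_mult[OF m_closed[OF c(1,3)] st d] fraction_mult[OF c(1,2) m_closed[OF c(3) d(1)] tr]
    using c d cc rc by (simp add: m_assoc)
  have cl1: "a \<otimes> t \<oplus> b \<otimes> s \<in> carrier R" "b \<otimes> r \<oplus> d \<otimes> t \<in> carrier R" using c d cc rc by auto
  show "x \<oplus>\<^bsub>RP\<^esub> y \<oplus>\<^bsub>RP\<^esub> z = x \<oplus>\<^bsub>RP\<^esub> (y \<oplus>\<^bsub>RP\<^esub> z)"
    unfolding xy z fraction_add[OF c] fraction_add[OF c(3,4) d]
      fraction_add[OF cl1(1) st d] fraction_add[OF c(1,2) cl1(2) tr]
    by (rule fraction_eqI1)
       ((use c d cc rc mult_not_in_P in auto)[4], use c(1,3) d(1) cc rc in algebra)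
  have sr: "s \<otimes> r \<in> cP" "t \<otimes> r \<in> cP" using mult_not_in_P c d by auto
  show "(x \<oplus>\<^bsub>RP\<^esub> y) \<otimes>\<^bsub>RP\<^esub> z = x \<otimes>\<^bsub>RP\<^esub> z \<oplus>\<^bsub>RP\<^esub> y \<otimes>\<^bsub>RP\<^esub> z"
    unfolding xy z fraction_add[OF c] fraction_mult[OF c(3,4) d] fraction_mult[OF c(1,2) d]
      fraction_mult[OF cl1(1) st d]
      fraction_add[OF m_closed[OF c(1) d(1)] sr(1) m_closed[OF c(3) d(1)] sr(2)]
    by (rule fraction_eqI1)
       ((use c d cc rc mult_not_in_P in auto)[4], use c(1,3) d(1) cc rc in algebra)
next
  show "\<zero>\<^bsub>RP\<^esub> \<in> carrier RP" "\<one>\<^bsub>RP\<^esub> \<in> carrier RP"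
    unfolding zero_RP one_RP using fraction_closed one_not_in_P by auto
next
  fix x assume "x \<in> carrier RP"
  then obtain a s where x: "x = fraction R P a s" and c: "a \<in> carrier R" "s \<in> cP"
    by (metis localization_carrierE)
  have cc: "s \<in> carrier R" using c by auto
  show "\<zero>\<^bsub>RP\<^esub> \<oplus>\<^bsub>RP\<^esub> x = x" "\<one>\<^bsub>RP\<^esub> \<otimes>\<^bsub>RP\<^esub> x = x"
    unfolding x zero_RP one_RP using c cc one_not_in_P
    by (simp_all add: fraction_add fraction_mult)
  show "\<exists>y\<in>carrier RP. y \<oplus>\<^bsub>RP\<^esub> x = \<zero>\<^bsub>RP\<^esub>"
  proof (rule bexI)
    show "fraction R P (\<ominus> a) s \<in> carrier RP" using c fraction_closed by auto
    have "fraction R P (\<ominus> a \<otimes> s \<oplus> a \<otimes> s) (s \<otimes> s) = fraction R P \<zero> \<one>"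
      by (rule fraction_eqI1) ((use c cc mult_not_in_P one_not_in_P in auto)[4], use c(1) cc in algebra)
    then show "fraction R P (\<ominus> a) s \<oplus>\<^bsub>RP\<^esub> x = \<zero>\<^bsub>RP\<^esub>"
      unfolding x zero_RP using c by (simp add: fraction_add)
  qed
qed

text \<open>The extension of \<open>I\<close> to \<open>R\<^sub>P\<close> consists of the fractions whose numerator can be moved
  into \<open>I\<close> by a factor outside \<open>P\<close>; for the inclusion one needs that these fractions form an
  ideal of the ring \<open>R\<^sub>P\<close>.\<close>

lemma fraction_in_localized_ideal_iff:
  assumes I: "ideal I R" and r: "r \<in> carrier R"
  shows "fraction R P r \<one> \<in> localized_ideal R P I \<longleftrightarrow> (\<exists>u\<in>cP. u \<otimes> r \<in> I)"
proof
  interpret I: ideal I R by fact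
  interpret RP: cring RP by (rule localization_cring)
  let ?E = "{fraction R P a s | a s. a \<in> I \<and> s \<in> cP}"
  have E: "ideal ?E RP"
  proof (rule idealI)
    show "ring RP" by (rule RP.ring_axioms)
    show "subgroup ?E (add_monoid RP)"
    proof (rule RP.add.subgroupI)
      show "?E \<subseteq> carrier RP" using I.Icarr fraction_closed by auto
      show "?E \<noteq> {}" using one_not_in_P I.zero_closed by blast
    next
      fix x assume "x \<in> ?E"
      then obtain a s where x: "x = fraction R P a s" and c: "a \<in> I" "s \<in> cP" by auto
      have cc: "a \<in> carrier R" "s \<in> carrier R" using c I.Icarr by auto
      have "fraction R P (\<ominus> a) s \<oplus>\<^bsub>RP\<^esub> x = fraction R P (\<ominus> a \<otimes> s \<oplus> a \<otimes> s) (s \<otimes> s)"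
        unfolding x using c cc by (simp add: fraction_add)
      also have "\<dots> = fraction R P \<zero> \<one>"
        by (rule fraction_eqI1) ((use c cc mult_not_in_P one_not_in_P in auto)[4], use cc in algebra)
      finally have "fraction R P (\<ominus> a) s \<oplus>\<^bsub>RP\<^esub> x = \<zero>\<^bsub>RP\<^esub>" using zero_RP by simp
      moreover have "fraction R P (\<ominus> a) s \<in> carrier RP" "x \<in> carrier RP"
        using x c cc fraction_closed by auto
      ultimately have "\<ominus>\<^bsub>RP\<^esub> x = fraction R P (\<ominus> a) s" by (simp add: RP.minus_equality)
      then show "\<ominus>\<^bsub>RP\<^esub> x \<in> ?E" using c I.a_inv_closed by auto
    next
      fix x y assume "x \<in> ?E" "y \<in> ?E"
      then obtain a s b t where xy: "x = fraction R P a s" "y = fraction R P b t"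
        and c: "a \<in> I" "s \<in> cP" "b \<in> I" "t \<in> cP" by auto
      have "x \<oplus>\<^bsub>RP\<^esub> y = fraction R P (a \<otimes> t \<oplus> b \<otimes> s) (s \<otimes> t)"
        unfolding xy using c I.Icarr by (simp add: fraction_add)
      moreover have "a \<otimes> t \<oplus> b \<otimes> s \<in> I" using c I.I_r_closed I.a_closed by auto
      ultimately show "x \<oplus>\<^bsub>RP\<^esub> y \<in> ?E" using c mult_not_in_P by blast
    qed
  next
    fix x y assume "x \<in> ?E" "y \<in> carrier RP"
    then obtain a s b t where xy: "x = fraction R P a s" "y = fraction R P b t"
        and c: "a \<in> I" "s \<in> cP" "b \<in> carrier R" "t \<in> cP" by (auto elim: localization_carrierE)
    have ac: "a \<in> carrier R" using c I.Icarr by auto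
    have "a \<otimes> b \<in> I" "b \<otimes> a \<in> I" "s \<otimes> t \<in> cP" "t \<otimes> s \<in> cP"
      using c I.I_r_closed I.I_l_closed mult_not_in_P by auto
    then show "y \<otimes>\<^bsub>RP\<^esub> x \<in> ?E" "x \<otimes>\<^bsub>RP\<^esub> y \<in> ?E"
      unfolding xy fraction_mult[OF ac c(2,3,4)] fraction_mult[OF c(3,4) ac c(2)]
      by blast+
  qed
  assume "fraction R P r \<one> \<in> localized_ideal R P I"
  moreover have "localized_ideal R P I \<subseteq> ?E"
    unfolding localized_ideal_def
    by (rule RP.genideal_minimal[OF E]) (use one_not_in_P in blast)
  ultimately obtain a s where as: "a \<in> I" "s \<in> cP" "fraction R P r \<one> = fraction R P a s" by auto
  obtain u where u: "u \<in> cP" "u \<otimes> (r \<otimes> s) = u \<otimes> (a \<otimes> \<one>)"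
    using fraction_eqD[OF I.Icarr[OF as(1)] as(2,3)] by blast
  have cc: "u \<in> carrier R" "s \<in> carrier R" using as u by auto
  have "u \<otimes> s \<otimes> r = u \<otimes> (r \<otimes> s)" using r cc by algebra
  also have "\<dots> = u \<otimes> a" using u I.Icarr[OF as(1)] by simp
  finally have "u \<otimes> s \<otimes> r \<in> I" using u as I.I_l_closed by auto
  then show "\<exists>u\<in>cP. u \<otimes> r \<in> I" using u as mult_not_in_P by blast
next
  interpret RP: cring RP by (rule localization_cring)
  assume "\<exists>u\<in>cP. u \<otimes> r \<in> I"
  then obtain u where u: "u \<in> cP" "u \<otimes> r \<in> I" by auto
  have sub: "(\<lambda>r. fraction R P r \<one>) ` I \<subseteq> carrier RP"
    using ideal.Icarr[OF I] one_not_in_P fraction_closed by auto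
  have "fraction R P (u \<otimes> r) \<one> \<in> localized_ideal R P I"
    unfolding localized_ideal_def using RP.genideal_self[OF sub] u by blast
  then have "fraction R P \<one> u \<otimes>\<^bsub>RP\<^esub> fraction R P (u \<otimes> r) \<one> \<in> localized_ideal R P I"
    unfolding localized_ideal_def using ideal.I_l_closed[OF RP.genideal_ideal[OF sub]]
      u fraction_closed by auto
  moreover have "fraction R P \<one> u \<otimes>\<^bsub>RP\<^esub> fraction R P (u \<otimes> r) \<one>
      = fraction R P (\<one> \<otimes> (u \<otimes> r)) (u \<otimes> \<one>)"
    by (rule fraction_mult) (use u r one_not_in_P in auto)
  moreover have "\<dots> = fraction R P r \<one>"
    by (rule fraction_eqI1) (use u r one_not_in_P in \<open>auto simp: m_comm\<close>)
  ultimately show "fraction R P r \<one> \<in> localized_ideal R P I" by simp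
qed

end

text \<open>Contracting from the localization at a prime amounts to finding a multiplier outside the prime, so
  the rest of the argument takes place in the ring itself.\<close>

lemma symbolic_square_eq:
  assumes R: "cring R" and I: "ideal I R"
  shows "symbolic_square R I = {r \<in> carrier R. \<forall>P \<in> Ass_quot R I.
    \<exists>u \<in> carrier R - P. u \<otimes>\<^bsub>R\<^esub> r \<in> ideal_prod R I I}"
proof -
  interpret cring R by fact
  have "fraction R P r \<one>\<^bsub>R\<^esub> \<in> localized_ideal R P (ideal_prod R I I)
      \<longleftrightarrow> (\<exists>u \<in> carrier R - P. u \<otimes>\<^bsub>R\<^esub> r \<in> ideal_prod R I I)"
    if "P \<in> Ass_quot R I" "r \<in> carrier R" for P r
  proof -
    interpret localized R P
      using that(1) R unfolding Ass_quot_def localized_def by auto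
    show ?thesis by (rule fraction_in_localized_ideal_iff[OF ideal_prod_is_ideal[OF I I] that(2)])
  qed
  then show ?thesis unfolding symbolic_square_def loc_contraction_def by auto
qed

section \<open>Polynomials as finitely supported functions\<close>

hide_const (open) Poly_Mapping.degree
abbreviation keys where "keys \<equiv> Poly_Mapping.keys"
abbreviation lookup where "lookup \<equiv> Poly_Mapping.lookup"

lemma poly_mapping_eq_sum_single:
  fixes f :: "'a \<Rightarrow>\<^sub>0 'b::comm_monoid_add"
  shows "f = (\<Sum>\<mu>\<in>keys f. Poly_Mapping.single \<mu> (lookup f \<mu>))"
proof (rule poly_mapping_eqI)
  fix k
  have "lookup (\<Sum>\<mu>\<in>keys f. Poly_Mapping.single \<mu> (lookup f \<mu>)) k
      = (\<Sum>\<mu>\<in>keys f. if k = \<mu> then lookup f \<mu> else 0)"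
    unfolding lookup_sum by (rule sum.cong) (auto simp: lookup_single when_def)
  also have "\<dots> = lookup f k"
    by (simp add: in_keys_iff)
  finally show "lookup f k = lookup (\<Sum>\<mu>\<in>keys f. Poly_Mapping.single \<mu> (lookup f \<mu>)) k" ..
qed

lemma poly_mapping_induct_on [consumes 1, case_names zero single add]:
  fixes f :: "'a \<Rightarrow>\<^sub>0 'b::comm_monoid_add"
  assumes "keys f \<subseteq> A" and "P 0" and "\<And>\<mu> c. \<mu> \<in> A \<Longrightarrow> P (Poly_Mapping.single \<mu> c)"
    and "\<And>f g. P f \<Longrightarrow> P g \<Longrightarrow> P (f + g)"
  shows "P f"
proof -
  have "P (\<Sum>\<mu>\<in>B. Poly_Mapping.single \<mu> (lookup f \<mu>))" if "finite B" "B \<subseteq> A" for B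
    using that by (induction B) (auto intro: assms)
  from this[OF finite_keys assms(1)] show ?thesis
    using poly_mapping_eq_sum_single[of f] by simp
qed

lemma lookup_single_mult:
  fixes f :: "'a::cancel_comm_monoid_add \<Rightarrow>\<^sub>0 'b::comm_semiring_1"
  shows "lookup (Poly_Mapping.single \<kappa> c * f) (\<kappa> + \<mu>) = c * lookup f \<mu>"
proof -
  have "lookup (Poly_Mapping.single \<kappa> c * f) (\<kappa> + \<mu>)
      = (\<Sum>l. (c * (\<Sum>q. lookup f q when \<kappa> + \<mu> = l + q)) when \<kappa> = l)"
    unfolding lookup_mult lookup_single by (simp add: when_mult)
  then show ?thesis by simp
qed

lemma keys_single_mult:
  fixes f :: "'a::cancel_comm_monoid_add \<Rightarrow>\<^sub>0 'b::comm_semiring_1"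
  shows "keys (Poly_Mapping.single \<kappa> 1 * f) = (+) \<kappa> ` keys f"
proof
  show "keys (Poly_Mapping.single \<kappa> 1 * f) \<subseteq> (+) \<kappa> ` keys f"
    using keys_mult[of "Poly_Mapping.single \<kappa> (1::'b)" f] by (auto split: if_splits)
qed (auto simp: in_keys_iff lookup_single_mult)

lemma single_mult_eq_0D:
  fixes f :: "'a::cancel_comm_monoid_add \<Rightarrow>\<^sub>0 'b::comm_ring_1"
  assumes "Poly_Mapping.single \<kappa> 1 * f = 0"
  shows "f = 0"
  using keys_single_mult[of \<kappa> f] unfolding assms by simp

text \<open>Extending a map on monomials linearly serves two purposes: if the map is multiplicative, the
  extension evaluates polynomials in another algebra; and it provides the linear section of the
  coordinate map of \<open>B\<close> constructed below, which is not multiplicative.\<close>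

definition linext :: "('a \<Rightarrow> ('c::comm_monoid_add \<Rightarrow>\<^sub>0 'k)) \<Rightarrow> ('a \<Rightarrow>\<^sub>0 'k::comm_ring_1) \<Rightarrow> ('c \<Rightarrow>\<^sub>0 'k)"
  where "linext s f = (\<Sum>\<mu>\<in>keys f. Poly_Mapping.single 0 (lookup f \<mu>) * s \<mu>)"

lemma linext_0 [simp]: "linext s 0 = 0"
  by (simp add: linext_def)

lemma linext_add: "linext s (f + g) = linext s f + linext s g"
  unfolding linext_def by (rule setsum_keys_plus_distrib) (simp_all add: single_add distrib_right)

lemma linext_single: "linext s (Poly_Mapping.single \<mu> c) = Poly_Mapping.single 0 c * s \<mu>"
  by (simp add: linext_def)

lemma linext_mult:
  assumes "\<And>\<mu> \<nu>. s (\<mu> + \<nu>) = s \<mu> * s \<nu>"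
  shows "linext s (f * g) = linext s f * linext s (g :: 'a::comm_monoid_add \<Rightarrow>\<^sub>0 'k::comm_ring_1)"
  using subset_UNIV[of "keys f"]
proof (induction f rule: poly_mapping_induct_on)
  case (single \<mu> c)
  show ?case
    using subset_UNIV[of "keys g"]
  proof (induction g rule: poly_mapping_induct_on)
    case (single \<nu> d)
    have "Poly_Mapping.single 0 (c * d) = Poly_Mapping.single 0 c * (Poly_Mapping.single (0::'b) d)"
      by (simp add: mult_single)
    then show ?case by (simp add: mult_single linext_single assms mult_ac)
  qed (simp_all add: linext_add distrib_left)
qed (simp_all add: linext_add distrib_right)

definition evalm :: "('v \<Rightarrow> 'b::comm_semiring_1) \<Rightarrow> ('v \<Rightarrow>\<^sub>0 nat) \<Rightarrow> 'b"
  where "evalm \<rho> m = (\<Prod>v\<in>keys m. \<rho> v ^ lookup m v)"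

lemma evalm_eq:
  assumes "finite V" "keys m \<subseteq> V"
  shows "evalm \<rho> m = (\<Prod>v\<in>V. \<rho> v ^ lookup m v)"
  unfolding evalm_def by (rule prod.mono_neutral_left) (use assms in \<open>auto simp: in_keys_iff\<close>)

lemma evalm_add: "evalm \<rho> (m + m') = evalm \<rho> m * evalm \<rho> m'"
proof -
  let ?V = "keys m \<union> keys m'"
  have "evalm \<rho> (m + m') = (\<Prod>v\<in>?V. \<rho> v ^ lookup (m + m') v)"
    by (rule evalm_eq) (use keys_add[of m m'] in auto)
  also have "\<dots> = (\<Prod>v\<in>?V. \<rho> v ^ lookup m v) * (\<Prod>v\<in>?V. \<rho> v ^ lookup m' v)"
    by (simp add: lookup_add power_add prod.distrib)
  also have "\<dots> = evalm \<rho> m * evalm \<rho> m'"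
    by (subst (1 2) evalm_eq[of ?V]) auto
  finally show ?thesis .
qed

lemma evalm_0 [simp]: "evalm \<rho> 0 = 1"
  by (simp add: evalm_def)

lemma evalm_single [simp]: "evalm \<rho> (Poly_Mapping.single v k) = \<rho> v ^ k"
  by (cases "k = 0") (simp_all add: evalm_def)

definition evalp :: "(var \<Rightarrow> ('c::comm_monoid_add \<Rightarrow>\<^sub>0 'k)) \<Rightarrow> 'k::comm_ring_1 mpoly \<Rightarrow> ('c \<Rightarrow>\<^sub>0 'k)"
  where "evalp \<rho> = linext (evalm \<rho>)"

lemma evalp_0 [simp]: "evalp \<rho> 0 = 0"
  and evalp_add [simp]: "evalp \<rho> (p + q) = evalp \<rho> p + evalp \<rho> q"
  and evalp_mult [simp]: "evalp \<rho> (p * q) = evalp \<rho> p * evalp \<rho> q"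
  and evalp_pconst [simp]: "evalp \<rho> (pconst c) = Poly_Mapping.single 0 c"
  and evalp_pvar [simp]: "evalp \<rho> (pvar v) = \<rho> v"
  unfolding evalp_def pconst_def pvar_def
  by (simp_all add: linext_add linext_mult[OF evalm_add] linext_single)

lemma evalp_1 [simp]: "evalp \<rho> 1 = 1"
  using evalp_pconst[of \<rho> 1] by (simp add: pconst_def)

lemma evalp_uminus [simp]: "evalp \<rho> (- p) = - evalp \<rho> p"
  using evalp_add[of \<rho> p "- p"] by (simp add: eq_neg_iff_add_eq_0 add.commute)

lemma evalp_diff [simp]: "evalp \<rho> (p - q) = evalp \<rho> p - evalp \<rho> q"
  using evalp_add[of \<rho> p "- q"] by simp

lemma evalp_sum [simp]: "evalp \<rho> (sum f A) = (\<Sum>i\<in>A. evalp \<rho> (f i))"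
  by (induction A rule: infinite_finite_induct) simp_all

subsection \<open>The polynomial rings as rings with carrier\<close>

lemma vars_0 [simp]: "vars 0 = {}"
  by (simp add: vars_def)

lemma vars_pconst [simp]: "vars (pconst c) = {}"
  by (simp add: vars_def pconst_def)

lemma vars_pvar [simp]: "vars (pvar v :: 'k::comm_ring_1 mpoly) = {v}"
  by (simp add: vars_def pvar_def)

lemma vars_add: "vars (p + q) \<subseteq> vars p \<union> vars q"
  using keys_add[of p q] by (auto simp: vars_def)

lemma vars_uminus [simp]: "vars (- p) = vars p"
  by (simp add: vars_def in_keys_iff)

lemma vars_mult: "vars (p * q) \<subseteq> vars p \<union> vars q"
proof
  fix v assume "v \<in> vars (p * q)"
  then obtain m where m: "m \<in> keys (p * q)" "v \<in> keys m" by (auto simp: vars_def)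
  then obtain a b where "m = a + b" "a \<in> keys p" "b \<in> keys q" using keys_mult[of p q] by auto
  then show "v \<in> vars p \<union> vars q" using m keys_add[of a b] by (auto simp: vars_def)
qed

lemma mem_poly_ring [simp]: "p \<in> carrier (poly_ring V) \<longleftrightarrow> vars p \<subseteq> V"
  by (simp add: poly_ring_def)

lemma poly_ring_ops [simp]:
  "p \<otimes>\<^bsub>poly_ring V\<^esub> q = p * q" "p \<oplus>\<^bsub>poly_ring V\<^esub> q = p + q"
  "\<one>\<^bsub>poly_ring V\<^esub> = 1" "\<zero>\<^bsub>poly_ring V\<^esub> = 0"
  by (simp_all add: poly_ring_def)

lemma vars_1 [simp]: "vars 1 = {}"
  using vars_pconst[of 1] by (simp add: pconst_def)

lemma vars_closed [intro, simp]:
  "vars p \<subseteq> V \<Longrightarrow> vars q \<subseteq> V \<Longrightarrow> vars (p + q) \<subseteq> V"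
  "vars p \<subseteq> V \<Longrightarrow> vars q \<subseteq> V \<Longrightarrow> vars (p * q) \<subseteq> V"
  "vars p \<subseteq> V \<Longrightarrow> vars q \<subseteq> V \<Longrightarrow> vars (p - q) \<subseteq> V"
  "vars p \<subseteq> V \<Longrightarrow> vars (p ^ k) \<subseteq> V"
proof -
  show a: "vars p \<subseteq> V \<Longrightarrow> vars q \<subseteq> V \<Longrightarrow> vars (p + q) \<subseteq> V" for p q :: "'k::comm_ring_1 mpoly"
    using vars_add[of p q] by auto
  show m: "vars p \<subseteq> V \<Longrightarrow> vars q \<subseteq> V \<Longrightarrow> vars (p * q) \<subseteq> V" for p q :: "'k::comm_ring_1 mpoly"
    using vars_mult[of p q] by auto
  show "vars p \<subseteq> V \<Longrightarrow> vars q \<subseteq> V \<Longrightarrow> vars (p - q) \<subseteq> V"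
    using a[of p "- q"] by simp
  show "vars p \<subseteq> V \<Longrightarrow> vars (p ^ k) \<subseteq> V"
    by (induction k) (simp_all add: m)
qed

lemma vars_sum: "(\<And>i. i \<in> A \<Longrightarrow> vars (f i) \<subseteq> V) \<Longrightarrow> vars (sum f A) \<subseteq> V"
  by (induction A rule: infinite_finite_induct) auto

lemma cring_poly_ring: "cring (poly_ring V :: 'k::comm_ring_1 mpoly ring)"
proof (intro cringI abelian_groupI comm_monoidI)
  fix x :: "'k mpoly" assume "x \<in> carrier (poly_ring V)"
  then show "\<exists>y\<in>carrier (poly_ring V). y \<oplus>\<^bsub>poly_ring V\<^esub> x = \<zero>\<^bsub>poly_ring V\<^esub>"
    by (intro bexI[of _ "- x"]) auto
qed (simp_all add: algebra_simps)

lemma poly_ring_a_inv: "p \<in> carrier (poly_ring V) \<Longrightarrow> \<ominus>\<^bsub>poly_ring V\<^esub> p = - p"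
proof -
  interpret cring "poly_ring V" by (rule cring_poly_ring)
  assume "p \<in> carrier (poly_ring V)"
  then show ?thesis by (intro minus_equality) auto
qed

lemma poly_ring_minus:
  "p \<in> carrier (poly_ring V) \<Longrightarrow> q \<in> carrier (poly_ring V) \<Longrightarrow> p \<ominus>\<^bsub>poly_ring V\<^esub> q = p - q"
  by (simp add: a_minus_def poly_ring_a_inv)

lemma poly_ring_induct [consumes 1, case_names const add var]:
  assumes "vars p \<subseteq> V" and const: "\<And>c. P (pconst c)"
    and add: "\<And>p q. P p \<Longrightarrow> P q \<Longrightarrow> P (p + q)"
    and var: "\<And>v p. v \<in> V \<Longrightarrow> P p \<Longrightarrow> P (pvar v * p)"
  shows "P p"
proof -
  have mon: "\<forall>f. P f \<longrightarrow> P (Poly_Mapping.single m 1 * f)" if "keys m \<subseteq> V" for m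
    using that
  proof (induction m rule: poly_mapping_induct_on)
    case (single v k)
    show ?case
    proof (induction k)
      case (Suc k)
      have "(Poly_Mapping.single (Poly_Mapping.single v (Suc k)) 1 :: 'a mpoly)
          = pvar v * Poly_Mapping.single (Poly_Mapping.single v k) 1"
        by (simp add: pvar_def mult_single flip: single_add)
      then show ?case using Suc var[OF single] by (simp add: mult.assoc)
    qed simp
  next
    case (add m m')
    have "(Poly_Mapping.single (m + m') 1 :: 'a mpoly) = Poly_Mapping.single m 1 * Poly_Mapping.single m' 1"
      by (simp add: mult_single)
    then show ?case using add by (simp add: mult.assoc)
  qed simp
  have "keys p \<subseteq> {m. keys m \<subseteq> V}" using assms(1) by (auto simp: vars_def)
  then show ?thesis
  proof (induction p rule: poly_mapping_induct_on)
    case zero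
    then show ?case using const[of 0] by (simp add: pconst_def)
  next
    case (single m c)
    have "Poly_Mapping.single m c = Poly_Mapping.single m 1 * pconst c"
      by (simp add: pconst_def mult_single)
    then show ?case using mon single const by simp
  qed (rule add)
qed

lemma evalp_eq_self:
  assumes "vars p \<subseteq> V" "\<And>v. v \<in> V \<Longrightarrow> \<rho> v = pvar v"
  shows "evalp \<rho> p = p"
  using assms(1) by (induction p rule: poly_ring_induct) (auto simp: assms(2) simp flip: pconst_def)

section \<open>The order of vanishing along a coordinate hyperplane\<close>

text \<open>The \<open>k\<close>-th coordinate divides \<open>f\<close> at least \<open>n\<close> times. Lower bounds avoid assigning an order to
  the zero polynomial, which satisfies all of them.\<close>

definition val_ge :: "'v \<Rightarrow> nat \<Rightarrow> (('v \<Rightarrow>\<^sub>0 nat) \<Rightarrow>\<^sub>0 'k::comm_ring_1) \<Rightarrow> bool"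
  where "val_ge k n f \<longleftrightarrow> (\<forall>\<mu>\<in>keys f. n \<le> lookup \<mu> k)"

lemma val_ge_0 [simp]: "val_ge k n 0"
  by (simp add: val_ge_def)

lemma val_ge_zero [simp]: "val_ge k 0 f"
  by (simp add: val_ge_def)

lemma val_ge_add: "val_ge k n f \<Longrightarrow> val_ge k n g \<Longrightarrow> val_ge k n (f + g)"
  using keys_add[of f g] by (auto simp: val_ge_def)

lemma val_ge_uminus [simp]: "val_ge i k (- f) \<longleftrightarrow> val_ge i k f"
  by (simp add: val_ge_def in_keys_iff)

lemma val_ge_mult: "val_ge k i f \<Longrightarrow> val_ge k j g \<Longrightarrow> val_ge k (i + j) (f * g)"
  using keys_mult[of f g] by (fastforce simp: val_ge_def lookup_add intro: add_mono)

lemma val_ge_multI: "val_ge k i f \<Longrightarrow> val_ge k i (f * g)" "val_ge k i f \<Longrightarrow> val_ge k i (g * f)"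
  using val_ge_mult[of k i f 0 g] by (simp_all add: mult.commute)

lemma val_ge_single_mult:
  "val_ge k n (Poly_Mapping.single \<kappa> 1 * f) \<longleftrightarrow> (\<forall>\<mu>\<in>keys f. n \<le> lookup \<kappa> k + lookup \<mu> k)"
  by (simp add: val_ge_def keys_single_mult lookup_add)

text \<open>For the smallest order \<open>j\<close> that occurs, the first summand is the initial form of \<open>f\<close> in the
  \<open>k\<close>-th coordinate.\<close>

lemma split_val:
  fixes f :: "('v \<Rightarrow>\<^sub>0 nat) \<Rightarrow>\<^sub>0 'k::comm_ring_1"
  obtains f0 f1 where "f = f0 + f1" "\<And>\<mu>. \<mu> \<in> keys f0 \<longleftrightarrow> \<mu> \<in> keys f \<and> lookup \<mu> k = j"
    "\<And>\<mu>. \<mu> \<in> keys f1 \<longleftrightarrow> \<mu> \<in> keys f \<and> lookup \<mu> k \<noteq> j"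
proof
  let ?f0 = "Poly_Mapping.mapp (\<lambda>\<mu> c. if lookup \<mu> k = j then c else 0) f"
  show "f = ?f0 + (f - ?f0)" by simp
  show "\<mu> \<in> keys ?f0 \<longleftrightarrow> \<mu> \<in> keys f \<and> lookup \<mu> k = j" for \<mu>
    by (auto simp: in_keys_iff lookup_mapp)
  show "\<mu> \<in> keys (f - ?f0) \<longleftrightarrow> \<mu> \<in> keys f \<and> lookup \<mu> k \<noteq> j" for \<mu>
    by (auto simp: in_keys_iff lookup_mapp lookup_minus when_def)
qed

text \<open>The order of vanishing is additive on products, because the product of the two initial
  forms does not vanish.\<close>

lemma val_ge_cancel:
  fixes f u :: "('v::linorder \<Rightarrow>\<^sub>0 nat) \<Rightarrow>\<^sub>0 'k::idom"
  assumes uf: "val_ge k n (u * f)" and u: "\<not> val_ge k 1 u"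
  shows "val_ge k n f"
proof (rule ccontr)
  assume f: "\<not> val_ge k n f"
  define j where "j = (LEAST j. \<exists>\<mu>\<in>keys f. lookup \<mu> k = j)"
  from f obtain \<mu>0 where \<mu>0: "\<mu>0 \<in> keys f" "lookup \<mu>0 k < n" by (auto simp: val_ge_def not_le)
  have j: "\<exists>\<mu>\<in>keys f. lookup \<mu> k = j" unfolding j_def
    by (rule LeastI_ex) (use \<mu>0 in blast)
  have jle: "j \<le> lookup \<mu> k" if "\<mu> \<in> keys f" for \<mu>
    unfolding j_def by (rule Least_le) (use that in blast)
  have jn: "j < n" using jle[OF \<mu>0(1)] \<mu>0(2) by simp
  obtain f0 f1 where f01: "f = f0 + f1" "\<And>\<mu>. \<mu> \<in> keys f0 \<longleftrightarrow> \<mu> \<in> keys f \<and> lookup \<mu> k = j"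
    "\<And>\<mu>. \<mu> \<in> keys f1 \<longleftrightarrow> \<mu> \<in> keys f \<and> lookup \<mu> k \<noteq> j" by (rule split_val[of f k j]) blast
  obtain u0 u1 where u01: "u = u0 + u1" "\<And>\<mu>. \<mu> \<in> keys u0 \<longleftrightarrow> \<mu> \<in> keys u \<and> lookup \<mu> k = 0"
    "\<And>\<mu>. \<mu> \<in> keys u1 \<longleftrightarrow> \<mu> \<in> keys u \<and> lookup \<mu> k \<noteq> 0" by (rule split_val[of u k 0]) blast
  from j have "f0 \<noteq> 0" using f01(2) by (auto simp flip: keys_eq_empty)
  moreover from u have "u0 \<noteq> 0" using u01(2) by (fastforce simp: val_ge_def not_le simp flip: keys_eq_empty)
  ultimately have "u0 * f0 \<noteq> 0" by simp
  then obtain \<mu> where \<mu>: "\<mu> \<in> keys (u0 * f0)" by (auto simp flip: keys_eq_empty)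
  have \<mu>k: "lookup \<mu> k = j"
    using \<mu> keys_mult[of u0 f0] u01(2) f01(2) by (auto simp: lookup_add)
  have "\<mu> \<notin> keys (u0 * f1)" "\<mu> \<notin> keys (u1 * f)"
    using \<mu>k keys_mult[of u0 f1] keys_mult[of u1 f] u01(2,3) f01(3) jle
    by (fastforce simp: lookup_add)+
  moreover have "u * f = u0 * f0 + (u0 * f1 + u1 * f)"
    using f01(1) u01(1) by (simp add: algebra_simps)
  ultimately have "\<mu> \<in> keys (u * f)"
    using \<mu> by (simp add: in_keys_iff lookup_add)
  then show False using uf jn \<mu>k by (auto simp: val_ge_def)
qed

section \<open>Ideals\<close>

lemma (in cring) ideal_mult_preimage:
  assumes A: "ideal A R" and u: "u \<in> carrier R"
  shows "ideal {x \<in> carrier R. u \<otimes> x \<in> A} R"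
proof (rule idealI)
  interpret A: ideal A R by fact
  show "ring R" by (rule ring_axioms)
  show "subgroup {x \<in> carrier R. u \<otimes> x \<in> A} (add_monoid R)"
    by (rule add.subgroupI) (use u in \<open>auto simp: r_distr r_minus A.a_closed A.a_inv_closed intro!: exI[of _ \<zero>] A.zero_closed\<close>)
  fix x y assume x: "x \<in> {x \<in> carrier R. u \<otimes> x \<in> A}" and y: "y \<in> carrier R"
  have "u \<otimes> (y \<otimes> x) = y \<otimes> (u \<otimes> x)" using x y u by (simp add: m_lcomm)
  moreover have "y \<otimes> (u \<otimes> x) \<in> A" using x y A.I_l_closed by simp
  ultimately have "y \<otimes> x \<in> {x \<in> carrier R. u \<otimes> x \<in> A}" using x y by simp
  moreover have "x \<otimes> y = y \<otimes> x" using x y by (simp add: m_comm)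
  ultimately show "y \<otimes> x \<in> {x \<in> carrier R. u \<otimes> x \<in> A}" "x \<otimes> y \<in> {x \<in> carrier R. u \<otimes> x \<in> A}"
    by simp_all
qed

lemma (in ring) ideal_sum_subset_iff:
  assumes "ideal I R" "ideal I' R" "ideal A R"
  shows "I <+> I' \<subseteq> A \<longleftrightarrow> I \<subseteq> A \<and> I' \<subseteq> A"
proof -
  have "I <+> I' = Idl (I \<union> I')" by (rule union_genideal[symmetric, OF assms(1,2)])
  moreover have "I \<union> I' \<subseteq> carrier R"
    using assms(1,2)[THEN ideal.axioms(1), THEN additive_subgroup.a_subset] by auto
  ultimately show ?thesis
    using genideal_self[of "I \<union> I'"] genideal_minimal[OF assms(3), of "I \<union> I'"] by auto
qed

lemma (in ring) genideal_subset_iff: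
  "G \<subseteq> carrier R \<Longrightarrow> ideal A R \<Longrightarrow> Idl G \<subseteq> A \<longleftrightarrow> G \<subseteq> A"
  using genideal_self genideal_minimal by blast

text \<open>Negation is multiplication by the constant \<open>-1\<close>.\<close>

lemma ideal_poly_ring_iff:
  "ideal A (poly_ring V) \<longleftrightarrow> A \<subseteq> {p. vars p \<subseteq> V} \<and> (0 :: 'k::comm_ring_1 mpoly) \<in> A
    \<and> (\<forall>p\<in>A. \<forall>q\<in>A. p + q \<in> A) \<and> (\<forall>r. vars r \<subseteq> V \<longrightarrow> (\<forall>p\<in>A. r * p \<in> A))" (is "?l \<longleftrightarrow> ?r")
proof
  assume ?l
  then interpret A: ideal A "poly_ring V" .
  show ?r
    using A.Icarr A.additive_subgroup_axioms[THEN additive_subgroup.zero_closed]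
      A.additive_subgroup_axioms[THEN additive_subgroup.a_closed] A.I_l_closed by auto
next
  assume r: ?r
  interpret R: cring "poly_ring V :: 'k mpoly ring" by (rule cring_poly_ring)
  show ?l
  proof (rule idealI)
    show "ring (poly_ring V :: 'k mpoly ring)" by (rule R.ring_axioms)
    show "subgroup A (add_monoid (poly_ring V))"
    proof (rule R.add.subgroupI)
      fix p assume p: "p \<in> A"
      then have "\<ominus>\<^bsub>poly_ring V\<^esub> p = pconst (- 1) * p"
        using r by (subst poly_ring_a_inv) (auto simp: pconst_def single_uminus)
      then show "\<ominus>\<^bsub>poly_ring V\<^esub> p \<in> A" using p r by simp
    qed (use r in auto)
    fix p r :: "'k mpoly" assume "p \<in> A" "r \<in> carrier (poly_ring V)"
    then show "r \<otimes>\<^bsub>poly_ring V\<^esub> p \<in> A" "p \<otimes>\<^bsub>poly_ring V\<^esub> r \<in> A"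
      using r by (simp_all add: mult.commute[of p])
  qed
qed

lemma poly_ideal_closed:
  fixes A :: "'k::comm_ring_1 mpoly set"
  assumes "ideal A (poly_ring V)"
  shows "0 \<in> A" "p \<in> A \<Longrightarrow> q \<in> A \<Longrightarrow> p + q \<in> A" "p \<in> A \<Longrightarrow> vars p \<subseteq> V"
    "vars r \<subseteq> V \<Longrightarrow> p \<in> A \<Longrightarrow> r * p \<in> A" "vars r \<subseteq> V \<Longrightarrow> p \<in> A \<Longrightarrow> p * r \<in> A"
    "p \<in> A \<Longrightarrow> - p \<in> A" "p \<in> A \<Longrightarrow> q \<in> A \<Longrightarrow> p - q \<in> A"
proof -
  note i = assms[unfolded ideal_poly_ring_iff]
  show "0 \<in> A" and add: "p \<in> A \<Longrightarrow> q \<in> A \<Longrightarrow> p + q \<in> A" and "p \<in> A \<Longrightarrow> vars p \<subseteq> V" for p q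
    using i by auto
  show m: "vars r \<subseteq> V \<Longrightarrow> p \<in> A \<Longrightarrow> r * p \<in> A" for p r using i by auto
  from m[of r p] show "vars r \<subseteq> V \<Longrightarrow> p \<in> A \<Longrightarrow> p * r \<in> A" by (simp add: mult.commute)
  show um: "p \<in> A \<Longrightarrow> - p \<in> A" for p using m[of "- 1" p] by simp
  show "p \<in> A \<Longrightarrow> q \<in> A \<Longrightarrow> p - q \<in> A" using add[of p "- q"] um by simp
qed

lemma poly_ideal_sum:
  assumes "ideal A (poly_ring V)" "\<And>i. i \<in> I \<Longrightarrow> f i \<in> A"
  shows "sum f I \<in> A"
  using assms(2) by (induction I rule: infinite_finite_induct) (auto intro: poly_ideal_closed[OF assms(1)])

lemma colon_ideal_is_ideal:
  fixes I :: "'k::comm_ring_1 mpoly set"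
  assumes "ideal I (poly_ring V)"
  shows "ideal (colon_ideal (poly_ring V) I T) (poly_ring V)"
  unfolding ideal_poly_ring_iff
  using poly_ideal_closed[OF assms]
  by (auto simp: colon_ideal_def distrib_right mult.assoc)

text \<open>The elements that \<open>p\<close> multiplies into \<open>I\<close> form an ideal, so testing generators suffices.\<close>

lemma colon_genideal_iff:
  fixes I :: "'k::comm_ring_1 mpoly set"
  assumes I: "ideal I (poly_ring V)" and G: "G \<subseteq> carrier (poly_ring V)"
  shows "p \<in> colon_ideal (poly_ring V) I (genideal (poly_ring V) G)
    \<longleftrightarrow> vars p \<subseteq> V \<and> (\<forall>t\<in>G. p * t \<in> I)"
proof
  interpret R: cring "poly_ring V :: 'k mpoly ring" by (rule cring_poly_ring)
  show "vars p \<subseteq> V \<and> (\<forall>t\<in>G. p * t \<in> I)" if "p \<in> colon_ideal (poly_ring V) I (genideal (poly_ring V) G)"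
    using that R.genideal_self[OF G] by (auto simp: colon_ideal_def)
  assume p: "vars p \<subseteq> V \<and> (\<forall>t\<in>G. p * t \<in> I)"
  have "ideal {t. vars t \<subseteq> V \<and> p * t \<in> I} (poly_ring V)"
    unfolding ideal_poly_ring_iff
    using poly_ideal_closed[OF I] by (auto simp: distrib_left mult.left_commute)
  then have "genideal (poly_ring V) G \<subseteq> {t. vars t \<subseteq> V \<and> p * t \<in> I}"
    by (rule R.genideal_minimal) (use G p in \<open>simp add: subset_iff\<close>)
  then show "p \<in> colon_ideal (poly_ring V) I (genideal (poly_ring V) G)"
    using p by (auto simp: colon_ideal_def)
qed

lemma pconst_simps:
  "pconst (u + v) = pconst u + pconst v" "pconst (u * v) = pconst u * pconst v"
  "pconst 0 = 0" "pconst 1 = 1" "pconst (- u) = - pconst u" "pconst (u - v) = pconst u - pconst v"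
  by (simp_all add: pconst_def single_add mult_single single_uminus single_diff)

section \<open>The presentation of the ring B\<close>

definition VS :: "nat \<Rightarrow> var set"
  where "VS n = {Vx, Vy, Vz} \<union> Vw ` {..<n}"

lemma VS_simps [simp]: "Vx \<in> VS n" "Vy \<in> VS n" "Vz \<in> VS n" "Vw i \<in> VS n \<longleftrightarrow> i < n"
  by (auto simp: VS_def)

text \<open>The parameters describe the shape that the hypotheses on \<open>\<phi>\<close> force. After
  \<open>t\<^sub>j = w\<^sub>j\<^sub>+\<^sub>1 + \<gamma>\<^sub>j w\<^sub>0\<close> the matrix \<open>A\<close> has the columns \<open>(t\<^sub>j, t\<^sub>j\<^sub>+\<^sub>1)\<close> for \<open>j < m\<close> and the last column
  \<open>(a w, b w)\<close>, where \<open>w = w\<^sub>n\<^sub>-\<^sub>1\<close>. The numbers \<open>c, d\<close> complete \<open>(a, b)\<close> to a unimodular matrix; they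
  exist because \<open>(a, b) \<noteq> 0\<close>. The last form is \<open>z w\<^sub>0 + g w\<close> with \<open>g = ax + by\<close>, and \<open>h\<close> is a
  second linear form in \<open>x, y\<close> that completes \<open>g\<close> to a basis.\<close>

locale scroll =
  fixes m :: nat and \<gamma> :: "nat \<Rightarrow> 'k::field" and a b c d :: 'k
  assumes m2: "2 \<le> m" and unimodular: "a * d + b * c = 1"
begin

abbreviation S :: "'k mpoly ring" where "S \<equiv> poly_ring (VS (m + 3))"

definition t :: "nat \<Rightarrow> 'k mpoly" where "t j = pw (Suc j) + pconst (\<gamma> j) * pw 0"
definition w :: "'k mpoly" where "w = pw (m + 2)"
definition g :: "'k mpoly" where "g = pconst a * px + pconst b * py"
definition h :: "'k mpoly" where "h = pconst c * px - pconst d * py"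

definition L :: "'k mpoly set"
  where "L = {px * t j + py * t (Suc j) | j. j < m} \<union> {pz * pw 0 + g * w}"

definition J :: "'k mpoly set"
  where "J = colon_ideal S (genideal S L) (genideal S {px, py, pz * pw 0})"

lemma det_pconst: "pconst a * pconst d + pconst b * pconst c = 1"
  using unimodular by (simp flip: pconst_simps)

lemma vars_S [simp]:
  "vars g \<subseteq> VS (m + 3)" "vars h \<subseteq> VS (m + 3)"
  "vars w \<subseteq> VS (m + 3)" "j \<le> m \<Longrightarrow> vars (t j) \<subseteq> VS (m + 3)" "vars (pconst u) \<subseteq> VS (m + 3)"
  unfolding g_def h_def w_def t_def
  by simp_all

lemma L_carrier: "L \<subseteq> carrier S"
proof
  fix p assume "p \<in> L"
  then consider j where "j < m" "p = px * t j + py * t (Suc j)" | "p = pz * pw 0 + g * w"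
    unfolding L_def by blast
  then show "p \<in> carrier S" by cases simp_all
qed

lemma ideal_L: "ideal (genideal S L) S"
  using cring.axioms(1)[OF cring_poly_ring] L_carrier by (rule ring.genideal_ideal)

lemma L_in_genideal: "p \<in> L \<Longrightarrow> p \<in> genideal S L"
  using ring.genideal_self[OF cring.axioms(1)[OF cring_poly_ring] L_carrier] by auto

lemma mem_J: "p \<in> J \<longleftrightarrow> vars p \<subseteq> VS (m + 3) \<and> p * px \<in> genideal S L \<and> p * py \<in> genideal S L
    \<and> p * (pz * pw 0) \<in> genideal S L"
  unfolding J_def by (subst colon_genideal_iff[OF ideal_L]) simp_all

lemma ideal_J: "ideal J S"
  unfolding J_def by (rule colon_ideal_is_ideal[OF ideal_L])

lemmas J_closed = poly_ideal_closed[OF ideal_J]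

lemma L_subset_J: "p \<in> L \<Longrightarrow> p \<in> J"
  using poly_ideal_closed(3)[OF ideal_L, of p] poly_ideal_closed(5)[OF ideal_L, of _ p] L_in_genideal[of p]
  unfolding mem_J by simp

lemma rel_x: "j < m \<Longrightarrow> px * t j + py * t (Suc j) \<in> J"
  and rel_z: "pz * pw 0 + g * w \<in> J"
  by (rule L_subset_J, auto simp: L_def)+

text \<open>Cramer's rule: multiplied by \<open>x\<close>, \<open>y\<close> or \<open>z w\<^sub>0\<close> the minor becomes a combination of the
  forms in \<open>L\<close>.\<close>

lemma rel_minor:
  assumes "i < m" "j < m"
  shows "t i * t (Suc j) - t (Suc i) * t j \<in> J"
proof -
  let ?f = "t i * t (Suc j) - t (Suc i) * t j"
  let ?l = "\<lambda>j. px * t j + py * t (Suc j)"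
  note cl = poly_ideal_closed[OF ideal_L]
  have l: "?l i \<in> genideal S L" "?l j \<in> genideal S L" "pz * pw 0 + g * w \<in> genideal S L"
    using assms L_in_genideal unfolding L_def by blast+
  have "?f * px = t (Suc j) * ?l i - t (Suc i) * ?l j" by (simp add: algebra_simps)
  moreover have "\<dots> \<in> genideal S L" using assms by (intro l cl(4,7)) simp_all
  ultimately have x: "?f * px \<in> genideal S L" by simp
  have "?f * py = t i * ?l j - t j * ?l i" by (simp add: algebra_simps)
  moreover have "\<dots> \<in> genideal S L" using assms by (intro l cl(4,7)) simp_all
  ultimately have y: "?f * py \<in> genideal S L" by simp
  have "?f * (pz * pw 0) = ?f * (pz * pw 0 + g * w)
      - pconst a * w * (?f * px) - pconst b * w * (?f * py)"
    by (simp add: g_def algebra_simps)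
  moreover have "\<dots> \<in> genideal S L" using assms by (intro l x y cl(4,7)) simp_all
  ultimately have "?f * (pz * pw 0) \<in> genideal S L" by simp
  with x y show ?thesis unfolding mem_J using assms by auto
qed

subsection \<open>Forms in the t's as polynomials\<close>

text \<open>The form \<open>\<Sum> c\<^sub>j t\<^sub>j\<close> is stored as the polynomial \<open>\<Sum> c\<^sub>j X\<^sup>j\<close>; multiplication by \<open>X\<close> then
  shifts the index.\<close>

definition form :: "'k poly \<Rightarrow> 'k mpoly"
  where "form P = (\<Sum>j\<le>m. pconst (poly.coeff P j) * t j)"

text \<open>The forms \<open>low P\<close> and \<open>high P\<close> are the two pairings of the coefficients of \<open>P\<close> with the rows
  \<open>(t\<^sub>0, \<dots>, t\<^sub>m\<^sub>-\<^sub>1)\<close> and \<open>(t\<^sub>1, \<dots>, t\<^sub>m)\<close>. Multiplying \<open>P\<close> by a linear polynomial combines the two,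
  so a change of basis of the linear polynomials acts on the two rows.\<close>

definition low :: "'k poly \<Rightarrow> 'k mpoly"
  where "low P = (\<Sum>j<m. pconst (poly.coeff P j) * t j)"

definition high :: "'k poly \<Rightarrow> 'k mpoly"
  where "high P = (\<Sum>j<m. pconst (poly.coeff P j) * t (Suc j))"

lemma vars_form [simp]:
  "vars (form P) \<subseteq> VS (m + 3)" "vars (low P) \<subseteq> VS (m + 3)" "vars (high P) \<subseteq> VS (m + 3)"
  unfolding form_def low_def high_def by (auto intro!: vars_sum vars_closed simp del: vars_closed del: subsetI)

lemma form_add: "form (P + Q) = form P + form Q"
  by (simp add: form_def pconst_simps distrib_right sum.distrib)

lemma form_smult: "form (Polynomial.smult u P) = pconst u * form P"
  by (simp add: form_def pconst_simps sum_distrib_left mult.assoc)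

lemma form_low: "degree P < m \<Longrightarrow> form P = low P"
  unfolding form_def low_def lessThan_Suc_atMost[symmetric]
  by (simp add: coeff_eq_0 pconst_simps)

lemma form_high: "form (pCons 0 P) = high P"
  unfolding form_def high_def lessThan_Suc_atMost[symmetric] sum.lessThan_Suc_shift
  by (simp add: pconst_simps)

lemma form_linear_mult:
  assumes "degree P < m"
  shows "form ([:u, v:] * P) = pconst v * high P + pconst u * low P"
proof -
  have "[:u, v:] * P = Polynomial.smult u P + Polynomial.smult v (pCons 0 P)"
    by simp
  then show ?thesis using assms by (simp only: form_add form_smult form_low form_high) simp
qed

lemma low_high_x: "px * low P + py * high P \<in> J"
proof -
  have "px * low P + py * high P = (\<Sum>j<m. pconst (poly.coeff P j) * (px * t j + py * t (Suc j)))"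
    by (simp add: low_def high_def sum_distrib_left sum.distrib algebra_simps)
  also have "\<dots> \<in> J"
    by (intro poly_ideal_sum[OF ideal_J] J_closed(4) rel_x) simp_all
  finally show ?thesis .
qed

lemma low_high_minor: "low P * high Q - high P * low Q \<in> J"
proof -
  have *: "high P * low Q = (\<Sum>i<m. \<Sum>j<m. pconst (poly.coeff P i) * t (Suc i) * (pconst (poly.coeff Q j) * t j))"
    by (simp add: low_def high_def sum_product)
  have "low P * high Q - high P * low Q = (\<Sum>i<m. \<Sum>j<m. pconst (poly.coeff P i) * pconst (poly.coeff Q j)
      * (t i * t (Suc j) - t (Suc i) * t j))"
    unfolding * by (simp add: low_def high_def sum_product algebra_simps flip: sum_subtractf)
  also have "\<dots> \<in> J"
    by (intro poly_ideal_sum[OF ideal_J] J_closed(4) rel_minor vars_closed(2)) simp_all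
  finally show ?thesis .
qed

text \<open>On the scroll \<open>x = \<lambda> \<sigma>\<close>, \<open>y = - \<lambda> \<tau>\<close>, where \<open>X\<close> stands for \<open>\<sigma>\<close> and 1 for \<open>\<tau>\<close>, the polynomials \<open>E, H\<close>
  correspond to \<open>a \<sigma> - b \<tau>\<close> and \<open>c \<sigma> + d \<tau>\<close>, the factors of \<open>g\<close> and \<open>h\<close> beside \<open>\<lambda>\<close>.\<close>

definition E :: "'k poly" where "E = [:- b, a:]"
definition H :: "'k poly" where "H = [:d, c:]"

text \<open>The relations \<open>x t\<^sub>j + y t\<^sub>j\<^sub>+\<^sub>1\<close> and the minors of the rows of \<open>t\<close>'s are invariant, up to the
  determinant \<open>ad + bc = 1\<close>, under the simultaneous change to \<open>g, h\<close> and to \<open>E, H\<close>. This and the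
  next lemma are these relations in the new coordinates.\<close>

lemma rel_gh:
  assumes "degree P < m"
  shows "g * form (H * P) - h * form (E * P) \<in> J"
proof -
  have "g * form (H * P) - h * form (E * P)
      = (pconst a * pconst d + pconst b * pconst c) * (px * low P + py * high P)"
    unfolding H_def E_def form_linear_mult[OF assms] g_def h_def
    by (simp add: pconst_simps algebra_simps)
  then show ?thesis using det_pconst low_high_x by simp
qed

lemma rel_forms:
  assumes "degree P < m" "degree Q < m"
  shows "form (E * P) * form (H * Q) - form (H * P) * form (E * Q) \<in> J"
proof -
  have "form (E * P) * form (H * Q) - form (H * P) * form (E * Q)
      = (pconst a * pconst d + pconst b * pconst c) * - (low P * high Q - high P * low Q)"
    unfolding H_def E_def form_linear_mult[OF assms(1)] form_linear_mult[OF assms(2)]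
    by (simp add: pconst_simps algebra_simps)
  then show ?thesis using det_pconst J_closed(6)[OF low_high_minor] by simp
qed

lemma degree_EH: "degree (E ^ i * H ^ j) \<le> i + j"
proof -
  have "degree (E ^ i) \<le> 1 * i" "degree (H ^ j) \<le> 1 * j"
    by (rule order_trans[OF degree_power_le], simp add: E_def H_def)+
  then show ?thesis using degree_mult_le[of "E ^ i" "H ^ j"] by simp
qed

text \<open>The \<open>T i\<close> play the role of the \<open>t\<close>'s in the new coordinates; on the scroll, where \<open>t\<^sub>j\<close> is
  \<open>\<rho> \<sigma>\<^sup>j \<tau>\<^sup>m\<^sup>-\<^sup>j\<close>, the element \<open>T i\<close> becomes a monomial.\<close>

definition T :: "nat \<Rightarrow> 'k mpoly" where "T i = form (E ^ i * H ^ (m - i))"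

lemma vars_T [simp]: "vars (T i) \<subseteq> VS (m + 3)"
  by (simp add: T_def)

lemma T_eq: "i < m \<Longrightarrow> T i = form (H * (E ^ i * H ^ (m - 1 - i)))"
  and T_Suc_eq: "i < m \<Longrightarrow> T (Suc i) = form (E * (E ^ i * H ^ (m - 1 - i)))"
proof -
  assume "i < m"
  then have "m - i = Suc (m - 1 - i)" "m - Suc i = m - 1 - i" by simp_all
  then show "T i = form (H * (E ^ i * H ^ (m - 1 - i)))" "T (Suc i) = form (E * (E ^ i * H ^ (m - 1 - i)))"
    unfolding T_def by (simp_all only: power_Suc mult_ac)
qed

section \<open>Congruence modulo J\<close>

definition eqv :: "'k mpoly \<Rightarrow> 'k mpoly \<Rightarrow> bool" (infix "\<approx>" 50)
  where "p \<approx> q \<longleftrightarrow> vars p \<subseteq> VS (m + 3) \<and> vars q \<subseteq> VS (m + 3) \<and> p - q \<in> J"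

lemma eqv_refl [simp]: "p \<approx> p \<longleftrightarrow> vars p \<subseteq> VS (m + 3)"
  by (simp add: eqv_def J_closed(1))

lemma eqv_sym: "p \<approx> q \<Longrightarrow> q \<approx> p"
  using J_closed(6)[of "p - q"] by (simp add: eqv_def)

lemma eqv_trans [trans]: "p \<approx> q \<Longrightarrow> q \<approx> r \<Longrightarrow> p \<approx> r"
  using J_closed(2)[of "p - q" "q - r"] by (simp add: eqv_def)

lemma eqv_add: "p \<approx> q \<Longrightarrow> p' \<approx> q' \<Longrightarrow> p + p' \<approx> q + q'"
  using J_closed(2)[of "p - q" "p' - q'"] by (simp add: eqv_def algebra_simps)

lemma eqv_mult: "vars r \<subseteq> VS (m + 3) \<Longrightarrow> p \<approx> q \<Longrightarrow> r * p \<approx> r * q"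
  using J_closed(4)[of r "p - q"] by (simp add: eqv_def algebra_simps)

lemma eqv_mult_right: "vars r \<subseteq> VS (m + 3) \<Longrightarrow> p \<approx> q \<Longrightarrow> p * r \<approx> q * r"
  using eqv_mult[of r p q] by (simp add: mult.commute)

lemma eqv_gT: "i < m \<Longrightarrow> g * T i \<approx> h * T (Suc i)"
  using rel_gh[of "E ^ i * H ^ (m - 1 - i)"] degree_EH[of i "m - 1 - i"]
  by (simp add: eqv_def T_eq T_Suc_eq)

lemma eqv_TT_step: "i < m \<Longrightarrow> 0 < j \<Longrightarrow> j \<le> m \<Longrightarrow> T i * T j \<approx> T (Suc i) * T (j - 1)"
  using rel_forms[of "E ^ i * H ^ (m - 1 - i)" "E ^ (j - 1) * H ^ (m - 1 - (j - 1))"]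
    degree_EH[of i "m - 1 - i"] degree_EH[of "j - 1" "m - 1 - (j - 1)"]
    T_eq[of i] T_Suc_eq[of i] T_eq[of "j - 1"] T_Suc_eq[of "j - 1"]
    J_closed(6)[of "T (Suc i) * T (j - 1) - T i * T j"]
  by (simp add: eqv_def)

lemma eqv_TT: "k \<le> j \<Longrightarrow> i + k \<le> m \<Longrightarrow> j \<le> m \<Longrightarrow> T i * T j \<approx> T (i + k) * T (j - k)"
proof (induction k)
  case (Suc k)
  then have "T i * T j \<approx> T (i + k) * T (j - k)" by simp
  also have "\<dots> \<approx> T (Suc (i + k)) * T (j - k - 1)" by (rule eqv_TT_step) (use Suc in auto)
  finally show ?case by simp
qed simp

lemma eqv_TT_max:
  assumes "i \<le> m" "j \<le> m"
  shows "T i * T j \<approx> T (min (i + j) m) * T (i + j - m)"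
proof (cases "i + j \<le> m")
  case True
  then show ?thesis using eqv_TT[of j j i] assms by (simp add: min_def)
next
  case False
  then show ?thesis using eqv_TT[of "m - i" j i] assms by (simp add: min_def add.commute)
qed

lemma eqv_zw: "pz * (- pw 0) \<approx> g * w"
  using J_closed(6)[OF rel_z] by (simp add: eqv_def mult.commute)

section \<open>Normal forms\<close>

text \<open>\<open>N l r p\<close> is the product of \<open>l\<close> factors from \<open>h, g\<close> (of weights 0, 1) and \<open>r\<close> factors from
  \<open>T 0, \<dots>, T m\<close> (of weights \<open>0, \<dots>, m\<close>) with total weight \<open>p\<close>, in which the weight is packed
  greedily into the first factors. All products with the same \<open>l, r, p\<close> agree modulo \<open>J\<close>.\<close>

fun N :: "nat \<Rightarrow> nat \<Rightarrow> nat \<Rightarrow> 'k mpoly" where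
  "N (Suc l) r p = (if p = 0 then h * N l r 0 else g * N l r (p - 1))"
| "N 0 (Suc r) p = T (min p m) * N 0 r (p - m)"
| "N 0 0 p = 1"

lemma vars_N [simp]: "vars (N l r p) \<subseteq> VS (m + 3)"
  by (induction l r p rule: N.induct) auto

text \<open>Multiplication by a factor of weight \<open>i\<close> is compatible with the greedy normal form, since
  \<open>eqv_TT_max\<close> moves weight between two factors until the first one is full. The following two
  lemmas extend this to \<open>h\<close> and to the mixed case; for \<open>g\<close> it holds by definition of \<open>N\<close>.\<close>

lemma T_mult_N0: "i \<le> m \<Longrightarrow> p \<le> m * r \<Longrightarrow> T i * N 0 r p \<approx> N 0 (Suc r) (p + i)"
proof (induction r arbitrary: i p)
  case (Suc r)
  show ?case
  proof (cases "p \<le> m")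
    case True
    have "T i * N 0 (Suc r) p = T i * T p * N 0 r 0" using True by (simp add: mult.assoc min_def)
    also have "\<dots> \<approx> T (min (i + p) m) * T (i + p - m) * N 0 r 0"
      by (rule eqv_mult_right[OF vars_N eqv_TT_max]) (use True Suc in auto)
    also have "\<dots> = T (min (i + p) m) * (T (i + p - m) * N 0 r 0)" by (simp add: mult.assoc)
    also have "\<dots> \<approx> T (min (i + p) m) * N 0 (Suc r) (0 + (i + p - m))"
      by (rule eqv_mult[OF vars_T Suc.IH]) (use True Suc in auto)
    finally show ?thesis by (simp add: add.commute)
  next
    case False
    have "T i * N 0 (Suc r) p = T m * (T i * N 0 r (p - m))"
      using False by (simp add: mult_ac min_def)
    also have "\<dots> \<approx> T m * N 0 (Suc r) (p - m + i)"
      by (rule eqv_mult[OF vars_T Suc.IH]) (use False Suc in auto)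
    also have "\<dots> = N 0 (Suc (Suc r)) (p + i)"
      using False by (simp add: min_def)
    finally show ?thesis .
  qed
qed simp

lemma h_mult_N: "p \<le> l + m * r \<Longrightarrow> h * N l r p \<approx> N (Suc l) r p"
proof (induction l arbitrary: p)
  case 0
  show ?case
  proof (cases "p = 0")
    case False
    with 0 obtain r' where r: "r = Suc r'" by (cases r) auto
    let ?i = "min p m - 1"
    have i: "Suc ?i = min p m" "?i < m" using False m2 by auto
    have "h * N 0 r p = h * T (Suc ?i) * N 0 r' (p - m)" using i by (simp add: r mult.assoc)
    also have "\<dots> \<approx> g * T ?i * N 0 r' (p - m)"
      by (rule eqv_mult_right[OF vars_N eqv_sym[OF eqv_gT]]) (use i in auto)
    also have "\<dots> = g * (T ?i * N 0 r' (p - m))" by (simp add: mult.assoc)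
    also have "\<dots> \<approx> g * N 0 (Suc r') (p - m + ?i)"
      by (rule eqv_mult[OF _ T_mult_N0]) (use i 0 r in auto)
    also have "p - m + ?i = p - 1" using False m2 by auto
    finally show ?thesis using False by (simp add: r)
  qed auto
next
  case (Suc l)
  show ?case
  proof (cases "p = 0")
    case False
    have "h * N (Suc l) r p = g * (h * N l r (p - 1))" using False by (simp add: mult_ac)
    also have "\<dots> \<approx> g * N (Suc l) r (p - 1)" by (rule eqv_mult[OF _ Suc.IH]) (use Suc in auto)
    finally show ?thesis using False by simp
  qed auto
qed

lemma T_mult_N: "i \<le> m \<Longrightarrow> p \<le> l + m * r \<Longrightarrow> T i * N l r p \<approx> N l (Suc r) (p + i)"
proof (induction l arbitrary: p)
  case 0
  then show ?case by (simp only: T_mult_N0 add_0)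
next
  case (Suc l)
  show ?case
  proof (cases "p = 0")
    case True
    have "T i * N (Suc l) r p = h * (T i * N l r 0)" using True by (simp add: mult_ac)
    also have "\<dots> \<approx> h * N l (Suc r) (0 + i)" by (rule eqv_mult[OF _ Suc.IH]) (use Suc in auto)
    also have "\<dots> \<approx> N (Suc l) (Suc r) (0 + i)" by (rule h_mult_N) (use Suc in auto)
    finally show ?thesis using True by simp
  next
    case False
    have "T i * N (Suc l) r p = g * (T i * N l r (p - 1))" using False by (simp add: mult_ac)
    also have "\<dots> \<approx> g * N l (Suc r) (p - 1 + i)" by (rule eqv_mult[OF _ Suc.IH]) (use Suc in auto)
    also have "\<dots> = N (Suc l) (Suc r) (p + i)" using False by simp
    finally show ?thesis .
  qed
qed

end

section \<open>Coordinates on B\<close>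

text \<open>The ring \<open>B\<close> embeds into a polynomial ring in the eight coordinates
  \<open>\<lambda>\<^sub>1, \<lambda>\<^sub>2, \<rho>, \<epsilon>\<^sub>1, \<epsilon>\<^sub>2, \<eta>, \<omega>\<^sub>1, \<omega>\<^sub>2\<close>, numbered from 0 to 7, whose products
  \<open>\<lambda> = \<lambda>\<^sub>1 \<lambda>\<^sub>2\<close> and \<open>\<epsilon> = \<epsilon>\<^sub>1 \<epsilon>\<^sub>2\<close> occur in the parametrization of the scroll. The splitting into
  two factors is forced by \<open>z w\<^sub>0 = - g w\<close>: each of the three factors of
  \<open>g w = \<lambda> \<epsilon> (\<omega>\<^sub>1 \<omega>\<^sub>2)\<close> is distributed between \<open>z = \<lambda>\<^sub>1 \<epsilon>\<^sub>1 \<omega>\<^sub>1\<close> and \<open>- w\<^sub>0 = \<lambda>\<^sub>2 \<epsilon>\<^sub>2 \<omega>\<^sub>2\<close>.\<close>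

definition expo :: "nat \<Rightarrow> nat \<Rightarrow> nat \<Rightarrow> nat \<Rightarrow> nat \<Rightarrow> nat \<Rightarrow> nat \<Rightarrow> nat \<Rightarrow> nat \<Rightarrow>\<^sub>0 nat"
  where "expo l1 l2 r e1 e2 q o1 o2 = Poly_Mapping.single 0 l1 + Poly_Mapping.single 1 l2
    + Poly_Mapping.single 2 r + Poly_Mapping.single 3 e1 + Poly_Mapping.single 4 e2
    + Poly_Mapping.single 5 q + Poly_Mapping.single 6 o1 + Poly_Mapping.single 7 o2"

lemma lookup_expo [simp]:
  "lookup (expo l1 l2 r e1 e2 q o1 o2) 0 = l1" "lookup (expo l1 l2 r e1 e2 q o1 o2) (Suc 0) = l2"
  "lookup (expo l1 l2 r e1 e2 q o1 o2) 2 = r" "lookup (expo l1 l2 r e1 e2 q o1 o2) 3 = e1"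
  "lookup (expo l1 l2 r e1 e2 q o1 o2) 4 = e2" "lookup (expo l1 l2 r e1 e2 q o1 o2) 5 = q"
  "lookup (expo l1 l2 r e1 e2 q o1 o2) 6 = o1" "lookup (expo l1 l2 r e1 e2 q o1 o2) 7 = o2"
  by (simp_all add: expo_def lookup_add lookup_single)

lemma expo_add: "expo l1 l2 r e1 e2 q o1 o2 + expo l1' l2' r' e1' e2' q' o1' o2'
    = expo (l1 + l1') (l2 + l2') (r + r') (e1 + e1') (e2 + e2') (q + q') (o1 + o1') (o2 + o2')"
  by (simp add: expo_def single_add add_ac)

definition tmon :: "(nat \<Rightarrow>\<^sub>0 nat) \<Rightarrow> ((nat \<Rightarrow>\<^sub>0 nat) \<Rightarrow>\<^sub>0 'k::field)"
  where "tmon \<kappa> = Poly_Mapping.single \<kappa> 1"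

lemma tmon_mult: "tmon \<kappa> * tmon \<kappa>' = tmon (\<kappa> + \<kappa>')"
  by (simp add: tmon_def mult_single)

abbreviation const :: "'k::field \<Rightarrow> ((nat \<Rightarrow>\<^sub>0 nat) \<Rightarrow>\<^sub>0 'k)"
  where "const \<equiv> Poly_Mapping.single 0"

lemma const_simps:
  "const (u + v) = const u + const v" "const (u * v) = const u * const v"
  "const (- u) = - const u" "const (u - v) = const u - const v"
  by (simp_all add: single_add mult_single single_uminus single_diff)

context scroll
begin

definition lam :: "(nat \<Rightarrow>\<^sub>0 nat) \<Rightarrow>\<^sub>0 'k" where "lam = tmon (expo 1 1 0 0 0 0 0 0)"
definition eps :: "(nat \<Rightarrow>\<^sub>0 nat) \<Rightarrow>\<^sub>0 'k" where "eps = tmon (expo 0 0 0 1 1 0 0 0)"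
definition eta :: "(nat \<Rightarrow>\<^sub>0 nat) \<Rightarrow>\<^sub>0 'k" where "eta = tmon (expo 0 0 0 0 0 1 0 0)"
definition rho :: "(nat \<Rightarrow>\<^sub>0 nat) \<Rightarrow>\<^sub>0 'k" where "rho = tmon (expo 0 0 1 0 0 0 0 0)"
definition sig :: "(nat \<Rightarrow>\<^sub>0 nat) \<Rightarrow>\<^sub>0 'k" where "sig = const d * eps + const b * eta"
definition tau :: "(nat \<Rightarrow>\<^sub>0 nat) \<Rightarrow>\<^sub>0 'k" where "tau = const a * eta - const c * eps"
definition w0m :: "(nat \<Rightarrow>\<^sub>0 nat) \<Rightarrow>\<^sub>0 'k" where "w0m = tmon (expo 0 1 0 0 1 0 0 1)"

text \<open>On the scroll \<open>x = \<lambda> \<sigma>\<close>, \<open>y = - \<lambda> \<tau>\<close> and \<open>t\<^sub>j = \<rho> \<sigma>\<^sup>j \<tau>\<^sup>m\<^sup>-\<^sup>j\<close>; the value of \<open>w\<^sub>j\<^sub>+\<^sub>1\<close> is chosen such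
  that \<open>t\<^sub>j\<close> gets this value. The forms \<open>\<sigma>, \<tau>\<close> are written in the basis
  \<open>\<epsilon> = a \<sigma> - b \<tau>\<close>, \<open>\<eta> = c \<sigma> + d \<tau>\<close>, so that \<open>g = \<lambda> \<epsilon>\<close> and \<open>h = \<lambda> \<eta>\<close> are monomials.\<close>

definition coord :: "var \<Rightarrow> ((nat \<Rightarrow>\<^sub>0 nat) \<Rightarrow>\<^sub>0 'k)"
  where "coord v = (case v of
      Vx \<Rightarrow> lam * sig
    | Vy \<Rightarrow> - (lam * tau)
    | Vz \<Rightarrow> tmon (expo 1 0 0 1 0 0 1 0)
    | Vw k \<Rightarrow> if k = 0 then - w0m
        else if k = m + 2 then tmon (expo 0 0 0 0 0 0 1 1)
        else rho * (sig ^ (k - 1) * tau ^ (m - (k - 1))) + const (\<gamma> (k - 1)) * w0m)"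

abbreviation \<Psi> where "\<Psi> \<equiv> evalp coord"

lemma const_det: "const a * const d + const b * const c = (1 :: (nat \<Rightarrow>\<^sub>0 nat) \<Rightarrow>\<^sub>0 'k)"
  using unimodular by (simp flip: const_simps)

lemma eps_eq: "const a * sig - const b * tau = eps" and eta_eq: "const c * sig + const d * tau = eta"
proof -
  have "const a * sig - const b * tau = (const a * const d + const b * const c) * eps"
    "const c * sig + const d * tau = (const a * const d + const b * const c) * eta"
    by (simp_all add: sig_def tau_def algebra_simps)
  then show "const a * sig - const b * tau = eps" "const c * sig + const d * tau = eta"
    by (simp_all add: const_det)
qed

text \<open>The homogenization of \<open>P\<close> in degree \<open>k\<close>, evaluated at \<open>\<sigma>, \<tau>\<close>; the value of \<open>form P\<close> is \<open>\<rho>\<close> times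
  the one of degree \<open>m\<close>.\<close>

definition homog :: "nat \<Rightarrow> 'k poly \<Rightarrow> ((nat \<Rightarrow>\<^sub>0 nat) \<Rightarrow>\<^sub>0 'k)"
  where "homog k P = (\<Sum>j\<le>k. const (poly.coeff P j) * (sig ^ j * tau ^ (k - j)))"

lemma homog_linear_mult:
  assumes "degree P \<le> k"
  shows "homog (Suc k) ([:u, v:] * P) = (const v * sig + const u * tau) * homog k P"
proof -
  have c: "poly.coeff P (Suc k) = 0" using assms by (simp add: coeff_eq_0)
  have "homog (Suc k) ([:u, v:] * P)
      = (\<Sum>j\<le>Suc k. const (u * poly.coeff P j) * (sig ^ j * tau ^ (Suc k - j)))
        + (\<Sum>j\<le>Suc k. const (poly.coeff (pCons 0 (Polynomial.smult v P)) j) * (sig ^ j * tau ^ (Suc k - j)))"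
    unfolding homog_def by (simp add: const_simps distrib_right sum.distrib)
  also have "(\<Sum>j\<le>Suc k. const (u * poly.coeff P j) * (sig ^ j * tau ^ (Suc k - j)))
      = const u * tau * homog k P"
    unfolding homog_def
    by (simp add: c sum_distrib_left const_simps Suc_diff_le mult_ac)
  also have "(\<Sum>j\<le>Suc k. const (poly.coeff (pCons 0 (Polynomial.smult v P)) j) * (sig ^ j * tau ^ (Suc k - j)))
      = const v * sig * homog k P"
    unfolding homog_def sum.atMost_Suc_shift
    by (simp add: sum_distrib_left const_simps mult_ac)
  finally show ?thesis by (simp add: algebra_simps)
qed

lemma homog_EH: "homog (i + j) (E ^ i * H ^ j) = eps ^ i * eta ^ j"
proof (induction i)
  case 0
  show ?case
  proof (induction j)
    case (Suc j)
    have "homog (Suc j) (H * H ^ j) = eta * homog j (H ^ j)"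
      unfolding H_def by (subst homog_linear_mult) (use degree_EH[of 0 j] in \<open>simp_all add: H_def flip: eta_eq\<close>)
    then show ?case using Suc by simp
  qed (simp add: homog_def)
next
  case (Suc i)
  have "homog (Suc (i + j)) (E * (E ^ i * H ^ j)) = (const a * sig + const (- b) * tau) * homog (i + j) (E ^ i * H ^ j)"
    using homog_linear_mult[OF degree_EH] unfolding E_def .
  then show ?case using Suc by (simp add: const_simps eps_eq mult.assoc)
qed

lemma Psi_t: "j \<le> m \<Longrightarrow> \<Psi> (t j) = rho * (sig ^ j * tau ^ (m - j))"
  by (simp add: t_def coord_def)

lemma Psi_form: "\<Psi> (form P) = rho * homog m P"
  unfolding form_def homog_def by (simp add: Psi_t sum_distrib_left mult_ac)

lemma eps_eta_power: "eps ^ i = tmon (expo 0 0 0 i i 0 0 0)" "eta ^ i = tmon (expo 0 0 0 0 0 i 0 0)"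
proof -
  have "expo 0 0 0 0 0 0 0 0 = 0" by (simp add: expo_def)
  then have 1: "tmon (expo 0 0 0 0 0 0 0 0) = 1" by (simp add: tmon_def)
  show "eps ^ i = tmon (expo 0 0 0 i i 0 0 0)" "eta ^ i = tmon (expo 0 0 0 0 0 i 0 0)"
    by (induction i) (simp_all add: 1 eps_def eta_def tmon_mult expo_add)
qed

text \<open>The generators \<open>g, h, T i, z, - w\<^sub>0, w\<close> all become monomials, which reduces the remaining questions
  about \<open>B\<close> to exponents.\<close>

lemma Psi_gens:
  "\<Psi> g = tmon (expo 1 1 0 1 1 0 0 0)" "\<Psi> h = tmon (expo 1 1 0 0 0 1 0 0)"
  "i \<le> m \<Longrightarrow> \<Psi> (T i) = tmon (expo 0 0 1 i i (m - i) 0 0)"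
  "\<Psi> pz = tmon (expo 1 0 0 1 0 0 1 0)" "\<Psi> (- pw 0) = tmon (expo 0 1 0 0 1 0 0 1)"
  "\<Psi> w = tmon (expo 0 0 0 0 0 0 1 1)"
proof -
  have "\<Psi> g = lam * (const a * sig - const b * tau)"
    by (simp add: g_def coord_def algebra_simps)
  then show "\<Psi> g = tmon (expo 1 1 0 1 1 0 0 0)"
    by (simp add: eps_eq lam_def eps_def tmon_mult expo_add)
  have "\<Psi> h = lam * (const c * sig + const d * tau)"
    by (simp add: h_def coord_def algebra_simps)
  then show "\<Psi> h = tmon (expo 1 1 0 0 0 1 0 0)"
    by (simp add: eta_eq lam_def eta_def tmon_mult expo_add)
  show "\<Psi> (T i) = tmon (expo 0 0 1 i i (m - i) 0 0)" if "i \<le> m"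
    using homog_EH[of i "m - i"] that
    by (simp add: T_def Psi_form eps_eta_power rho_def tmon_mult expo_add)
qed (simp_all add: coord_def w0m_def w_def)

subsection \<open>The section of the coordinate map\<close>

text \<open>The monomials of degree zero for the three gradings of the coordinate ring in which all generators
  have degree zero. The image of the coordinate map is spanned by them.\<close>

definition Mon :: "(nat \<Rightarrow>\<^sub>0 nat) set"
  where "Mon = {\<mu>. lookup \<mu> 0 + lookup \<mu> 4 = lookup \<mu> 1 + lookup \<mu> 3
    \<and> lookup \<mu> 0 + lookup \<mu> 7 = lookup \<mu> 1 + lookup \<mu> 6
    \<and> lookup \<mu> 4 + lookup \<mu> 5 = lookup \<mu> 1 + m * lookup \<mu> 2}"

definition zpart :: "(nat \<Rightarrow>\<^sub>0 nat) \<Rightarrow> 'k mpoly"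
  where "zpart \<mu> = pz ^ (lookup \<mu> 0 - lookup \<mu> 1) * (- pw 0) ^ (lookup \<mu> 1 - lookup \<mu> 0)"

text \<open>A product of generators that maps to the monomial \<open>\<mu>\<close>. By the first two conditions in \<open>Mon\<close> the
  excess of \<open>\<lambda>\<^sub>1\<close> over \<open>\<lambda>\<^sub>2\<close> is also that of \<open>\<epsilon>\<^sub>1\<close> over \<open>\<epsilon>\<^sub>2\<close> and of \<open>\<omega>\<^sub>1\<close> over \<open>\<omega>\<^sub>2\<close>; it is absorbed
  by a power of \<open>z\<close> or of \<open>- w\<^sub>0\<close>, depending on its sign (one of the two truncated differences in
  \<open>zpart\<close> is 0), and the minima are left for \<open>w\<close> and for the normal form.\<close>

definition lift :: "(nat \<Rightarrow>\<^sub>0 nat) \<Rightarrow> 'k mpoly"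
  where "lift \<mu> = zpart \<mu> * w ^ min (lookup \<mu> 6) (lookup \<mu> 7)
    * N (min (lookup \<mu> 0) (lookup \<mu> 1)) (lookup \<mu> 2) (min (lookup \<mu> 3) (lookup \<mu> 4))"

lemma vars_zpart [simp]: "vars (zpart \<mu>) \<subseteq> VS (m + 3)"
  unfolding zpart_def by (intro vars_closed(2,4)) simp_all

lemma vars_lift [simp]: "vars (lift \<mu>) \<subseteq> VS (m + 3)"
  unfolding lift_def by (intro vars_closed(2,4)) simp_all

lemma vars_wpow [simp]: "vars (w ^ k) \<subseteq> VS (m + 3)"
  by (intro vars_closed(4)) simp

text \<open>This lemma and its analogues for \<open>g, h, T i, z, - w\<^sub>0\<close> hold because \<open>N\<close> absorbs the factors
  \<open>g, h, T i\<close> modulo \<open>J\<close>. For \<open>z\<close> and \<open>- w\<^sub>0\<close> a factor of the opposite kind may be present, and then the relation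
  \<open>z (- w\<^sub>0) = g w\<close> cancels the two.\<close>

lemma lift_w: "\<mu> \<in> Mon \<Longrightarrow> lift (expo 0 0 0 0 0 0 1 1 + \<mu>) \<approx> w * lift \<mu>"
  by (simp add: lift_def zpart_def lookup_add mult_ac vars_closed del: vars_lift)

lemma N_bound: "\<mu> \<in> Mon \<Longrightarrow> min (lookup \<mu> 3) (lookup \<mu> 4) \<le> min (lookup \<mu> 0) (lookup \<mu> 1) + m * lookup \<mu> 2"
  by (auto simp: Mon_def)

lemma eqv_eqI: "p = q \<Longrightarrow> vars q \<subseteq> VS (m + 3) \<Longrightarrow> p \<approx> q"
  by simp

lemma lift_g: "\<mu> \<in> Mon \<Longrightarrow> lift (expo 1 1 0 1 1 0 0 0 + \<mu>) \<approx> g * lift \<mu>"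
  by (rule eqv_eqI) (simp_all add: lift_def zpart_def lookup_add mult_ac)

lemma lift_h: "\<mu> \<in> Mon \<Longrightarrow> lift (expo 1 1 0 0 0 1 0 0 + \<mu>) \<approx> h * lift \<mu>"
proof -
  assume \<mu>: "\<mu> \<in> Mon"
  let ?p = "zpart \<mu> * w ^ min (lookup \<mu> 6) (lookup \<mu> 7)"
  let ?l = "min (lookup \<mu> 0) (lookup \<mu> 1)" and ?e = "min (lookup \<mu> 3) (lookup \<mu> 4)"
  have "lift (expo 1 1 0 0 0 1 0 0 + \<mu>) = ?p * N (Suc ?l) (lookup \<mu> 2) ?e"
    by (simp add: lift_def zpart_def lookup_add)
  also have "\<dots> \<approx> ?p * (h * N ?l (lookup \<mu> 2) ?e)"
    by (rule eqv_mult[OF _ eqv_sym[OF h_mult_N]]) (use N_bound[OF \<mu>] in simp_all)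
  also have "\<dots> = h * lift \<mu>" by (simp add: lift_def mult_ac)
  finally show ?thesis .
qed

lemma lift_T: "\<mu> \<in> Mon \<Longrightarrow> i \<le> m \<Longrightarrow> lift (expo 0 0 1 i i (m - i) 0 0 + \<mu>) \<approx> T i * lift \<mu>"
proof -
  assume \<mu>: "\<mu> \<in> Mon" and i: "i \<le> m"
  let ?p = "zpart \<mu> * w ^ min (lookup \<mu> 6) (lookup \<mu> 7)"
  let ?l = "min (lookup \<mu> 0) (lookup \<mu> 1)" and ?e = "min (lookup \<mu> 3) (lookup \<mu> 4)"
  have "lift (expo 0 0 1 i i (m - i) 0 0 + \<mu>) = ?p * N ?l (Suc (lookup \<mu> 2)) (?e + i)"
    by (simp add: lift_def zpart_def lookup_add min_add_distrib_left min_add_distrib_right add.commute)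
  also have "\<dots> \<approx> ?p * (T i * N ?l (lookup \<mu> 2) ?e)"
    by (rule eqv_mult[OF _ eqv_sym[OF T_mult_N]]) (use N_bound[OF \<mu>] i in simp_all)
  also have "\<dots> = T i * lift \<mu>" by (simp add: lift_def mult_ac)
  finally show ?thesis .
qed

lemma cancel_zw: "vars q \<subseteq> VS (m + 3) \<Longrightarrow> q * (g * w) \<approx> pz * ((- pw 0) * q)"
  using eqv_mult[of q, OF _ eqv_sym[OF eqv_zw]] by (simp add: mult_ac)

lemma lift_z: "\<mu> \<in> Mon \<Longrightarrow> lift (expo 1 0 0 1 0 0 1 0 + \<mu>) \<approx> pz * lift \<mu>"
proof (cases "lookup \<mu> 1 \<le> lookup \<mu> 0")
  case True
  assume \<mu>: "\<mu> \<in> Mon"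
  have "min (Suc (lookup \<mu> 6)) (lookup \<mu> 7) = min (lookup \<mu> 6) (lookup \<mu> 7)"
    "min (Suc (lookup \<mu> 3)) (lookup \<mu> 4) = min (lookup \<mu> 3) (lookup \<mu> 4)"
    "min (Suc (lookup \<mu> 0)) (lookup \<mu> 1) = min (lookup \<mu> 0) (lookup \<mu> 1)"
    using \<mu> True by (auto simp: Mon_def)
  then show ?thesis using True
    by (intro eqv_eqI) (simp_all add: lift_def zpart_def lookup_add mult_ac Suc_diff_le)
next
  case False
  assume \<mu>: "\<mu> \<in> Mon"
  have "lookup \<mu> 0 < lookup \<mu> 1" using False by simp
  then obtain k where k: "lookup \<mu> 1 = Suc (lookup \<mu> 0 + k)" by (rule less_natE)
  have o: "lookup \<mu> 7 = Suc (lookup \<mu> 6 + k)" "lookup \<mu> 4 = Suc (lookup \<mu> 3 + k)"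
    using \<mu> k by (auto simp: Mon_def)
  let ?q = "(- pw 0) ^ k * w ^ lookup \<mu> 6 * N (lookup \<mu> 0) (lookup \<mu> 2) (lookup \<mu> 3)"
  have q: "vars ?q \<subseteq> VS (m + 3)" by (intro vars_closed(2,4)) simp_all
  have "lift (expo 1 0 0 1 0 0 1 0 + \<mu>) = ?q * (g * w)"
    using k o by (simp add: lift_def zpart_def lookup_add min_def mult_ac)
  also have "\<dots> \<approx> pz * ((- pw 0) * ?q)" by (rule cancel_zw[OF q])
  also have "\<dots> = pz * lift \<mu>"
    using k o by (simp add: lift_def zpart_def lookup_add min_def mult_ac)
  finally show ?thesis .
qed

lemma lift_w0: "\<mu> \<in> Mon \<Longrightarrow> lift (expo 0 1 0 0 1 0 0 1 + \<mu>) \<approx> (- pw 0) * lift \<mu>"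
proof (cases "lookup \<mu> 0 \<le> lookup \<mu> 1")
  case True
  assume \<mu>: "\<mu> \<in> Mon"
  have "min (lookup \<mu> 6) (Suc (lookup \<mu> 7)) = min (lookup \<mu> 6) (lookup \<mu> 7)"
    "min (lookup \<mu> 3) (Suc (lookup \<mu> 4)) = min (lookup \<mu> 3) (lookup \<mu> 4)"
    "min (lookup \<mu> 0) (Suc (lookup \<mu> 1)) = min (lookup \<mu> 0) (lookup \<mu> 1)"
    using \<mu> True by (auto simp: Mon_def)
  then show ?thesis using True
    by (intro eqv_eqI) (simp_all add: lift_def zpart_def lookup_add mult_ac Suc_diff_le)
next
  case False
  assume \<mu>: "\<mu> \<in> Mon"
  have "lookup \<mu> 1 < lookup \<mu> 0" using False by simp
  then obtain k where k: "lookup \<mu> 0 = Suc (lookup \<mu> 1 + k)" by (rule less_natE)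
  have o: "lookup \<mu> 6 = Suc (lookup \<mu> 7 + k)" "lookup \<mu> 3 = Suc (lookup \<mu> 4 + k)"
    using \<mu> k by (auto simp: Mon_def)
  let ?q = "pz ^ k * w ^ lookup \<mu> 7 * N (lookup \<mu> 1) (lookup \<mu> 2) (lookup \<mu> 4)"
  have q: "vars ?q \<subseteq> VS (m + 3)" by (intro vars_closed(2,4)) simp_all
  have "lift (expo 0 1 0 0 1 0 0 1 + \<mu>) = ?q * (g * w)"
    using k o by (simp add: lift_def zpart_def lookup_add min_def mult_ac)
  also have "\<dots> \<approx> pz * ((- pw 0) * ?q)" by (rule cancel_zw[OF q])
  also have "\<dots> = (- pw 0) * lift \<mu>"
    using k o by (simp add: lift_def zpart_def lookup_add min_def mult_ac)
  finally show ?thesis .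
qed

lemma linext_lift_tmon_mult:
  assumes "\<And>\<mu>. \<mu> \<in> Mon \<Longrightarrow> lift (\<kappa> + \<mu>) \<approx> v * lift \<mu>" and v: "vars v \<subseteq> VS (m + 3)"
    and "keys f \<subseteq> Mon"
  shows "linext lift (tmon \<kappa> * f) \<approx> v * linext lift f"
  using assms(3)
proof (induction f rule: poly_mapping_induct_on)
  case (single \<mu> u)
  have "linext lift (tmon \<kappa> * Poly_Mapping.single \<mu> u) = pconst u * lift (\<kappa> + \<mu>)"
    by (simp add: tmon_def mult_single linext_single pconst_def)
  also have "\<dots> \<approx> pconst u * (v * lift \<mu>)" by (rule eqv_mult[OF _ assms(1)[OF single]]) simp
  also have "\<dots> = v * linext lift (Poly_Mapping.single \<mu> u)"
    by (simp add: linext_single pconst_def mult_ac)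
  finally show ?case .
qed (simp_all add: linext_add distrib_left eqv_add)

text \<open>A polynomial is good if the linear section recovers it from its coordinates modulo \<open>J\<close>. All
  polynomials are good, because goodness passes to sums and to multiples by generators.\<close>

definition good :: "'k mpoly \<Rightarrow> bool"
  where "good p \<longleftrightarrow> keys (\<Psi> p) \<subseteq> Mon \<and> p \<approx> linext lift (\<Psi> p)"

lemma good_add: "good p \<Longrightarrow> good q \<Longrightarrow> good (p + q)"
  unfolding good_def using keys_add[of "\<Psi> p" "\<Psi> q"] by (auto simp: linext_add eqv_add)

lemma good_gen:
  assumes "\<Psi> v = tmon \<kappa>" "\<And>\<mu>. \<mu> \<in> Mon \<Longrightarrow> lift (\<kappa> + \<mu>) \<approx> v * lift \<mu>" "\<kappa> \<in> Mon"
    "vars v \<subseteq> VS (m + 3)" "good p"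
  shows "good (v * p)"
proof -
  have "keys (\<Psi> (v * p)) \<subseteq> Mon"
    using assms(3,5) unfolding good_def
    by (auto simp: assms(1) tmon_def keys_single_mult Mon_def lookup_add algebra_simps)
  moreover have "v * p \<approx> v * linext lift (\<Psi> p)"
    using assms(4,5) by (auto simp: good_def intro: eqv_mult)
  from eqv_trans[OF this eqv_sym[OF linext_lift_tmon_mult[OF assms(2,4)]]]
  have "v * p \<approx> linext lift (\<Psi> (v * p))"
    using assms(5) by (simp add: good_def assms(1))
  ultimately show ?thesis by (simp add: good_def)
qed

lemma good_pconst_mult: "good p \<Longrightarrow> good (pconst u * p)"
proof -
  assume p: "good p"
  have l: "linext lift (const u * f) = pconst u * linext lift f" for f
    using subset_UNIV[of "keys f"]
    by (induction f rule: poly_mapping_induct_on)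
       (simp_all add: linext_add distrib_left mult_single linext_single pconst_def flip: mult.assoc)
  have "keys (const u * \<Psi> p) \<subseteq> keys (\<Psi> p)"
    using keys_mult[of "const u" "\<Psi> p"] by (auto split: if_splits)
  then show ?thesis using p eqv_mult[of "pconst u" p] by (auto simp: good_def l)
qed

lemma good_1: "good 1"
  by (auto simp: good_def Mon_def linext_def lift_def zpart_def)

lemma good_mult_gens:
  assumes "good p"
  shows "good (g * p)" "good (h * p)" "i \<le> m \<Longrightarrow> good (T i * p)" "good (pz * p)" "good (- pw 0 * p)" "good (w * p)"
proof -
  show "good (g * p)"
    by (rule good_gen[OF Psi_gens(1) lift_g _ _ assms]) (simp_all add: Mon_def)
  show "good (h * p)"
    by (rule good_gen[OF Psi_gens(2) lift_h _ _ assms]) (simp_all add: Mon_def)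
  show "good (T i * p)" if "i \<le> m"
    by (rule good_gen[OF Psi_gens(3)[OF that] lift_T[OF _ that] _ _ assms]) (use that in \<open>simp_all add: Mon_def\<close>)
  show "good (pz * p)"
    by (rule good_gen[OF Psi_gens(4) lift_z _ _ assms]) (simp_all add: Mon_def)
  show "good (- pw 0 * p)"
    by (rule good_gen[OF Psi_gens(5) lift_w0 _ _ assms]) (simp_all add: Mon_def)
  show "good (w * p)"
    by (rule good_gen[OF Psi_gens(6) lift_w _ _ assms]) (simp_all add: Mon_def)
qed

text \<open>Substituting \<open>X = dE + bH\<close> and \<open>1 = aH - cE\<close> writes every form in the \<open>t\<close>'s as a linear
  combination of \<open>T 0, \<dots>, T m\<close>.\<close>

lemma X_one_eq: "pCons 0 P = Polynomial.smult d (E * P) + Polynomial.smult b (H * P)"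
  "P = Polynomial.smult a (H * P) + Polynomial.smult (- c) (E * P)"
proof -
  have 1: "[:0, 1:] = Polynomial.smult d E + Polynomial.smult b H" "1 = Polynomial.smult a H + Polynomial.smult (- c) E"
    using unimodular by (simp_all add: E_def H_def one_pCons algebra_simps)
  have "pCons 0 P = [:0, 1:] * P" by simp
  then show "pCons 0 P = Polynomial.smult d (E * P) + Polynomial.smult b (H * P)"
    by (simp only: 1) (simp add: distrib_right)
  have "(Polynomial.smult a H + Polynomial.smult (- c) E) * P = P" unfolding 1(2)[symmetric] by simp
  then show "P = Polynomial.smult a (H * P) + Polynomial.smult (- c) (E * P)"
    by (simp only: distrib_right mult_smult_left)
qed

lemma good_form_EH:
  assumes "good p"
  shows "k + i + j \<le> m \<Longrightarrow> good (form ((pCons 0 ^^ k) (E ^ i * H ^ j)) * p)"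
proof (induction k arbitrary: i j)
  case 0
  then show ?case
  proof (induction "m - (i + j)" arbitrary: i j)
    case 0
    then have "j = m - i" "i \<le> m" by auto
    then show ?case using good_mult_gens(3)[OF assms, of i] by (simp add: T_def)
  next
    case (Suc k)
    have "good (form (E ^ i * H ^ Suc j) * p)" "good (form (E ^ Suc i * H ^ j) * p)"
      using Suc.hyps(1)[of i "Suc j"] Suc.hyps(1)[of "Suc i" j] Suc.hyps(2) Suc.prems by auto
    then have "good (pconst a * (form (E ^ i * H ^ Suc j) * p) + pconst (- c) * (form (E ^ Suc i * H ^ j) * p))"
      by (intro good_add good_pconst_mult)
    also have "pconst a * (form (E ^ i * H ^ Suc j) * p) + pconst (- c) * (form (E ^ Suc i * H ^ j) * p)
        = form (E ^ i * H ^ j) * p"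
    proof -
      have "form (E ^ i * H ^ j) = pconst a * form (H * (E ^ i * H ^ j)) + pconst (- c) * form (E * (E ^ i * H ^ j))"
        by (subst X_one_eq(2)) (simp only: form_add form_smult)
      then show ?thesis by (simp add: distrib_right distrib_left mult_ac)
    qed
    finally show ?case by simp
  qed
next
  case (Suc k)
  have lin: "form ((pCons 0 ^^ k) (Polynomial.smult u P + Polynomial.smult v Q))
      = pconst u * form ((pCons 0 ^^ k) P) + pconst v * form ((pCons 0 ^^ k) Q)" for u v P Q
  proof -
    have "(pCons 0 ^^ k) (Polynomial.smult u P + Polynomial.smult v Q)
      = Polynomial.smult u ((pCons 0 ^^ k) P) + Polynomial.smult v ((pCons 0 ^^ k) Q)"
      by (induction k) simp_all
    then show ?thesis by (simp add: form_add form_smult)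
  qed
  have "good (form ((pCons 0 ^^ k) (E ^ Suc i * H ^ j)) * p)" "good (form ((pCons 0 ^^ k) (E ^ i * H ^ Suc j)) * p)"
    using Suc.IH[of "Suc i" j] Suc.IH[of i "Suc j"] Suc.prems by auto
  then have "good (pconst d * (form ((pCons 0 ^^ k) (E ^ Suc i * H ^ j)) * p)
      + pconst b * (form ((pCons 0 ^^ k) (E ^ i * H ^ Suc j)) * p))"
    by (intro good_add good_pconst_mult)
  also have "pconst d * (form ((pCons 0 ^^ k) (E ^ Suc i * H ^ j)) * p)
      + pconst b * (form ((pCons 0 ^^ k) (E ^ i * H ^ Suc j)) * p)
      = form ((pCons 0 ^^ k) (pCons 0 (E ^ i * H ^ j))) * p"
    unfolding X_one_eq(1)[of "E ^ i * H ^ j"] lin by (simp add: distrib_right distrib_left mult_ac)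
  finally show ?case by (simp add: funpow_swap1)
qed

lemma good_t: "j \<le> m \<Longrightarrow> good p \<Longrightarrow> good (t j * p)"
proof -
  assume j: "j \<le> m" and p: "good p"
  have X: "(pCons 0 ^^ j) 1 = monom (1::'k) j" by (induction j) (simp_all add: monom_Suc one_pCons)
  have "form (monom 1 j) = (\<Sum>i\<le>m. if i = j then t j else 0)"
    unfolding form_def by (rule sum.cong) (auto simp: pconst_simps)
  then have "form ((pCons 0 ^^ j) (E ^ 0 * H ^ 0)) = t j" using X j by simp
  then show ?thesis using good_form_EH[OF p, of j 0 0] j by simp
qed

lemma good_all:
  assumes "vars p \<subseteq> VS (m + 3)"
  shows "good p"
  using assms
proof (induction p rule: poly_ring_induct)
  case (const u)
  then show ?case using good_pconst_mult[OF good_1, of u] by simp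
next
  case (var v p)
  note gen = good_mult_gens[OF \<open>good p\<close>]
  have w0: "good (pw 0 * p)" using good_pconst_mult[OF gen(5), of "- 1"] by (simp add: pconst_simps)
  consider "v = Vx" | "v = Vy" | "v = Vz" | "v = Vw 0" | "v = Vw (m + 2)" | j where "v = Vw (Suc j)" "j \<le> m"
  proof (cases v)
    case (Vw k)
    then show thesis using var(1) that by (cases k) (auto simp: le_less_Suc_eq less_Suc_eq)
  qed (use that in auto)
  then show ?case
  proof cases
    case 1
    have "pconst d * (g * p) + pconst b * (h * p) = (pconst a * pconst d + pconst b * pconst c) * (px * p)"
      by (simp add: g_def h_def algebra_simps)
    then show ?thesis using good_add[OF good_pconst_mult[OF gen(1)] good_pconst_mult[OF gen(2)], of d b]
      by (simp add: det_pconst 1)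
  next
    case 2
    have "pconst c * (g * p) + pconst (- a) * (h * p) = (pconst a * pconst d + pconst b * pconst c) * (py * p)"
      by (simp add: g_def h_def algebra_simps pconst_simps)
    then show ?thesis using good_add[OF good_pconst_mult[OF gen(1)] good_pconst_mult[OF gen(2)], of c "- a"]
      by (simp add: det_pconst 2)
  next
    case (6 j)
    have "good (t j * p + pconst (- \<gamma> j) * (pw 0 * p))"
      by (intro good_add good_pconst_mult w0 good_t 6 var)
    then show ?thesis by (simp add: t_def 6 algebra_simps pconst_simps)
  qed (use gen w0 in \<open>simp_all add: w_def\<close>)
qed (rule good_add)

section \<open>The ideal J is the kernel\<close>

lemma Psi_L: "p \<in> genideal S L \<Longrightarrow> \<Psi> p = 0"
proof -
  have t: "\<Psi> (px * t j + py * t (Suc j)) = 0" if "j < m" for j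
  proof -
    have "m - j = Suc (m - Suc j)" using that by simp
    then show ?thesis using that by (simp add: Psi_t coord_def mult_ac)
  qed
  have "\<Psi> (pw 0) = - tmon (expo 0 1 0 0 1 0 0 1)" by (simp add: coord_def w0m_def)
  then have z: "\<Psi> (pz * pw 0 + g * w) = 0"
    by (simp add: Psi_gens tmon_mult expo_add del: evalp_pvar)
  have "ideal {p. vars p \<subseteq> VS (m + 3) \<and> \<Psi> p = 0} S"
    unfolding ideal_poly_ring_iff by (auto simp: vars_closed)
  moreover have "L \<subseteq> {p. vars p \<subseteq> VS (m + 3) \<and> \<Psi> p = 0}"
    using L_carrier t z unfolding L_def mem_poly_ring subset_iff Un_iff mem_Collect_eq singleton_iff
    by metis
  ultimately have "genideal S L \<subseteq> {p. vars p \<subseteq> VS (m + 3) \<and> \<Psi> p = 0}"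
    by (rule ring.genideal_minimal[OF cring.axioms(1)[OF cring_poly_ring]])
  then show "p \<in> genideal S L \<Longrightarrow> \<Psi> p = 0" by auto
qed

text \<open>An element of the kernel is congruent to the lift of 0. Conversely, an element of the colon ideal
  is multiplied by \<open>g\<close> into the ideal of \<open>L\<close>, which lies in the kernel, and the value of \<open>g\<close> is a
  monomial, so it can be cancelled.\<close>

lemma J_eq_kernel: "p \<in> J \<longleftrightarrow> vars p \<subseteq> VS (m + 3) \<and> \<Psi> p = 0"
proof
  assume p: "p \<in> J"
  then have x: "\<Psi> (p * px) = 0" and y: "\<Psi> (p * py) = 0" and v: "vars p \<subseteq> VS (m + 3)"
    using Psi_L unfolding mem_J by blast+
  have "\<Psi> g * \<Psi> p = const a * \<Psi> (p * px) + const b * \<Psi> (p * py)" by (simp add: g_def algebra_simps)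
  then have "\<Psi> g * \<Psi> p = 0" unfolding x y by simp
  then show "vars p \<subseteq> VS (m + 3) \<and> \<Psi> p = 0"
    using v single_mult_eq_0D unfolding Psi_gens tmon_def by blast
next
  assume p: "vars p \<subseteq> VS (m + 3) \<and> \<Psi> p = 0"
  then show "p \<in> J" using good_all[of p] by (simp add: good_def eqv_def)
qed

lemma eqv_iff: "p \<approx> q \<longleftrightarrow> vars p \<subseteq> VS (m + 3) \<and> vars q \<subseteq> VS (m + 3) \<and> \<Psi> p = \<Psi> q"
  by (auto simp: eqv_def J_eq_kernel vars_closed del: subsetI)

end

lemma val_ge_tmon_mult:
  "val_ge i k (tmon \<kappa> * f) \<longleftrightarrow> (\<forall>\<mu>\<in>keys f. k \<le> lookup \<kappa> i + lookup \<mu> i)"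
  unfolding tmon_def by (rule val_ge_single_mult)

context scroll
begin

section \<open>Divisibility conditions as ideals\<close>

text \<open>The positions 3, 4, 6, 7 hold the exponents of \<open>\<epsilon>\<^sub>1, \<epsilon>\<^sub>2, \<omega>\<^sub>1, \<omega>\<^sub>2\<close>. Divisibility by all four of
  them will turn out to describe \<open>K\<close>, double divisibility its symbolic square.\<close>

definition V :: "nat \<Rightarrow> 'k mpoly set"
  where "V k = {p. vars p \<subseteq> VS (m + 3) \<and> (\<forall>i\<in>{3,4,6,7}. val_ge i k (\<Psi> p))}"

lemma ideal_V: "ideal (V k) S"
  unfolding ideal_poly_ring_iff V_def by (intro conjI subsetI) (auto simp: vars_closed val_ge_add val_ge_multI del: subsetI)

lemma V_mult: "p \<in> V i \<Longrightarrow> q \<in> V j \<Longrightarrow> p * q \<in> V (i + j)"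
  by (auto simp: V_def vars_closed val_ge_mult del: subsetI)

text \<open>A polynomial is congruent to the combination of the lifts of its monomials, and divisibility by
  coordinates is tested on monomials.\<close>

lemma V_subset_ideal:
  assumes A: "ideal A S" and J: "J \<subseteq> A"
    and l: "\<And>\<mu>. \<mu> \<in> Mon \<Longrightarrow> \<forall>i\<in>{3,4,6,7}. k \<le> lookup \<mu> i \<Longrightarrow> lift \<mu> \<in> A"
    and p: "p \<in> V k"
  shows "p \<in> A"
proof -
  note cl = poly_ideal_closed[OF A]
  have good: "good p" using p good_all by (auto simp: V_def)
  have "linext lift (\<Psi> p) = (\<Sum>\<mu>\<in>keys (\<Psi> p). pconst (lookup (\<Psi> p) \<mu>) * lift \<mu>)"
    by (simp add: linext_def pconst_def)
  also have "\<dots> \<in> A"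
    using good p by (intro poly_ideal_sum[OF A] cl(4) l) (auto simp: good_def V_def val_ge_def)
  finally have "(p - linext lift (\<Psi> p)) + linext lift (\<Psi> p) \<in> A"
    using good J by (intro cl(2)) (auto simp: good_def eqv_def)
  then show ?thesis by simp
qed

text \<open>This is the minor \<open>\<aa>\<^sub>i\<^sub>+\<^sub>1\<close>, and \<open>q2 i\<close> is the corresponding generator of \<open>N\<^sub>3\<close>. They
  are equal to \<open>- w form (E X\<^sup>i)\<close> and \<open>w\<^sup>2 form (E\<^sup>2 X\<^sup>i)\<close>, and since \<open>E\<close> corresponds to \<open>\<epsilon>\<close> they are
  divisible by \<open>\<epsilon>\<close> once and twice.\<close>

definition fr :: "nat \<Rightarrow> 'k mpoly"
  where "fr i = w * (pconst b * t i - pconst a * t (Suc i))"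

definition q2 :: "nat \<Rightarrow> 'k mpoly"
  where "q2 i = - pconst a * w * fr (Suc i) + pconst b * w * fr i"

lemma vars_fr [simp]: "i < m \<Longrightarrow> vars (fr i) \<subseteq> VS (m + 3)"
  by (simp add: fr_def vars_closed)

lemma vars_q2 [simp]: "i < m - 1 \<Longrightarrow> vars (q2 i) \<subseteq> VS (m + 3)"
proof -
  assume i: "i < m - 1"
  have "q2 i = pconst b * (w * fr i) - pconst a * (w * fr (Suc i))" by (simp add: q2_def)
  then show ?thesis using i by (simp add: vars_closed)
qed

lemma w_form_E:
  assumes "degree P < m"
  shows "w * form (E * P) = - (\<Sum>j<m. pconst (poly.coeff P j) * fr j)"
  unfolding E_def form_linear_mult[OF assms]
  by (simp add: fr_def low_def high_def sum_distrib_left sum.distrib sum_negf sum_subtractf pconst_simps algebra_simps)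

lemma ww_form_EE:
  assumes P: "degree P < m - 1"
  shows "w * w * form (E * (E * P)) = (\<Sum>j<m - 1. pconst (poly.coeff P j) * q2 j)"
proof -
  obtain k where m: "m = Suc k" using m2 by (cases m) auto
  have c: "poly.coeff P k = 0" using P by (simp add: m coeff_eq_0)
  have EP: "E * P = Polynomial.smult (- b) P + pCons 0 (Polynomial.smult a P)" by (simp add: E_def)
  have "degree (E * P) \<le> degree E + degree P" by (rule degree_mult_le)
  then have "degree (E * P) < m" using P by (auto simp: E_def split: if_splits)
  then have "w * form (E * (E * P)) = - (\<Sum>j<Suc k. pconst (poly.coeff (E * P) j) * fr j)"
    using w_form_E by (simp add: m)
  also have "\<dots> = - ((\<Sum>j<Suc k. pconst (- b * poly.coeff P j) * fr j)
      + (\<Sum>j<Suc k. pconst (poly.coeff (pCons 0 (Polynomial.smult a P)) j) * fr j))"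
    unfolding EP by (simp only: coeff_add coeff_smult pconst_simps(1) distrib_right sum.distrib)
  also have "(\<Sum>j<Suc k. pconst (- b * poly.coeff P j) * fr j) = (\<Sum>j<k. pconst (- b * poly.coeff P j) * fr j)"
    using c by (simp add: pconst_simps)
  also have "(\<Sum>j<Suc k. pconst (poly.coeff (pCons 0 (Polynomial.smult a P)) j) * fr j)
      = (\<Sum>j<k. pconst (a * poly.coeff P j) * fr (Suc j))"
    unfolding sum.lessThan_Suc_shift by (simp add: pconst_simps)
  finally have "w * (w * form (E * (E * P))) = w * - ((\<Sum>j<k. pconst (- b * poly.coeff P j) * fr j)
      + (\<Sum>j<k. pconst (a * poly.coeff P j) * fr (Suc j)))" by simp
  also have "\<dots> = (\<Sum>j<k. pconst (poly.coeff P j) * q2 j)"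
    by (simp add: q2_def sum_distrib_left sum.distrib sum_negf sum_subtractf pconst_simps algebra_simps)
  finally show ?thesis by (simp add: m mult.assoc)
qed

lemma q2_eq:
  assumes "i < m - 1"
  shows "q2 i = w * w * form (E * (E * monom 1 i))"
proof -
  have "(\<Sum>j<m - 1. pconst (poly.coeff (monom 1 i) j) * q2 j) = (\<Sum>j<m - 1. if j = i then q2 i else 0)"
    by (rule sum.cong) (auto simp: pconst_simps)
  then show ?thesis using assms ww_form_EE[of "monom 1 i"] by (simp add: degree_monom_eq)
qed

lemma T_E: "1 \<le> i \<Longrightarrow> i \<le> m \<Longrightarrow> \<exists>P. degree P < m \<and> T i = form (E * P)"
  using T_Suc_eq[of "i - 1"] degree_EH[of "i - 1" "m - 1 - (i - 1)"]
  by (intro exI[of _ "E ^ (i - 1) * H ^ (m - 1 - (i - 1))"]) auto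

lemma T_EE: "2 \<le> i \<Longrightarrow> i \<le> m \<Longrightarrow> \<exists>P. degree P < m - 1 \<and> T i = form (E * (E * P))"
proof -
  assume i: "2 \<le> i" "i \<le> m"
  then obtain k where k: "i = Suc (Suc k)" by (metis add_2_eq_Suc le_Suc_ex)
  show ?thesis using degree_EH[of k "m - i"] i
    by (intro exI[of _ "E ^ k * H ^ (m - i)"]) (auto simp: T_def k mult.assoc)
qed

text \<open>Modulo \<open>J\<close> the generator \<open>z w\<^sub>0\<close> of \<open>K\<close> may be replaced by \<open>g w\<close>.\<close>

lemma zw_eqv: "w * g \<approx> pz * (- pw 0)"
  unfolding eqv_iff evalp_mult Psi_gens tmon_mult expo_add by (simp add: vars_closed)

lemma ideal_eqv: "ideal A S \<Longrightarrow> J \<subseteq> A \<Longrightarrow> p \<approx> q \<Longrightarrow> q \<in> A \<Longrightarrow> p \<in> A"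
  using poly_ideal_closed(2)[of A "VS (m + 3)" "p - q" q] by (auto simp: eqv_def)

lemma w_form_E_mem:
  assumes "ideal A S" "\<And>i. i < m \<Longrightarrow> fr i \<in> A" "degree P < m"
  shows "w * form (E * P) \<in> A"
  unfolding w_form_E[OF assms(3)]
  by (intro poly_ideal_closed(4,6)[OF assms(1)] poly_ideal_sum[OF assms(1)]) (simp_all add: assms(2))

text \<open>If the four coordinates divide \<open>\<mu>\<close>, then its lift has a factor \<open>w\<close>, and the greedy normal
  form begins with \<open>g\<close> or with some \<open>T i\<close>, \<open>i \<ge> 1\<close>. Both \<open>w g\<close> and \<open>w (T i)\<close> come from generators.\<close>

lemma lift_mem_1:
  assumes A: "ideal A S" "J \<subseteq> A" "\<And>i. i < m \<Longrightarrow> fr i \<in> A" "pz * pw 0 \<in> A"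
    and \<mu>: "\<mu> \<in> Mon" "\<forall>i\<in>{3,4,6,7}. 1 \<le> lookup \<mu> i"
  shows "lift \<mu> \<in> A"
proof -
  note cl = poly_ideal_closed[OF A(1)]
  have g: "w * g \<in> A"
    by (rule ideal_eqv[OF A(1,2) zw_eqv]) (use cl(6)[OF A(4)] in simp)
  have T: "w * T i \<in> A" if "1 \<le> i" "i \<le> m" for i
    using T_E[OF that] w_form_E_mem[OF A(1,3)] by auto
  have N: "w * N l r p \<in> A" if "1 \<le> p" "p \<le> l + m * r" for l r p
  proof (cases l)
    case 0
    with that obtain r' where r: "r = Suc r'" by (cases r) auto
    have "w * T (min p m) * N 0 r' (p - m) \<in> A" by (rule cl(5)[OF vars_N T]) (use that m2 in auto)
    then show ?thesis by (simp add: 0 r mult.assoc)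
  next
    case (Suc l')
    have "w * g * N l' r (p - 1) \<in> A" by (rule cl(5)[OF vars_N g])
    then show ?thesis using that by (simp add: Suc mult.assoc)
  qed
  obtain k where k: "min (lookup \<mu> 6) (lookup \<mu> 7) = Suc k" using \<mu>(2) by (cases "min (lookup \<mu> 6) (lookup \<mu> 7)") auto
  have "zpart \<mu> * w ^ k * (w * N (min (lookup \<mu> 0) (lookup \<mu> 1)) (lookup \<mu> 2) (min (lookup \<mu> 3) (lookup \<mu> 4))) \<in> A"
    by (intro cl(4) N vars_closed(2)) (use \<mu> N_bound[OF \<mu>(1)] in simp_all)
  then show ?thesis by (simp add: lift_def k mult_ac)
qed

text \<open>If the four coordinates divide \<open>\<mu>\<close> twice, the lift has a factor \<open>w\<^sup>2\<close>, and the greedy normal form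
  begins with \<open>g\<^sup>2\<close>, with \<open>g (T i)\<close>, \<open>i \<ge> 1\<close>, or with \<open>T i\<close>, \<open>i \<ge> 2\<close>. The last case uses that
  \<open>T i\<close> is then divisible by \<open>E\<^sup>2\<close>, and \<open>g (T 1) = h (T 2)\<close> reduces the middle case to it; here
  \<open>m \<ge> 2\<close> is needed.\<close>

lemma lift_mem_2:
  assumes A: "ideal A S" "J \<subseteq> A" "\<And>i. i < m - 1 \<Longrightarrow> q2 i \<in> A" "pz ^ 2 * pw 0 ^ 2 \<in> A"
    and \<mu>: "\<mu> \<in> Mon" "\<forall>i\<in>{3,4,6,7}. 2 \<le> lookup \<mu> i"
  shows "lift \<mu> \<in> A"
proof -
  note cl = poly_ideal_closed[OF A(1)]
  have "(w * g) * (w * g) \<approx> (pz * (- pw 0)) * (pz * (- pw 0))"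
    using zw_eqv by (auto simp: eqv_iff vars_closed del: subsetI)
  then have g: "(w * g) * (w * g) \<in> A"
    by (rule ideal_eqv[OF A(1,2)]) (use A(4) in \<open>simp add: power2_eq_square mult_ac\<close>)
  have T: "w * w * T i \<in> A" if i: "2 \<le> i" "i \<le> m" for i
  proof -
    obtain P where P: "degree P < m - 1" "T i = form (E * (E * P))" using T_EE[OF i] by auto
    show ?thesis unfolding P(2) ww_form_EE[OF P(1)]
      by (intro poly_ideal_sum[OF A(1)] cl(4)) (simp_all add: A(3))
  qed
  have gT: "w * w * (g * T i) \<in> A" if i: "1 \<le> i" "i \<le> m" for i
  proof (cases "i = 1")
    case True
    have "w * w * (g * T 1) \<approx> w * w * (h * T (Suc 1))"
      using m2 by (intro eqv_mult eqv_gT) (simp_all add: vars_closed)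
    moreover have "h * (w * w * T 2) \<in> A" by (intro cl(4) T) (use m2 in simp_all)
    ultimately show ?thesis using ideal_eqv[OF A(1,2)] True by (simp add: mult_ac numeral_2_eq_2)
  next
    case False
    have "g * (w * w * T i) \<in> A" by (intro cl(4) T) (use i False in simp_all)
    then show ?thesis by (simp add: mult_ac)
  qed
  have N: "w * w * N l r p \<in> A" if p: "2 \<le> p" "p \<le> l + m * r" for l r p
  proof -
    consider "l = 0" | "l = 1" | k where "l = Suc (Suc k)" by (metis One_nat_def not0_implies_Suc)
    then show ?thesis
    proof cases
      case 1
      with that obtain r' where r: "r = Suc r'" by (cases r) auto
      have "w * w * T (min p m) * N 0 r' (p - m) \<in> A" by (rule cl(5)[OF vars_N T]) (use that m2 in auto)
      then show ?thesis by (simp add: 1 r mult.assoc)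
    next
      case 2
      with that obtain r' where r: "r = Suc r'" by (cases r) auto
      have "w * w * (g * T (min (p - 1) m)) * N 0 r' (p - 1 - m) \<in> A"
        by (rule cl(5)[OF vars_N gT]) (use that m2 in auto)
      then show ?thesis using p by (simp add: 2 r mult.assoc)
    next
      case (3 k)
      have "(w * g) * (w * g) * N k r (p - 2) \<in> A" by (rule cl(5)[OF vars_N g])
      moreover have "p - 1 \<noteq> 0" "p - Suc (Suc 0) = p - 2" using p by auto
      ultimately show ?thesis using p by (simp add: 3 mult_ac)
    qed
  qed
  obtain k where k: "min (lookup \<mu> 6) (lookup \<mu> 7) = Suc (Suc k)"
    using \<mu>(2) le_Suc_ex[of 2 "min (lookup \<mu> 6) (lookup \<mu> 7)"] by auto
  have "zpart \<mu> * w ^ k * (w * w * N (min (lookup \<mu> 0) (lookup \<mu> 1)) (lookup \<mu> 2) (min (lookup \<mu> 3) (lookup \<mu> 4))) \<in> A"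
    by (intro cl(4) N vars_closed(2)) (use \<mu> N_bound[OF \<mu>(1)] in simp_all)
  then show ?thesis by (simp add: lift_def k mult_ac)
qed

lemma fr_in_V1: "i < m \<Longrightarrow> fr i \<in> V 1"
proof -
  assume i: "i < m"
  obtain k where m: "m = Suc k" using m2 by (cases m) auto
  have "(\<Sum>j<m. pconst (poly.coeff (monom 1 i) j) * fr j) = (\<Sum>j<m. if j = i then fr i else 0)"
    by (rule sum.cong) (auto simp: pconst_simps)
  then have "fr i = - (w * form (E * monom 1 i))"
    using w_form_E[of "monom 1 i"] i by (simp add: degree_monom_eq)
  moreover have "homog m (E * monom 1 i) = eps * homog k (monom 1 i)"
    using homog_linear_mult[of "monom 1 i" k "- b" a] i eps_eq
    by (simp add: m E_def degree_monom_eq const_simps)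
  ultimately have "\<Psi> (fr i) = - (tmon (expo 0 0 1 1 1 0 1 1) * homog k (monom 1 i))"
    by (simp add: Psi_form Psi_gens rho_def eps_def tmon_mult expo_add flip: mult.assoc)
  then show ?thesis using i by (simp add: V_def val_ge_tmon_mult)
qed

lemma zw_in_V1: "pz * pw 0 \<in> V 1"
proof -
  have "\<Psi> (pz * pw 0) = - tmon (expo 1 1 0 1 1 0 1 1)"
    by (simp add: coord_def w0m_def tmon_mult expo_add)
  then show ?thesis by (simp add: V_def vars_closed del: evalp_mult) (simp add: val_ge_def tmon_def)
qed

lemma J_subset_V: "J \<subseteq> V k"
  by (auto simp: V_def J_eq_kernel simp del: evalp_mult)

section \<open>The quotient ring B\<close>

abbreviation B :: "'k mpoly set ring" where "B \<equiv> S Quot J"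
abbreviation cls :: "'k mpoly \<Rightarrow> 'k mpoly set" where "cls p \<equiv> J +>\<^bsub>S\<^esub> p"

lemma cring_B: "cring B"
  by (rule ideal.quotient_is_cring[OF ideal_J cring_poly_ring])

lemma cls_hom: "cls \<in> Ring.ring_hom S B"
  by (rule ideal.rcos_ring_hom[OF ideal_J])

lemma cls_closed: "vars p \<subseteq> VS (m + 3) \<Longrightarrow> cls p \<in> carrier B"
  using ring_hom_closed[OF cls_hom, of p] by simp

lemma cls_add: "vars p \<subseteq> VS (m + 3) \<Longrightarrow> vars q \<subseteq> VS (m + 3) \<Longrightarrow> cls p \<oplus>\<^bsub>B\<^esub> cls q = cls (p + q)"
  using ring_hom_add[OF cls_hom, of p q] by simp

lemma cls_mult: "vars p \<subseteq> VS (m + 3) \<Longrightarrow> vars q \<subseteq> VS (m + 3) \<Longrightarrow> cls p \<otimes>\<^bsub>B\<^esub> cls q = cls (p * q)"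
  using ring_hom_mult[OF cls_hom, of p q] by simp

lemma cls_eq_iff: "vars p \<subseteq> VS (m + 3) \<Longrightarrow> vars q \<subseteq> VS (m + 3) \<Longrightarrow> cls p = cls q \<longleftrightarrow> \<Psi> p = \<Psi> q"
  using ring.quotient_eq_iff_same_a_r_cos[OF cring.axioms(1)[OF cring_poly_ring] ideal_J, of p q]
    eqv_iff[of p q] by (simp add: poly_ring_minus eqv_def)

lemma B_carrierE:
  assumes "X \<in> carrier B"
  obtains p where "vars p \<subseteq> VS (m + 3)" "X = cls p"
  using assms unfolding FactRing_def by (auto simp: A_RCOSETS_def' A_RCOSETS_def RCOSETS_def a_r_coset_def)

lemma ideal_pullback:
  assumes "ideal A B"
  shows "ideal {p. vars p \<subseteq> VS (m + 3) \<and> cls p \<in> A} S" "J \<subseteq> {p. vars p \<subseteq> VS (m + 3) \<and> cls p \<in> A}"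
proof -
  interpret A: ideal A B by fact
  have 0: "cls 0 = \<zero>\<^bsub>B\<^esub>"
    using ring_hom_zero[OF cls_hom cring.axioms(1)[OF cring_poly_ring] cring.axioms(1)[OF cring_B]] by simp
  show "ideal {p. vars p \<subseteq> VS (m + 3) \<and> cls p \<in> A} S"
    unfolding ideal_poly_ring_iff
    using A.additive_subgroup_axioms[THEN additive_subgroup.zero_closed]
      A.additive_subgroup_axioms[THEN additive_subgroup.a_closed] A.I_l_closed
    by (intro conjI subsetI) (auto simp: 0 vars_closed cls_closed simp flip: cls_add cls_mult del: subsetI)
  have "cls p \<in> A" if "p \<in> J" for p
    using that A.additive_subgroup_axioms[THEN additive_subgroup.zero_closed] 0 cls_eq_iff[of p 0] J_eq_kernel
    by simp
  then show "J \<subseteq> {p. vars p \<subseteq> VS (m + 3) \<and> cls p \<in> A}" using J_closed(3) by auto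
qed

definition N3 :: "'k mpoly set set"
  where "N3 = genideal B {cls (pz ^ 2 * pw 0 ^ 2)} <+>\<^bsub>B\<^esub> genideal B {cls (q2 i) | i. i < m - 1}"

lemma vars_zw [simp]: "vars (pz * pw 0 :: 'k mpoly) \<subseteq> VS (m + 3)" "vars (pz ^ 2 * pw 0 ^ 2 :: 'k mpoly) \<subseteq> VS (m + 3)"
  by (simp_all add: vars_closed)

lemma N3_gens_carrier: "{cls (pz ^ 2 * pw 0 ^ 2)} \<subseteq> carrier B" "{cls (q2 i) | i. i < m - 1} \<subseteq> carrier B"
  using cls_closed vars_zw(2) vars_q2 by blast+

lemma ideal_N3: "ideal N3 B" and N3_gens: "cls (pz ^ 2 * pw 0 ^ 2) \<in> N3" "i < m - 1 \<Longrightarrow> cls (q2 i) \<in> N3"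
proof -
  interpret B: cring B by (rule cring_B)
  show i: "ideal N3 B" unfolding N3_def
    by (rule B.add_ideals[OF B.genideal_ideal B.genideal_ideal]) (rule N3_gens_carrier)+
  show "cls (pz ^ 2 * pw 0 ^ 2) \<in> N3" "i < m - 1 \<Longrightarrow> cls (q2 i) \<in> N3"
    using B.ideal_sum_subset_iff[OF B.genideal_ideal[OF N3_gens_carrier(1)] B.genideal_ideal[OF N3_gens_carrier(2)] i]
      B.genideal_subset_iff[OF N3_gens_carrier(1) i] B.genideal_subset_iff[OF N3_gens_carrier(2) i]
    unfolding N3_def by auto
qed

lemma N3_subset: "ideal A B \<Longrightarrow> cls (pz ^ 2 * pw 0 ^ 2) \<in> A \<Longrightarrow> (\<And>i. i < m - 1 \<Longrightarrow> cls (q2 i) \<in> A) \<Longrightarrow> N3 \<subseteq> A"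
proof -
  interpret B: cring B by (rule cring_B)
  assume A: "ideal A B" and "cls (pz ^ 2 * pw 0 ^ 2) \<in> A" "\<And>i. i < m - 1 \<Longrightarrow> cls (q2 i) \<in> A"
  then have "{cls (pz ^ 2 * pw 0 ^ 2)} \<subseteq> A" "{cls (q2 i) | i. i < m - 1} \<subseteq> A" by auto
  then show ?thesis unfolding N3_def
    using B.ideal_sum_subset_iff[OF B.genideal_ideal[OF N3_gens_carrier(1)] B.genideal_ideal[OF N3_gens_carrier(2)] A]
      B.genideal_subset_iff[OF N3_gens_carrier(1) A] B.genideal_subset_iff[OF N3_gens_carrier(2) A]
    by simp
qed

lemma V2_N3: "p \<in> V 2 \<Longrightarrow> cls p \<in> N3"
proof -
  let ?A = "{p. vars p \<subseteq> VS (m + 3) \<and> cls p \<in> N3}"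
  assume p: "p \<in> V 2"
  have "p \<in> ?A"
    by (rule V_subset_ideal[OF ideal_pullback[OF ideal_N3] lift_mem_2[OF ideal_pullback[OF ideal_N3]] p])
       (use N3_gens in simp_all)
  then show ?thesis by simp
qed

section \<open>The symbolic square\<close>

text \<open>Write \<open>V k\<close> for divisibility by \<open>(\<epsilon>\<^sub>1 \<epsilon>\<^sub>2 \<omega>\<^sub>1 \<omega>\<^sub>2)\<^sup>k\<close>. Then \<open>K\<close> is the image of \<open>V 1\<close>, hence for each of
  the four coordinates the elements divisible by it form an associated prime of \<open>K\<close>. An element of
  the symbolic square is multiplied into the image of \<open>V 2\<close> by elements outside these four primes,
  so it lies in the image of \<open>V 2\<close>, that is, in \<open>N\<^sub>3\<close>. For the converse, \<open>h = \<lambda> \<eta>\<close> involves none of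
  the four coordinates and so lies in no associated prime at all, while \<open>h\<close> multiplies \<open>N\<^sub>3\<close> into the
  square of \<open>K\<close>.\<close>

lemma symbolic_square_eq_N3:
  assumes K: "ideal K S" "\<And>i. i < m \<Longrightarrow> fr i \<in> K" "pz * pw 0 \<in> K" "K \<subseteq> V 1"
  shows "symbolic_square B (cls ` K) = N3"
proof -
  interpret B: cring B by (rule cring_B)
  let ?K = "cls ` K"
  let ?KK = "ideal_prod B ?K ?K"
  have iK: "ideal ?K B"
    by (rule ring.ring_ideal_imp_quot_ideal[OF cring.axioms(1)[OF cring_poly_ring] ideal_J K(1)])
  have iKK: "ideal ?KK B" by (rule B.ideal_prod_is_ideal[OF iK iK])
  have mem_K: "cls p \<in> ?K \<longleftrightarrow> p \<in> V 1" if p: "vars p \<subseteq> VS (m + 3)" for p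
  proof
    assume "cls p \<in> ?K"
    then obtain k where k: "k \<in> K" "cls p = cls k" by auto
    have "vars k \<subseteq> VS (m + 3)" using poly_ideal_closed(3)[OF K(1) k(1)] .
    then have "\<Psi> p = \<Psi> k" using p k cls_eq_iff by blast
    then show "p \<in> V 1" using k K(4) p by (auto simp: V_def)
  next
    let ?A = "{p. vars p \<subseteq> VS (m + 3) \<and> cls p \<in> ?K}"
    assume pV: "p \<in> V 1"
    have "p \<in> ?A"
      by (rule V_subset_ideal[OF ideal_pullback[OF iK] lift_mem_1[OF ideal_pullback[OF iK]] pV])
         (use K in simp_all)
    then show "cls p \<in> ?K" by simp
  qed
  have KK: "X \<in> ?KK \<Longrightarrow> \<exists>p\<in>V 2. X = cls p" for X
  proof (induction rule: ideal_prod.induct)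
    case (prod X Y)
    then obtain p q where pq: "p \<in> K" "q \<in> K" "X = cls p" "Y = cls q" by auto
    then have "p * q \<in> V (1 + 1)" using K(4) by (intro V_mult) auto
    moreover have "X \<otimes>\<^bsub>B\<^esub> Y = cls (p * q)" using pq poly_ideal_closed(3)[OF K(1)] cls_mult by simp
    ultimately show ?case by (auto simp: numeral_2_eq_2)
  next
    case (sum X Y)
    then obtain p q where pq: "p \<in> V 2" "q \<in> V 2" "X = cls p" "Y = cls q" by auto
    then have "X \<oplus>\<^bsub>B\<^esub> Y = cls (p + q)" using poly_ideal_closed(3)[OF ideal_V] cls_add by simp
    then show ?case using poly_ideal_closed(2)[OF ideal_V pq(1,2)] by auto
  qed
  have Ass: "\<exists>P\<in>Ass_quot B ?K. \<forall>u. vars u \<subseteq> VS (m + 3) \<longrightarrow> (cls u \<in> P \<longleftrightarrow> val_ge i 1 (\<Psi> u))"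
    if i: "i \<in> {3,4,6,7}" for i
  proof -
    \<comment> \<open>The elements divisible by coordinate i are those that multiply e into K, where e is a monomial divisible by exactly the other three.\<close>
    define ec where "ec = (if i = 3 then (- pw 0 * w, expo 0 1 0 0 1 0 1 2)
      else if i = 4 then (pz * w, expo 1 0 0 1 0 0 2 1)
      else if i = 6 then (- pw 0 * g, expo 1 2 0 1 2 0 0 1) else (pz * g, expo 2 1 0 2 1 0 1 0))"
    obtain e \<kappa> where e: "ec = (e, \<kappa>)" by (cases ec)
    have vars_e: "vars e \<subseteq> VS (m + 3)"
      using e i by (auto simp: ec_def vars_closed simp del: mult_minus_left split: if_splits del: subsetI)
    have Psi_e: "\<Psi> e = tmon \<kappa>"
      using e i by (auto simp: ec_def Psi_gens tmon_mult expo_add evalp_mult numeral_2_eq_2 simp del: mult_minus_left evalp_pvar evalp_uminus split: if_splits)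
    have \<kappa>: "lookup \<kappa> i = 0" "\<And>j. j \<in> {3,4,6,7} \<Longrightarrow> j \<noteq> i \<Longrightarrow> 1 \<le> lookup \<kappa> j"
      using e i by (auto simp: ec_def split: if_splits)
    define P where "P = {X \<in> carrier B. cls e \<otimes>\<^bsub>B\<^esub> X \<in> ?K}"
    have mem_P: "cls u \<in> P \<longleftrightarrow> val_ge i 1 (\<Psi> u)" if u: "vars u \<subseteq> VS (m + 3)" for u
    proof -
      have "cls u \<in> P \<longleftrightarrow> e * u \<in> V 1"
        using u vars_e by (simp add: P_def cls_closed cls_mult mem_K vars_closed)
      also have "\<dots> \<longleftrightarrow> (\<forall>j\<in>{3,4,6,7}. \<forall>\<mu>\<in>keys (\<Psi> u). 1 \<le> lookup \<kappa> j + lookup \<mu> j)"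
        using u vars_e by (simp add: V_def Psi_e val_ge_tmon_mult vars_closed)
      also have "\<dots> \<longleftrightarrow> (\<forall>\<mu>\<in>keys (\<Psi> u). 1 \<le> lookup \<mu> i)"
        using \<kappa> i by (metis add_0 trans_le_add1)
      finally show ?thesis by (simp add: val_ge_def)
    qed
    have "primeideal P B"
    proof (rule primeidealI)
      show "ideal P B" unfolding P_def by (rule B.ideal_mult_preimage[OF iK cls_closed[OF vars_e]])
      have "\<not> val_ge i 1 (\<Psi> 1)" by (simp add: val_ge_def)
      then show "carrier B \<noteq> P" using mem_P[of 1] cls_closed[of 1] by auto
      fix X Y assume "X \<in> carrier B" "Y \<in> carrier B" and XY: "X \<otimes>\<^bsub>B\<^esub> Y \<in> P"
      then obtain p q where pq: "vars p \<subseteq> VS (m + 3)" "X = cls p" "vars q \<subseteq> VS (m + 3)" "Y = cls q"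
        by (metis B_carrierE)
      then have "val_ge i 1 (\<Psi> p * \<Psi> q)" using XY mem_P[of "p * q"] by (simp add: cls_mult vars_closed)
      then show "X \<in> P \<or> Y \<in> P" using pq mem_P val_ge_cancel by blast
    qed (rule cring_B)
    moreover have "P = {X \<in> carrier B. X \<otimes>\<^bsub>B\<^esub> cls e \<in> ?K}"
      unfolding P_def using cls_closed[OF vars_e] by (auto simp: B.m_comm)
    ultimately have "P \<in> Ass_quot B ?K" unfolding Ass_quot_def using cls_closed[OF vars_e] by blast
    then show ?thesis using mem_P by blast
  qed
  have "symbolic_square B ?K \<subseteq> N3"
  proof
    fix X assume X: "X \<in> symbolic_square B ?K"
    then have "X \<in> carrier B" by (simp add: symbolic_square_def)
    then obtain p where p: "vars p \<subseteq> VS (m + 3)" "X = cls p" by (rule B_carrierE)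
    have "val_ge i 2 (\<Psi> p)" if i: "i \<in> {3,4,6,7}" for i
    proof -
      obtain P where P: "P \<in> Ass_quot B ?K" "\<And>u. vars u \<subseteq> VS (m + 3) \<Longrightarrow> cls u \<in> P \<longleftrightarrow> val_ge i 1 (\<Psi> u)"
        using Ass[OF i] by blast
      then obtain U where U: "U \<in> carrier B" "U \<notin> P" "U \<otimes>\<^bsub>B\<^esub> X \<in> ?KK"
        using X unfolding symbolic_square_eq[OF cring_B iK] by blast
      then obtain u where u: "vars u \<subseteq> VS (m + 3)" "U = cls u" by (metis B_carrierE)
      obtain q where q: "q \<in> V 2" "cls (u * p) = cls q" using KK[OF U(3)] u p by (auto simp: cls_mult)
      have "\<Psi> (u * p) = \<Psi> q"
        using q poly_ideal_closed(3)[OF ideal_V q(1)] u p cls_eq_iff[of "u * p" q] vars_closed(2) by blast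
      then have "val_ge i 2 (\<Psi> u * \<Psi> p)" using q i by (auto simp: V_def)
      moreover have "\<not> val_ge i 1 (\<Psi> u)" using P(2) u U(2) by blast
      ultimately show ?thesis by (rule val_ge_cancel)
    qed
    then show "X \<in> N3" using p V2_N3 by (simp add: V_def)
  qed
  moreover have "N3 \<subseteq> symbolic_square B ?K"
  proof
    fix X assume X: "X \<in> N3"
    have Xc: "X \<in> carrier B" using X ideal.Icarr[OF ideal_N3] by blast
    \<comment> \<open>h does not change any of the four orders, so it cannot be a zero divisor modulo K.\<close>
    have h: "cls h \<notin> P" if P: "P \<in> Ass_quot B ?K" for P
    proof
      assume hP: "cls h \<in> P"
      obtain C where C: "C \<in> carrier B" "P = {r \<in> carrier B. r \<otimes>\<^bsub>B\<^esub> C \<in> ?K}" and prime: "primeideal P B"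
        using P by (auto simp: Ass_quot_def)
      obtain p where p: "vars p \<subseteq> VS (m + 3)" "C = cls p" using C(1) by (rule B_carrierE)
      have "cls (h * p) \<in> ?K" using hP p C by (simp add: cls_mult)
      then have "h * p \<in> V 1" using mem_K[of "h * p"] p by (simp add: vars_closed)
      then have "p \<in> V 1" using p by (simp add: V_def Psi_gens val_ge_tmon_mult) (simp add: val_ge_def)
      then have "C \<in> ?K" using mem_K p by blast
      then have "\<one>\<^bsub>B\<^esub> \<in> P" using C by simp
      then show False using primeideal.I_notcarr[OF prime] ideal.one_imp_carrier[OF primeideal.axioms(1)[OF prime]] by auto
    qed
    have "N3 \<subseteq> {X \<in> carrier B. cls h \<otimes>\<^bsub>B\<^esub> X \<in> ?KK}"
    proof (rule N3_subset)
      show "ideal {X \<in> carrier B. cls h \<otimes>\<^bsub>B\<^esub> X \<in> ?KK} B"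
        by (rule B.ideal_mult_preimage[OF iKK cls_closed]) simp
      have "cls (pz * pw 0) \<otimes>\<^bsub>B\<^esub> cls (pz * pw 0) \<in> ?KK"
        using K(3) by (intro ideal_prod.prod) auto
      then have "cls (pz ^ 2 * pw 0 ^ 2) \<in> ?KK"
        by (simp add: cls_mult power2_eq_square mult_ac)
      then show "cls (pz ^ 2 * pw 0 ^ 2) \<in> {X \<in> carrier B. cls h \<otimes>\<^bsub>B\<^esub> X \<in> ?KK}"
        using ideal.I_l_closed[OF iKK] by (simp add: cls_closed)
    next
      fix i assume i: "i < m - 1"
      let ?P = "monom (1::'k) i"
      have d: "degree (E * ?P) < m" "degree (H * ?P) < m"
        using i degree_mult_le[of E ?P] degree_mult_le[of H ?P]
        by (auto simp: degree_monom_eq E_def H_def split: if_splits)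
      \<comment> \<open>Trading h E for g H splits h w^2 E^2 into the two factors w g and w E H, both in K.\<close>
      have "h * q2 i = w * w * (h * form (E * (E * ?P)))" by (simp add: q2_eq[OF i] mult_ac)
      also have "\<dots> \<approx> w * w * (g * form (H * (E * ?P)))"
      proof (rule eqv_mult)
        show "h * form (E * (E * ?P)) \<approx> g * form (H * (E * ?P))"
          by (rule eqv_sym) (use rel_gh[OF d(1)] in \<open>simp add: eqv_def vars_closed\<close>)
      qed (simp add: vars_closed)
      also have "\<dots> = (w * g) * (w * form (E * (H * ?P)))" by (simp add: mult_ac)
      finally have e: "h * q2 i \<approx> (w * g) * (w * form (E * (H * ?P)))" .
      have "cls (w * g) \<in> ?K"
        using mem_K[of "w * g"] by (simp add: V_def Psi_gens tmon_mult expo_add vars_closed)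
           (simp add: tmon_def val_ge_def expo_add)
      moreover have "cls (w * form (E * (H * ?P))) \<in> ?K"
        using w_form_E_mem[OF K(1,2) d(2)] by blast
      ultimately have "cls (w * g) \<otimes>\<^bsub>B\<^esub> cls (w * form (E * (H * ?P))) \<in> ?KK"
        by (rule ideal_prod.prod)
      then have "cls (h * q2 i) \<in> ?KK"
        using e cls_eq_iff[of "h * q2 i" "(w * g) * (w * form (E * (H * ?P)))"]
        by (simp add: cls_mult vars_closed eqv_iff)
      then show "cls (q2 i) \<in> {X \<in> carrier B. cls h \<otimes>\<^bsub>B\<^esub> X \<in> ?KK}"
        using i by (simp add: cls_closed cls_mult)
    qed
    then have "cls h \<otimes>\<^bsub>B\<^esub> X \<in> ?KK" using X by auto
    then show "X \<in> symbolic_square B ?K"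
      unfolding symbolic_square_eq[OF cring_B iK] using h Xc cls_closed[of h] by auto
  qed
  ultimately show ?thesis by blast
qed

end

section \<open>Two-by-two minors\<close>

lemma det_two:
  fixes A :: "'a::comm_ring_1 mat"
  assumes A: "A \<in> carrier_mat 2 2"
  shows "det A = A $$ (0, 0) * A $$ (1, 1) - A $$ (0, 1) * A $$ (1, 0)"
proof -
  have d: "det (mat_delete A 0 j) = A $$ (1, 1 - j)" if "j < 2" for j
    by (subst det_single) (use A that in \<open>auto simp: mat_delete_def less_2_cases_iff\<close>)
  have "det A = (\<Sum>j<2. A $$ (0, j) * cofactor A 0 j)"
    by (rule laplace_expansion_row[OF A]) simp
  then show ?thesis by (simp add: cofactor_def d numeral_2_eq_2 lessThan_Suc)
qed

lemma pick_pair: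
  assumes "p < q"
  shows "pick {p, q} 0 = p" "pick {p, q} (Suc 0) = q"
proof -
  show p: "pick {p, q} 0 = p" using assms by (auto intro!: Least_equality)
  show "pick {p, q} (Suc 0) = q"
    unfolding pick.simps(2) p using assms by (auto intro!: Least_equality)
qed

lemma det_submatrix_pair:
  fixes M :: "'a::comm_ring_1 mat"
  assumes "p < q" "q < dim_row M" "r < s" "s < dim_col M"
  shows "det (submatrix M {p, q} {r, s}) = M $$ (p, r) * M $$ (q, s) - M $$ (p, s) * M $$ (q, r)"
proof -
  have "{i. i < dim_row M \<and> i \<in> {p, q}} = {p, q}" "{j. j < dim_col M \<and> j \<in> {r, s}} = {r, s}"
    using assms by auto
  then have c: "card {i. i < dim_row M \<and> i \<in> {p, q}} = 2" "card {j. j < dim_col M \<and> j \<in> {r, s}} = 2"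
    using assms by auto
  have "submatrix M {p, q} {r, s} \<in> carrier_mat 2 2"
    using dim_submatrix[of M "{p, q}" "{r, s}"] c by (metis carrier_matI)
  then show ?thesis
    using submatrix_index[of _ M "{p, q}" _ "{r, s}"] c pick_pair[OF assms(1)] pick_pair[OF assms(3)]
    by (simp add: det_two)
qed

lemma pair_setE:
  fixes J :: "nat set"
  assumes "J \<subseteq> {..<k}" "card J = 2"
  obtains r s where "J = {r, s}" "r < s" "s < k"
proof -
  obtain r s where rs: "J = {r, s}" "r \<noteq> s" using assms(2) by (meson card_2_iff)
  then show thesis using assms(1) that[of r s] that[of s r] by (cases "r < s") auto
qed

lemma minors_ideal_two:
  fixes M :: "'k::comm_ring_1 mpoly mat"
  shows "minors_ideal R 2 M = genideal R {M $$ (p, r) * M $$ (q, s) - M $$ (p, s) * M $$ (q, r) | p q r s.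
    p < q \<and> q < dim_row M \<and> r < s \<and> s < dim_col M}"
proof -
  have "{det (submatrix M I J) | I J. I \<subseteq> {..<dim_row M} \<and> J \<subseteq> {..<dim_col M} \<and> card I = 2 \<and> card J = 2}
    = {M $$ (p, r) * M $$ (q, s) - M $$ (p, s) * M $$ (q, r) | p q r s.
      p < q \<and> q < dim_row M \<and> r < s \<and> s < dim_col M}" (is "?l = ?r")
  proof
    show "?l \<subseteq> ?r"
    proof
      fix x assume "x \<in> ?l"
      then obtain I J where x: "x = det (submatrix M I J)" "I \<subseteq> {..<dim_row M}" "J \<subseteq> {..<dim_col M}"
        "card I = 2" "card J = 2" by blast
      obtain p q where pq: "I = {p, q}" "p < q" "q < dim_row M" using x(2,4) by (rule pair_setE)
      obtain r s where rs: "J = {r, s}" "r < s" "s < dim_col M" using x(3,5) by (rule pair_setE)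
      show "x \<in> ?r" using x(1) pq rs det_submatrix_pair by blast
    qed
    show "?r \<subseteq> ?l"
    proof
      fix x assume "x \<in> ?r"
      then obtain p q r s where x: "x = M $$ (p, r) * M $$ (q, s) - M $$ (p, s) * M $$ (q, r)"
        "p < q" "q < dim_row M" "r < s" "s < dim_col M" by blast
      then have "x = det (submatrix M {p, q} {r, s})" by (simp add: det_submatrix_pair)
      moreover have "{p, q} \<subseteq> {..<dim_row M}" "{r, s} \<subseteq> {..<dim_col M}" "card {p, q} = 2" "card {r, s} = 2"
        using x by auto
      ultimately show "x \<in> ?l" by blast
    qed
  qed
  then show ?thesis unfolding minors_ideal_def by simp
qed

section \<open>Reading off the matrix\<close>

lemma linear_form_xyE:
  assumes "linear_form_xy (p :: 'k::comm_ring_1 mpoly)"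
  obtains u v where "p = pconst u * px + pconst v * py"
proof -
  have "keys p \<subseteq> {Poly_Mapping.single Vx 1, Poly_Mapping.single Vy 1}"
  proof
    fix \<mu> assume \<mu>: "\<mu> \<in> keys p"
    have k: "keys \<mu> \<subseteq> {Vx, Vy}" using assms \<mu> by (auto simp: linear_form_xy_def vars_def)
    have "mdeg \<mu> = (\<Sum>v\<in>{Vx, Vy}. lookup \<mu> v)"
      unfolding mdeg_def by (rule sum.mono_neutral_left) (use k in \<open>auto simp: in_keys_iff\<close>)
    then have d: "lookup \<mu> Vx + lookup \<mu> Vy = 1"
      using assms \<mu> by (auto simp: linear_form_xy_def homogeneous_def)
    have z: "lookup \<mu> v = 0" if "v \<noteq> Vx" "v \<noteq> Vy" for v
      using k that by (auto simp: in_keys_iff)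
    show "\<mu> \<in> {Poly_Mapping.single Vx 1, Poly_Mapping.single Vy 1}"
    proof (cases "lookup \<mu> Vx = 0")
      case True
      have "lookup \<mu> v = lookup (Poly_Mapping.single Vy 1) v" for v
        by (cases v) (use True d z in \<open>simp_all add: lookup_single\<close>)
      then have "\<mu> = Poly_Mapping.single Vy 1" by (rule poly_mapping_eqI)
      then show ?thesis by simp
    next
      case False
      have "lookup \<mu> v = lookup (Poly_Mapping.single Vx 1) v" for v
        by (cases v) (use False d z in \<open>simp_all add: lookup_single\<close>)
      then have "\<mu> = Poly_Mapping.single Vx 1" by (rule poly_mapping_eqI)
      then show ?thesis by simp
    qed
  qed
  then have "\<exists>u v. p = pconst u * px + pconst v * py"
  proof (induction p rule: poly_mapping_induct_on)
    case zero
    then show ?case by (intro exI[of _ 0]) (simp add: pconst_simps)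
  next
    case (single \<mu> c)
    then consider "Poly_Mapping.single \<mu> c = pconst c * px + pconst 0 * py"
      | "Poly_Mapping.single \<mu> c = pconst 0 * px + pconst c * py"
      by (auto simp: pconst_simps) (auto simp: pconst_def pvar_def mult_single)
    then show ?case by cases blast+
  next
    case (add p q)
    then obtain u v u' v' where "p = pconst u * px + pconst v * py" "q = pconst u' * px + pconst v' * py" by blast
    then have "p + q = pconst (u + u') * px + pconst (v + v') * py" by (simp add: pconst_simps algebra_simps)
    then show ?case by blast
  qed
  then show thesis using that by blast
qed

lemma l_row_entry:
  fixes M :: "'k::comm_ring_1 mpoly mat"
  assumes "dim_row M = n" "j < dim_col M"
  shows "l_row n M $$ (0, j) = (\<Sum>i<n. pw i * M $$ (i, j))"
  using assms by (simp add: l_row_def scalar_prod_def lessThan_atLeast0)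

lemma phi'_entry:
  fixes a b :: "'k::comm_ring_1"
  assumes "phi' (m + 3) \<phi> = diag_block_mat [transpose_mat (Lblock m), mat 1 1 (\<lambda>_. pconst a * px + pconst b * py)]"
    and "i < m + 2" "j \<le> m"
  shows "\<phi> $$ (Suc i, j) = (if j = m then if i = Suc m then pconst a * px + pconst b * py else 0
    else if i = j then px else if i = Suc j then py else 0)"
proof -
  have "\<phi> $$ (Suc i, j) = phi' (m + 3) \<phi> $$ (i, j)" using assms(2,3) by (simp add: phi'_def)
  also have "\<dots> = (if j = m then if i = Suc m then pconst a * px + pconst b * py else 0
    else if i = j then px else if i = Suc j then py else 0)"
    unfolding assms(1) using assms(2,3) by (auto simp: Let_def Lblock_def)
  finally show ?thesis .
qed

text \<open>Setting one of \<open>x, y, z\<close> to 1 and the others to 0 isolates one coefficient; in the last case the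
  monomial factor \<open>w\<^sub>0\<close> is cancelled. This determines \<open>B(\<phi>'')\<close>.\<close>

lemma w_linear_comb_unique:
  fixes p q :: "nat \<Rightarrow> 'k::comm_ring_1 mpoly"
  assumes "\<And>i. vars (p i) \<subseteq> Vw ` {..<n}" "\<And>i. vars (q i) \<subseteq> Vw ` {..<n}"
    and e: "px * p 0 + py * p 1 + pz * pw 0 * p 2 = px * q 0 + py * q 1 + pz * pw 0 * q 2"
  shows "p 0 = q 0" "p 1 = q 1" "p 2 = q 2"
proof -
  have ev: "evalp \<rho> (p i) = p i" "evalp \<rho> (q i) = q i" if "\<And>i. \<rho> (Vw i) = pw i" for \<rho> i
    by (rule evalp_eq_self[OF assms(1)] evalp_eq_self[OF assms(2)]; use that in auto)+
  let ?\<rho> = "\<lambda>u v. case v of Vw i \<Rightarrow> pw i | _ \<Rightarrow> (if v = u then 1 else 0 :: 'k mpoly)"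
  have *: "evalp (?\<rho> u) (px * p 0 + py * p 1 + pz * pw 0 * p 2) = evalp (?\<rho> u) (px * q 0 + py * q 1 + pz * pw 0 * q 2)" for u
    using e by simp
  show "p 0 = q 0" using *[of Vx] by (simp add: ev)
  show "p 1 = q 1" using *[of Vy] by (simp add: ev)
  have "pw 0 * (p 2 - q 2) = 0" using *[of Vz] by (simp add: ev algebra_simps)
  then have "p 2 - q 2 = 0" unfolding pvar_def by (rule single_mult_eq_0D)
  then show "p 2 = q 2" by simp
qed

lemma min_gens_le: "finite A \<Longrightarrow> A \<subseteq> carrier R \<Longrightarrow> genideal R A = I \<Longrightarrow> min_gens R I \<le> enat (card A)"
  unfolding min_gens_def by (rule Inf_lower) blast

text \<open>Such a column is the syzygy \<open>v f\<^sub>0 = 0\<close>, so \<open>f\<^sub>0 = 0\<close> and the other \<open>n - 1\<close> entries of \<open>f\<close> already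
  generate the ideal.\<close>

lemma presentation_column_not_monomial:
  fixes f :: "'k::comm_ring_1 mpoly vec"
  assumes pres: "presentation_matrix (poly_ring V) f \<phi>" and f: "f \<in> carrier_vec n" "\<And>i. i < n \<Longrightarrow> vars (f $ i) \<subseteq> V"
    and j: "j < dim_col \<phi>" and col: "\<phi> $$ (0, j) = pvar v" "\<And>i. 0 < i \<Longrightarrow> i < n \<Longrightarrow> \<phi> $$ (i, j) = 0"
    and n: "0 < n" and mu: "min_gens (poly_ring V) (genideal (poly_ring V) {f $ i | i. i < n}) = enat n"
  shows False
proof -
  have dr: "dim_row \<phi> = n" using pres f by (simp add: presentation_matrix_def)
  let ?u = "unit_vec (dim_col \<phi>) j :: 'k mpoly vec"
  have "\<phi> *\<^sub>v ?u \<in> {\<phi> *\<^sub>v u | u. u \<in> carrier_vec (dim_col \<phi>) \<and> (\<forall>j < dim_col \<phi>. u $ j \<in> carrier (poly_ring V))}"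
  proof -
    have "?u \<in> carrier_vec (dim_col \<phi>)" by (rule unit_vec_carrier)
    moreover have "\<forall>i<dim_col \<phi>. ?u $ i \<in> carrier (poly_ring V)" using j by simp
    ultimately show ?thesis by blast
  qed
  then have "f \<bullet> (\<phi> *\<^sub>v ?u) = 0" using pres unfolding presentation_matrix_def by blast
  moreover have "f \<bullet> (\<phi> *\<^sub>v ?u) = f \<bullet> col \<phi> j"
  proof -
    have "\<phi> *\<^sub>v ?u = col \<phi> j" using j by (intro eq_vecI) (auto simp: scalar_prod_right_unit)
    then show ?thesis by simp
  qed
  moreover have "f \<bullet> col \<phi> j = (\<Sum>i<n. f $ i * \<phi> $$ (i, j))"
    using dr j by (simp add: scalar_prod_def lessThan_atLeast0)
  moreover have "(\<Sum>i<n. f $ i * \<phi> $$ (i, j)) = (\<Sum>i<n. if i = 0 then f $ 0 * pvar v else 0)"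
    by (rule sum.cong) (auto simp: col)
  ultimately have "pvar v * f $ 0 = 0" using n by (simp add: mult.commute)
  then have f0: "f $ 0 = 0" unfolding pvar_def by (rule single_mult_eq_0D)
  interpret R: cring "poly_ring V :: 'k mpoly ring" by (rule cring_poly_ring)
  let ?A = "{f $ i | i. 0 < i \<and> i < n}" and ?F = "{f $ i | i. i < n}"
  have sub: "?A \<subseteq> carrier (poly_ring V)" "?F \<subseteq> carrier (poly_ring V)" using f(2) by auto
  have iA: "ideal (genideal (poly_ring V) ?A) (poly_ring V)" by (rule R.genideal_ideal[OF sub(1)])
  have "?F \<subseteq> genideal (poly_ring V) ?A"
  proof
    fix x assume "x \<in> ?F"
    then obtain i where i: "x = f $ i" "i < n" by auto
    show "x \<in> genideal (poly_ring V) ?A"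
      using i f0 poly_ideal_closed(1)[OF iA] R.genideal_self[OF sub(1)] by (cases "i = 0") auto
  qed
  then have "genideal (poly_ring V) ?F \<subseteq> genideal (poly_ring V) ?A" by (rule R.genideal_minimal[OF iA])
  moreover have "?A \<subseteq> ?F" by blast
  then have "genideal (poly_ring V) ?A \<subseteq> genideal (poly_ring V) ?F"
    by (rule R.subset_Idl_subset[OF sub(2)])
  ultimately have eq: "genideal (poly_ring V) ?A = genideal (poly_ring V) ?F" by blast
  have A: "?A = (\<lambda>i. f $ i) ` {1..<n}" by (auto simp: Suc_le_eq)
  then have "card ?A \<le> n - 1" using card_image_le[of "{1..<n}" "\<lambda>i. f $ i"] by simp
  moreover have "enat n \<le> enat (card ?A)"
    using min_gens_le[OF _ sub(1) eq] mu A by simp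
  ultimately show False using n by simp
qed

section \<open>The theorem on the symbolic square\<close>

theorem theorem4p15:
  fixes I :: "'k::alg_closed_field mpoly set"
    and f :: "'k mpoly vec"
    and \<phi> Bm :: "'k mpoly mat"
    and n :: nat
    and a b :: 'k
  assumes n: "n > 4"
    and I_ideal: "ideal I Rxyz"
    and I_height: "ideal_height Rxyz I = 2"
    and I_perfect: "perfect_ideal Rxyz I"
    and f_dim: "f \<in> carrier_vec n"
    and f_homogeneous: "\<exists>d. \<forall>i < n. f $ i \<in> carrier Rxyz \<and> homogeneous d (f $ i)"
    and f_generates: "I = genideal Rxyz {f $ i | i. i < n}"
    and mu_I: "min_gens Rxyz I = enat n"
    and phi_dim: "\<phi> \<in> carrier_mat n (n - 1)"
    and phi_presents: "presentation_matrix Rxyz f \<phi>"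
    and phi_linear: "\<forall>i < n. \<forall>j < n - 2. homogeneous 1 (\<phi> $$ (i, j))"
    and phi_quadratic: "\<forall>i < n. homogeneous 2 (\<phi> $$ (i, n - 2))"
    and phi_I1: "minors_ideal Rxyz 1 \<phi> = genideal Rxyz {px, py, pz}"
    and phi_rank: "\<exists>u v. u \<in> {Vx, Vy, Vz} \<and> v \<in> {Vx, Vy, Vz} \<and> u \<noteq> v \<and>
                     rank_modulo Rxyz (genideal Rxyz {pvar u, pvar v}) \<phi> \<le> 1"
    and I_G2: "satisfies_G 2 Rxyz I"
    and I_not_G3: "\<not> satisfies_G 3 Rxyz I"
    and phi_case_I: "case_I n \<phi>"
    and phi'_blocks: "phi' n \<phi> = diag_block_mat
          [transpose_mat (Lblock (n - 3)), mat 1 1 (\<lambda>_. pconst a * px + pconst b * py)]"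
    and Bm: "is_B_matrix n \<phi> Bm"
    and w0: "pw 0 \<notin> minors_ideal (Sring n) 2 Bm"
  shows "symbolic_square (B_ring n \<phi>) (K_bar n \<phi> Bm) = N3_ideal n \<phi> Bm a b"
proof -
  define m where "m = n - 3"
  have nm: "n = m + 3" and m2: "2 \<le> m" using n by (auto simp: m_def)
  have "phi' (m + 3) \<phi> = diag_block_mat
      [transpose_mat (Lblock m), mat 1 1 (\<lambda>_. pconst a * px + pconst b * py)]"
    using phi'_blocks unfolding m_def[symmetric] unfolding nm .
  note ent = phi'_entry[OF this]
  have phi0m: "\<phi> $$ (0, m) = pz" using phi_case_I by (simp add: case_I_def m_def)
  have "\<forall>j. \<exists>u v. j < m \<longrightarrow> \<phi> $$ (0, j) = pconst u * px + pconst v * py"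
    using phi_case_I unfolding case_I_def m_def by (metis linear_form_xyE)
  then obtain \<alpha> \<beta> where ab: "\<And>j. j < m \<Longrightarrow> \<phi> $$ (0, j) = pconst (\<alpha> j) * px + pconst (\<beta> j) * py" by metis
  \<comment> \<open>For a = b = 0 the column with the entry z would be z times a unit vector.\<close>
  have "\<not> (a = 0 \<and> b = 0)"
  proof
    assume z: "a = 0 \<and> b = 0"
    have "\<phi> $$ (i, m) = 0" if "0 < i" "i < n" for i
      using ent[of "i - 1" m] that z nm by (simp add: pconst_simps)
    moreover have "\<And>i. i < n \<Longrightarrow> vars (f $ i) \<subseteq> {Vx, Vy, Vz}" using f_homogeneous by auto
    ultimately show False
      using presentation_column_not_monomial[OF phi_presents f_dim _ _ phi0m] phi_dim nm n mu_I f_generates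
      by simp
  qed
  then obtain c d where cd: "a * d + b * c = 1"
    by (metis add.right_neutral add_0 mult_zero_left mult_zero_right right_inverse)
  have l_row_j: "l_row n \<phi> $$ (0, j) = px * (pw (Suc j) + pconst (\<alpha> j) * pw 0) + py * (pw (Suc (Suc j)) + pconst (\<beta> j) * pw 0)"
    and l_row_m: "l_row n \<phi> $$ (0, m) = pz * pw 0 + (pconst a * px + pconst b * py) * pw (m + 2)"
    if "j < m" for j
  proof -
    have l: "l_row n \<phi> $$ (0, j) = pw 0 * \<phi> $$ (0, j) + (\<Sum>i<m + 2. pw (Suc i) * \<phi> $$ (Suc i, j))" if "j \<le> m" for j
    proof -
      have "{..<n} = {..<Suc (m + 2)}" using nm by simp
      moreover have "l_row n \<phi> $$ (0, j) = (\<Sum>i<n. pw i * \<phi> $$ (i, j))"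
        by (rule l_row_entry) (use that phi_dim nm in auto)
      ultimately show ?thesis by (simp only: sum.lessThan_Suc_shift)
    qed
    have "(\<Sum>i<m + 2. pw (Suc i) * \<phi> $$ (Suc i, j))
        = (\<Sum>i<m + 2. (if i = j then pw (Suc j) * px else 0) + (if i = Suc j then pw (Suc (Suc j)) * py else 0))"
      by (rule sum.cong) (use that ent in auto)
    then show "l_row n \<phi> $$ (0, j) = px * (pw (Suc j) + pconst (\<alpha> j) * pw 0) + py * (pw (Suc (Suc j)) + pconst (\<beta> j) * pw 0)"
      using that l[of j] ab[of j] by (simp add: sum.distrib algebra_simps)
    have "(\<Sum>i<m + 2. pw (Suc i) * \<phi> $$ (Suc i, m))
        = (\<Sum>i<m + 2. if i = Suc m then pw (m + 2) * (pconst a * px + pconst b * py) else 0)"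
      by (rule sum.cong) (use ent in auto)
    then show "l_row n \<phi> $$ (0, m) = pz * pw 0 + (pconst a * px + pconst b * py) * pw (m + 2)"
      using l[of m] phi0m by (simp add: algebra_simps)
  qed
  note l_row_m = l_row_m[of 0]
  have B1: "Bm \<in> carrier_mat 3 (n - 2)" and B2: "entries_in Bm (carrier (poly_ring (Vw ` {..<n})))"
    and Bl: "l_row n (phi'' n \<phi>) = mat_of_row (vec_of_list [px, py, pz * pw 0]) * Bm"
    using Bm unfolding is_B_matrix_def by blast+
  have Bdim: "Bm \<in> carrier_mat 3 (m + 1)" using B1 nm by simp
  have Bvars: "vars (Bm $$ (r, j)) \<subseteq> Vw ` {..<n}" if "r < 3" "j \<le> m" for r j
    using B2 Bdim that unfolding entries_in_def by (metis carrier_matD less_Suc_eq_le mem_poly_ring Suc_eq_plus1)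
  have comb: "l_row n \<phi> $$ (0, j) = px * Bm $$ (0, j) + py * Bm $$ (1, j) + pz * pw 0 * Bm $$ (2, j)" if j: "j \<le> m" for j
  proof -
    have "l_row n \<phi> $$ (0, j) = l_row n (phi'' n \<phi>) $$ (0, j)"
      using j phi_dim nm by (subst (1 2) l_row_entry) (auto simp: phi''_def)
    also have "\<dots> = px * Bm $$ (0, j) + py * Bm $$ (1, j) + pz * pw 0 * Bm $$ (2, j)"
      unfolding Bl using j Bdim by (simp add: scalar_prod_def numeral_3_eq_3 numeral_2_eq_2)
    finally show ?thesis .
  qed
  have uniq: "Bm $$ (0, j) = q0" "Bm $$ (1, j) = q1" "Bm $$ (2, j) = q2"
    if "j \<le> m" "vars q0 \<subseteq> Vw ` {..<n}" "vars q1 \<subseteq> Vw ` {..<n}" "vars q2 \<subseteq> Vw ` {..<n}"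
      "l_row n \<phi> $$ (0, j) = px * q0 + py * q1 + pz * pw 0 * q2" for j q0 q1 q2
    using w_linear_comb_unique[of "\<lambda>i. if i < 3 then Bm $$ (i, j) else 0" n "\<lambda>i. if i = 0 then q0 else if i = 1 then q1 else q2"]
      that comb[of j] Bvars by simp_all
  have Bj: "Bm $$ (0, j) = pw (Suc j) + pconst (\<alpha> j) * pw 0" "Bm $$ (1, j) = pw (Suc (Suc j)) + pconst (\<beta> j) * pw 0"
    "Bm $$ (2, j) = 0" if "j < m" for j
    using uniq[of j "pw (Suc j) + pconst (\<alpha> j) * pw 0" "pw (Suc (Suc j)) + pconst (\<beta> j) * pw 0" 0]
      l_row_j[OF that] that nm by simp_all
  have Bend: "Bm $$ (0, m) = pconst a * pw (m + 2)" "Bm $$ (1, m) = pconst b * pw (m + 2)" "Bm $$ (2, m) = 1"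
    using uniq[of m "pconst a * pw (m + 2)" "pconst b * pw (m + 2)" 1] l_row_m nm m2
    by (simp_all add: algebra_simps)
  \<comment> \<open>Otherwise the difference of two 2x2 minors, each an entry times the 1 in the last row, is a nonzero multiple of w_0.\<close>
  have \<beta>: "\<beta> j = \<alpha> (Suc j)" if j: "Suc j < m" for j
  proof (rule ccontr)
    assume ne: "\<beta> j \<noteq> \<alpha> (Suc j)"
    let ?G = "{Bm $$ (p, r) * Bm $$ (q, s) - Bm $$ (p, s) * Bm $$ (q, r) | p q r s.
      p < q \<and> q < dim_row Bm \<and> r < s \<and> s < dim_col Bm}"
    have sub: "?G \<subseteq> carrier (Sring n)"
    proof
      fix x assume "x \<in> ?G"
      then obtain p q r s where x: "x = Bm $$ (p, r) * Bm $$ (q, s) - Bm $$ (p, s) * Bm $$ (q, r)"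
        "p < 3" "q < 3" "r \<le> m" "s \<le> m" using Bdim by fastforce
      have "Vw ` {..<n} \<subseteq> {Vx, Vy, Vz} \<union> Vw ` {..<n}" by blast
      then have "vars (Bm $$ (p, r)) \<subseteq> {Vx, Vy, Vz} \<union> Vw ` {..<n}" "vars (Bm $$ (p, s)) \<subseteq> {Vx, Vy, Vz} \<union> Vw ` {..<n}"
        "vars (Bm $$ (q, r)) \<subseteq> {Vx, Vy, Vz} \<union> Vw ` {..<n}" "vars (Bm $$ (q, s)) \<subseteq> {Vx, Vy, Vz} \<union> Vw ` {..<n}"
        using Bvars x by blast+
      then show "x \<in> carrier (Sring n)" unfolding x mem_poly_ring by (intro vars_closed)
    qed
    interpret R: cring "Sring n :: 'k mpoly ring" by (rule cring_poly_ring)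
    have iM: "ideal (minors_ideal (Sring n) 2 Bm) (Sring n)"
      unfolding minors_ideal_two by (rule R.genideal_ideal[OF sub])
    have G: "?G \<subseteq> minors_ideal (Sring n) 2 Bm"
      unfolding minors_ideal_two by (rule R.genideal_self[OF sub])
    have "Bm $$ (1, j) * Bm $$ (2, m) - Bm $$ (1, m) * Bm $$ (2, j) \<in> ?G"
      "Bm $$ (0, Suc j) * Bm $$ (2, m) - Bm $$ (0, m) * Bm $$ (2, Suc j) \<in> ?G"
    proof -
      have "1 < (2::nat)" "0 < (2::nat)" "2 < dim_row Bm" "j < m" "m < dim_col Bm" using Bdim j by auto
      then show "Bm $$ (1, j) * Bm $$ (2, m) - Bm $$ (1, m) * Bm $$ (2, j) \<in> ?G"
        "Bm $$ (0, Suc j) * Bm $$ (2, m) - Bm $$ (0, m) * Bm $$ (2, Suc j) \<in> ?G"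
        using j by blast+
    qed
    note this[THEN subsetD[OF G]]
    moreover have "Bm $$ (1, j) * Bm $$ (2, m) - Bm $$ (1, m) * Bm $$ (2, j) = Bm $$ (1, j)"
      "Bm $$ (0, Suc j) * Bm $$ (2, m) - Bm $$ (0, m) * Bm $$ (2, Suc j) = Bm $$ (0, Suc j)"
      using j Bj(3)[of j] Bj(3)[of "Suc j"] Bend(3) by simp_all
    ultimately have "Bm $$ (1, j) - Bm $$ (0, Suc j) \<in> minors_ideal (Sring n) 2 Bm"
      using poly_ideal_closed(7)[OF iM] by metis
    then have "pconst (1 / (\<beta> j - \<alpha> (Suc j))) * (Bm $$ (1, j) - Bm $$ (0, Suc j)) \<in> minors_ideal (Sring n) 2 Bm"
      by (intro poly_ideal_closed(4)[OF iM]) simp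
    also have "Bm $$ (1, j) - Bm $$ (0, Suc j) = pconst (\<beta> j - \<alpha> (Suc j)) * pw 0"
      using j Bj(1)[of "Suc j"] Bj(2)[of j] by (simp add: pconst_simps algebra_simps)
    also have "pconst (1 / (\<beta> j - \<alpha> (Suc j))) * (pconst (\<beta> j - \<alpha> (Suc j)) * pw 0)
        = pconst (1 / (\<beta> j - \<alpha> (Suc j)) * (\<beta> j - \<alpha> (Suc j))) * pw 0"
      by (simp only: pconst_simps(2) mult.assoc)
    also have "\<dots> = pw 0" using ne by (simp add: pconst_simps)
    finally show False using w0 by simp
  qed
  \<comment> \<open>The second row of A is the first one shifted by one place, so a single list of coefficients serves both.\<close>
  define \<gamma> where "\<gamma> j = (if j < m then \<alpha> j else \<beta> (m - 1))" for j
  interpret scroll m \<gamma> a b c d by standard (use m2 cd in auto)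
  have t0: "Bm $$ (0, j) = t j" if "j < m" for j
    using that by (simp add: Bj t_def \<gamma>_def)
  have t1: "Bm $$ (1, j) = t (Suc j)" if j: "j < m" for j
  proof (cases "Suc j < m")
    case True
    then show ?thesis using Bj(2)[OF j] by (simp add: t_def \<gamma>_def \<beta>)
  next
    case False
    then have "m - 1 = j" using j by simp
    then show ?thesis using Bj(2)[OF j] False by (simp add: t_def \<gamma>_def)
  qed
  have S: "Sring n = S" by (simp add: VS_def nm)
  have "{j. j < n - 2} = insert m {j. j < m}" unfolding nm by auto
  then have "l_set n \<phi> = insert (l_row n \<phi> $$ (0, m)) {l_row n \<phi> $$ (0, j) | j. j < m}"
    unfolding l_set_def image_Collect[symmetric] by (simp only: image_insert)
  also have "{l_row n \<phi> $$ (0, j) | j. j < m} = {px * t j + py * t (Suc j) | j. j < m}"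
  proof (intro Collect_cong ex_cong1)
    have "l_row n \<phi> $$ (0, j) = px * t j + py * t (Suc j)" if "j < m" for j
      using l_row_j[OF that] Bj(1,2)[OF that] t0[OF that] t1[OF that] by simp
    then show "x = l_row n \<phi> $$ (0, j) \<and> j < m \<longleftrightarrow> x = px * t j + py * t (Suc j) \<and> j < m" for x j
      by auto
  qed
  finally have L: "l_set n \<phi> = L" using m2 by (simp add: L_def l_row_m g_def w_def)
  have J: "J_ideal n \<phi> = J" unfolding J_ideal_def xyzw0_def J_def S L ..
  have B: "B_ring n \<phi> = B" and cls: "bar n \<phi> = cls"
    unfolding B_ring_def bar_def J S by (rule refl)+
  have A: "A_matrix n Bm $$ (r, s) = Bm $$ (r, s)" if "r < 2" "s \<le> m" for r s
    using that nm by (simp add: A_matrix_def)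
  have minor: "Bm $$ (0, r) * Bm $$ (1, m) - Bm $$ (0, m) * Bm $$ (1, r) = fr r" if "r < m" for r
    unfolding t0[OF that] t1[OF that] Bend fr_def w_def by (simp add: algebra_simps)
  have fr: "frak_a n Bm i = fr i" if i: "i < m" for i
    unfolding frak_a_def using i minor[OF i] A[of 0 i] A[of 1 i] A[of 0 m] A[of 1 m]
    by (subst det_two) (simp_all add: m_def)
  have dimA: "dim_row (A_matrix n Bm) = 2" "dim_col (A_matrix n Bm) = m + 1" using nm by (auto simp: A_matrix_def)
  let ?G = "{A_matrix n Bm $$ (p, r) * A_matrix n Bm $$ (q, s) - A_matrix n Bm $$ (p, s) * A_matrix n Bm $$ (q, r) | p q r s.
      p < q \<and> q < dim_row (A_matrix n Bm) \<and> r < s \<and> s < dim_col (A_matrix n Bm)}"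
  have GV: "?G \<subseteq> V 1"
  proof
    fix x assume "x \<in> ?G"
    then obtain p q r s where x: "x = A_matrix n Bm $$ (p, r) * A_matrix n Bm $$ (q, s) - A_matrix n Bm $$ (p, s) * A_matrix n Bm $$ (q, r)"
      and "p < q" "q < 2" and rs: "r < s" "s \<le> m" unfolding dimA by fastforce
    then have pq: "p = 0" "q = 1" by auto
    have x: "x = Bm $$ (0, r) * Bm $$ (1, s) - Bm $$ (0, s) * Bm $$ (1, r)" using x rs by (simp add: pq A)
    show "x \<in> V 1"
    proof (cases "s = m")
      case True
      then show ?thesis using x rs minor fr_in_V1 by simp
    next
      case False
      then have "x = t r * t (Suc s) - t (Suc r) * t s" using x rs t0[of r] t0[of s] t1[of r] t1[of s]
        by (simp add: mult.commute)
      then show ?thesis using rel_minor[of r s] J_subset_V rs False by auto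
    qed
  qed
  moreover have "V 1 \<subseteq> carrier S" by (auto simp: V_def)
  ultimately have GS: "?G \<subseteq> carrier S" by (rule subset_trans)
  interpret R: cring S by (rule cring_poly_ring)
  have zwS: "{pz * pw 0} \<subseteq> carrier S" by simp
  define K where "K = K_ideal n \<phi> Bm"
  have K_eq: "K = genideal S L <+>\<^bsub>S\<^esub> genideal S ?G <+>\<^bsub>S\<^esub> genideal S {pz * pw 0}"
    unfolding K_def K_ideal_def S L minors_ideal_two ..
  note ideals = R.genideal_ideal[OF L_carrier] R.genideal_ideal[OF GS] R.genideal_ideal[OF zwS]
  have iK: "ideal K S" unfolding K_eq by (intro R.add_ideals ideals)
  have sub: "X \<subseteq> V' \<longleftrightarrow> L \<subseteq> V' \<and> ?G \<subseteq> V' \<and> pz * pw 0 \<in> V'" if "X = K" "ideal V' S" for X V'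
    using that ideals
    by (simp only: K_eq R.ideal_sum_subset_iff R.add_ideals R.genideal_subset_iff L_carrier GS zwS) simp
  have "fr i \<in> K" if i: "i < m" for i
  proof -
    have "fr i = A_matrix n Bm $$ (0, i) * A_matrix n Bm $$ (1, m) - A_matrix n Bm $$ (0, m) * A_matrix n Bm $$ (1, i)"
      using i minor by (simp add: A)
    moreover have "0 < (1::nat)" "1 < dim_row (A_matrix n Bm)" "m < dim_col (A_matrix n Bm)" using dimA by auto
    ultimately have "fr i \<in> ?G" using i by blast
    then show ?thesis using sub[OF refl iK] by blast
  qed
  moreover have "pz * pw 0 \<in> K" using sub[OF refl iK] by blast
  moreover have "K \<subseteq> V 1"
    using sub[OF refl ideal_V] L_subset_J J_subset_V GV zw_in_V1 by blast
  ultimately have main: "symbolic_square B (cls ` K) = N3"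
    by (rule symbolic_square_eq_N3[OF iK])
  have "{bar n \<phi> (- pconst a * pw (n - 1) * frak_a n Bm (i + 1) + pconst b * pw (n - 1) * frak_a n Bm i) | i. i < n - 4}
      = {cls (q2 i) | i. i < m - 1}"
  proof -
    have "bar n \<phi> (- pconst a * pw (n - 1) * frak_a n Bm (i + 1) + pconst b * pw (n - 1) * frak_a n Bm i) = cls (q2 i)"
      if "i < m - 1" for i
    proof -
      have "i < m" "i + 1 < m" using that by auto
      moreover have "pw (n - 1) = w" by (simp add: nm w_def)
      ultimately show ?thesis unfolding cls q2_def by (simp only: fr Suc_eq_plus1)
    qed
    moreover have "n - 4 = m - 1" using nm by simp
    ultimately show ?thesis by (simp only:) blast
  qed
  then have "N3_ideal n \<phi> Bm a b = N3" unfolding N3_ideal_def N3_def B cls by simp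
  then show ?thesis using main unfolding K_bar_def B cls K_def by simp
qed

end
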